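(* Let $Q$ be a quiver whose underlying graph is $\mathbb{D}_n$ ($n\ge4$), with vertices labeled so that vertex $2$ is joined to $1$, $3$ and $n$, and $3,4,\dots,n-1$ form a chain $3-4-\dots-(n-1)$; the arrow between $2$ and $n$ is oriented $2\to n$, and the other arrows are oriented arbitrarily. Let $\alpha\in\mathbb{N}^{Q_0}$. Then the following algorithm gives the generic decomposition of $\alpha$. Let $R$ be the generic representation of dimension vector $(\alpha_1,\dots,\alpha_{n-1})$ of the $\mathbb{A}_{n-1}$ quiver $Q'$ obtained by dropping vertex $n$, and decompose $R$ into indecomposables (listed with multiplicity). Let $Z_1,Z_2,\dots$ be those indecomposable summands having dimension $0$ at vertex $2$. The remaining summands have dimension $1$ at vertex $2$ and are divided into two classes: if the arrow between $1$ and $2$ is $1\to2$, the first class consists of those with dimension $1$ at vertex $1$ and the second class of those with dimension $0$ at vertex $1$; if the arrow is $2\to1$, the first class consists of those with dimension $0$ at vertex $1$ and the second class of those with dimension $1$ at vertex $1$. Order the first class as $A_1,\dots,A_M$ and the second class as $B_1,\dots,B_N$, so that $\operatorname{Hom}_{Q'}(A_i,A_j)\neq0$ and $\operatorname{Hom}_{Q'}(B_i,B_j)\ne0$ whenever $j\leq i$. Form rows numbered $1,\dots,c$, where $c=\alpha_n$, each containing one copy of the simple $S_n$ at vertex $n$; for $i\leq\min(M,c)$ place $A_i$ in row $i$. Then place $B_1,B_2,\dots$ successively in rows $c,c-1,c-2,\dots$ ($B_j$ in row $c+1-j$), and stop before placing $B_{t+1}$ as soon as one of the following holds: (a) $t=c$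 (all rows have been used); (b) $t=N$ (there are no more $B_j$); (c) row $c-t$ contains $A_{c-t}$ (that is, $c-t\leq M$) and there is a non-zero morphism from $B_{t+1}$ to $A_{c-t}$. The generic decomposition of $\alpha$ then consists of: the dimension vectors of all $Z_i$, of all $A_i$ with $i>c$, and of all $B_j$ with $j>t$ (each extended by $0$ at vertex $n$); and, for each row $i=1,\dots,c$, the sum of $\operatorname{\mathbf{dim}}S_n$ with the dimension vectors of the representations placed in row $i$ (i.e. $A_i$ if $i\leq M$, and $B_{c+1-i}$ if $c+1-i\leq t$).
   Context: Everything is over $\mathbb{C}$. For a quiver $Q$ and a dimension vector $\alpha$, $\operatorname{Rep}(Q,\alpha)=\bigoplus_{a\in Q_1}\operatorname{Hom}(\mathbb{C}^{\alpha_{ta}},\mathbb{C}^{\alpha_{ha}})$ with the base-change action of $\prod_x\operatorname{GL}(\alpha_x)$. For Dynkin quivers every $\operatorname{Rep}(Q,\alpha)$ has a dense orbit; a representation in it is called the generic representation of dimension vector $\alpha$. The generic decomposition $\alpha=\alpha_1\oplus\dots\oplus\alpha_t$ is the list (with multiplicities) of dimension vectors of the indecomposable summands of the generic representation. *)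

theory Defs
  imports
    "HOL-Analysis.Abstract_Topology"
    "Graph_Theory.Digraph_Component"
    "Jordan_Normal_Form.Matrix"
begin

text \<open>A quiver is a finite directed multigraph. Dimension vectors are total functions that vanish
  off the vertex set, so that a dimension vector of a quiver with a vertex deleted, read as a
  dimension vector of the whole quiver, is extended by \<open>0\<close>.\<close>

definition dim_vectors :: "('v, 'b) pre_digraph \<Rightarrow> ('v \<Rightarrow> nat) set" where
  "dim_vectors Q = {\<alpha>. \<forall>x. x \<notin> verts Q \<longrightarrow> \<alpha> x = 0}"

definition rep_space :: "('v, 'b) pre_digraph \<Rightarrow> ('v \<Rightarrow> nat) \<Rightarrow> ('b \<Rightarrow> complex mat) set" where
  "rep_space Q \<alpha> = (\<Pi>\<^sub>E a\<in>arcs Q. carrier_mat (\<alpha> (head Q a)) (\<alpha> (tail Q a)))"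

text \<open>The dimension vector is stored separately because the matrices do not determine it at
  vertices without arrows.\<close>

record ('v, 'b) quiver_rep =
  dimv :: "'v \<Rightarrow> nat"
  maps :: "'b \<Rightarrow> complex mat"

definition is_rep :: "('v, 'b) pre_digraph \<Rightarrow> ('v, 'b) quiver_rep \<Rightarrow> bool" where
  "is_rep Q X \<longleftrightarrow> dimv X \<in> dim_vectors Q \<and> maps X \<in> rep_space Q (dimv X)"

definition Hom_rep ::
    "('v, 'b) pre_digraph \<Rightarrow> ('v, 'b) quiver_rep \<Rightarrow> ('v, 'b) quiver_rep \<Rightarrow> ('v \<Rightarrow> complex mat) set" where
  "Hom_rep Q X Y = {\<phi> \<in> (\<Pi>\<^sub>E x\<in>verts Q. carrier_mat (dimv Y x) (dimv X x)).
     \<forall>a\<in>arcs Q. \<phi> (head Q a) * maps X a = maps Y a * \<phi> (tail Q a)}"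

definition nonzero_Hom ::
    "('v, 'b) pre_digraph \<Rightarrow> ('v, 'b) quiver_rep \<Rightarrow> ('v, 'b) quiver_rep \<Rightarrow> bool" where
  "nonzero_Hom Q X Y \<longleftrightarrow>
     (\<exists>\<phi>\<in>Hom_rep Q X Y. \<exists>x\<in>verts Q. \<phi> x \<noteq> 0\<^sub>m (dimv Y x) (dimv X x))"

definition iso_rep ::
    "('v, 'b) pre_digraph \<Rightarrow> ('v, 'b) quiver_rep \<Rightarrow> ('v, 'b) quiver_rep \<Rightarrow> bool" where
  "iso_rep Q X Y \<longleftrightarrow> (\<exists>\<phi>\<in>Hom_rep Q X Y. \<forall>x\<in>verts Q. invertible_mat (\<phi> x))"

definition direct_sum ::
    "('v, 'b) pre_digraph \<Rightarrow> ('v, 'b) quiver_rep list \<Rightarrow> ('v, 'b) quiver_rep" where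
  "direct_sum Q Xs =
     \<lparr>dimv = (\<lambda>x. \<Sum>X\<leftarrow>Xs. dimv X x),
      maps = (\<lambda>a\<in>arcs Q. diag_block_mat (map (\<lambda>X. maps X a) Xs))\<rparr>"

definition zero_rep :: "('v, 'b) pre_digraph \<Rightarrow> ('v, 'b) quiver_rep \<Rightarrow> bool" where
  "zero_rep Q X \<longleftrightarrow> (\<forall>x\<in>verts Q. dimv X x = 0)"

definition indecomposable_rep :: "('v, 'b) pre_digraph \<Rightarrow> ('v, 'b) quiver_rep \<Rightarrow> bool" where
  "indecomposable_rep Q X \<longleftrightarrow> is_rep Q X \<and> \<not> zero_rep Q X \<and>
     (\<forall>Y Z. is_rep Q Y \<and> is_rep Q Z \<and> iso_rep Q X (direct_sum Q [Y, Z])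
        \<longrightarrow> zero_rep Q Y \<or> zero_rep Q Z)"

definition indec_decomposition ::
    "('v, 'b) pre_digraph \<Rightarrow> ('v, 'b) quiver_rep \<Rightarrow> ('v, 'b) quiver_rep list \<Rightarrow> bool" where
  "indec_decomposition Q X Xs \<longleftrightarrow>
     (\<forall>Y\<in>set Xs. indecomposable_rep Q Y) \<and> iso_rep Q X (direct_sum Q Xs)"

text \<open>Regular functions on the affine space of representations. The Zariski topology is generated
  by their non-vanishing loci, which form a base of it.\<close>

inductive_set regular_functions ::
    "('v, 'b) pre_digraph \<Rightarrow> ('v \<Rightarrow> nat) \<Rightarrow> (('b \<Rightarrow> complex mat) \<Rightarrow> complex) set"
  for Q :: "('v, 'b) pre_digraph" and \<alpha> :: "'v \<Rightarrow> nat" where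
  const: "(\<lambda>R. c) \<in> regular_functions Q \<alpha>"
| coord: "a \<in> arcs Q \<Longrightarrow> i < \<alpha> (head Q a) \<Longrightarrow> j < \<alpha> (tail Q a) \<Longrightarrow>
    (\<lambda>R. R a $$ (i, j)) \<in> regular_functions Q \<alpha>"
| add: "f \<in> regular_functions Q \<alpha> \<Longrightarrow> g \<in> regular_functions Q \<alpha> \<Longrightarrow>
    (\<lambda>R. f R + g R) \<in> regular_functions Q \<alpha>"
| mult: "f \<in> regular_functions Q \<alpha> \<Longrightarrow> g \<in> regular_functions Q \<alpha> \<Longrightarrow>
    (\<lambda>R. f R * g R) \<in> regular_functions Q \<alpha>"

definition zariski :: "('v, 'b) pre_digraph \<Rightarrow> ('v \<Rightarrow> nat) \<Rightarrow> ('b \<Rightarrow> complex mat) topology" where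
  "zariski Q \<alpha> =
     topology_generated_by ((\<lambda>f. {R \<in> rep_space Q \<alpha>. f R \<noteq> 0}) ` regular_functions Q \<alpha>)"

text \<open>The family \<open>h\<close> is the inverse of the group element \<open>g\<close>.\<close>

definition orbit_rep ::
    "('v, 'b) pre_digraph \<Rightarrow> ('v \<Rightarrow> nat) \<Rightarrow> ('b \<Rightarrow> complex mat) \<Rightarrow> ('b \<Rightarrow> complex mat) set" where
  "orbit_rep Q \<alpha> R = {\<lambda>a\<in>arcs Q. g (head Q a) * R a * h (tail Q a) | g h.
     \<forall>x\<in>verts Q. g x \<in> carrier_mat (\<alpha> x) (\<alpha> x) \<and> h x \<in> carrier_mat (\<alpha> x) (\<alpha> x) \<and>
       inverts_mat (g x) (h x) \<and> inverts_mat (h x) (g x)}"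

definition generic_rep ::
    "('v, 'b) pre_digraph \<Rightarrow> ('v \<Rightarrow> nat) \<Rightarrow> ('v, 'b) quiver_rep \<Rightarrow> bool" where
  "generic_rep Q \<alpha> X \<longleftrightarrow> is_rep Q X \<and> dimv X = \<alpha> \<and>
     zariski Q \<alpha> closure_of orbit_rep Q \<alpha> (maps X) = rep_space Q \<alpha>"

text \<open>A dense orbit is unique and decompositions are unique up to order and isomorphism
  (Krull--Schmidt), so at most one multiset \<open>D\<close> satisfies this predicate.\<close>

definition generic_decomposition ::
    "('v, 'b) pre_digraph \<Rightarrow> ('v \<Rightarrow> nat) \<Rightarrow> ('v \<Rightarrow> nat) multiset \<Rightarrow> bool" where
  "generic_decomposition Q \<alpha> D \<longleftrightarrow>
     (\<exists>X Xs. generic_rep Q \<alpha> X \<and> indec_decomposition Q X Xs \<and> D = mset (map dimv Xs))"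

definition D_edges :: "nat \<Rightarrow> nat set set" where
  "D_edges n = {{2, 1}, {2, 3}, {2, n}} \<union> {{i, i + 1} | i. 3 \<le> i \<and> i + 1 \<le> n - 1}"

definition type_D_quiver :: "nat \<Rightarrow> (nat, 'b) pre_digraph \<Rightarrow> bool" where
  "type_D_quiver n Q \<longleftrightarrow> fin_digraph Q \<and> verts Q = {1..n} \<and>
     bij_betw (\<lambda>a. {tail Q a, head Q a}) (arcs Q) (D_edges n)"

definition first_class :: "(nat, 'b) pre_digraph \<Rightarrow> (nat, 'b) quiver_rep \<Rightarrow> bool" where
  "first_class Q X \<longleftrightarrow> dimv X 2 = 1 \<and> dimv X 1 = (if 1 \<rightarrow>\<^bsub>Q\<^esub> 2 then 1 else 0)"

definition second_class :: "(nat, 'b) pre_digraph \<Rightarrow> (nat, 'b) quiver_rep \<Rightarrow> bool" where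
  "second_class Q X \<longleftrightarrow> dimv X 2 = 1 \<and> dimv X 1 = (if 1 \<rightarrow>\<^bsub>Q\<^esub> 2 then 0 else 1)"

definition hom_ordered :: "('v, 'b) pre_digraph \<Rightarrow> ('v, 'b) quiver_rep list \<Rightarrow> bool" where
  "hom_ordered Q Xs \<longleftrightarrow> (\<forall>i<length Xs. \<forall>j\<le>i. nonzero_Hom Q (Xs ! i) (Xs ! j))"

definition admissible_orders ::
    "(nat, 'b) pre_digraph \<Rightarrow> (nat, 'b) quiver_rep list \<Rightarrow>
     (nat, 'b) quiver_rep list \<Rightarrow> (nat, 'b) quiver_rep list \<Rightarrow> bool" where
  "admissible_orders Q Xs As Bs \<longleftrightarrow>
     mset As = filter_mset (first_class Q) (mset Xs) \<and>
     mset Bs = filter_mset (second_class Q) (mset Xs) \<and>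
     hom_ordered Q As \<and> hom_ordered Q Bs"

text \<open>List positions start at \<open>0\<close>, so \<open>Bs ! t\<close> is \<open>B\<^sub>t\<^sub>+\<^sub>1\<close> and \<open>As ! (c - t - 1)\<close> is the
  representation \<open>A\<^sub>c\<^sub>-\<^sub>t\<close> in row \<open>c - t\<close>. Since \<open>t\<close> is least, the third condition matters only for
  \<open>t < c\<close> and \<open>t < length Bs\<close>, where both positions are meaningful.\<close>

definition stop_index ::
    "('v, 'b) pre_digraph \<Rightarrow> nat \<Rightarrow> ('v, 'b) quiver_rep list \<Rightarrow> ('v, 'b) quiver_rep list \<Rightarrow> nat" where
  "stop_index Q c As Bs = (LEAST t. t = c \<or> t = length Bs \<or>
     (c - t \<le> length As \<and> nonzero_Hom Q (Bs ! t) (As ! (c - t - 1))))"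

definition row_dim ::
    "nat \<Rightarrow> nat \<Rightarrow> (nat, 'b) quiver_rep list \<Rightarrow> (nat, 'b) quiver_rep list \<Rightarrow> nat \<Rightarrow> nat \<Rightarrow> nat \<Rightarrow> nat" where
  "row_dim n c As Bs t i = (\<lambda>x.
     (if x = n then 1 else 0) +
     (if i \<le> length As then dimv (As ! (i - 1)) x else 0) +
     (if c + 1 - i \<le> t then dimv (Bs ! (c - i)) x else 0))"

definition algorithm_output ::
    "nat \<Rightarrow> (nat, 'b) pre_digraph \<Rightarrow> nat \<Rightarrow> (nat, 'b) quiver_rep list \<Rightarrow>
     (nat, 'b) quiver_rep list \<Rightarrow> (nat, 'b) quiver_rep list \<Rightarrow> (nat \<Rightarrow> nat) multiset" where
  "algorithm_output n Q' c Xs As Bs =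
     (let t = stop_index Q' c As Bs in
        mset (map dimv (filter (\<lambda>X. dimv X 2 = 0) Xs)) +
        mset (map dimv (drop c As)) +
        mset (map dimv (drop t Bs)) +
        mset (map (row_dim n c As Bs t) [1..<c + 1]))"

end

theory Submission
  imports Defs "Jordan_Normal_Form.Determinant"
begin

text \<open>Deleting \<open>n\<close> leaves a chain, whose indecomposable representations are intervals: along the chain
  one can always split off an interval (\<open>chain_retract\<close>). Each summand through vertex \<open>2\<close> is
  one-dimensional there, so a representation of \<open>Q\<close> restricting to the generic representation \<open>R\<close> is a
  matrix \<open>f\<close> with \<open>\<alpha> n\<close> rows whose columns are the \<open>A\<^sub>i\<close> and \<open>B\<^sub>j\<close>; base change at \<open>n\<close> acts by row
  operations and \<open>End R\<close> by those column operations that come from non-zero morphisms. The matrix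
  \<open>f\<close> produced by the algorithm satisfies \<open>{\<gamma> f + f \<kappa>} = \<close> all matrices, with \<open>\<gamma>\<close> a matrix and
  \<open>\<kappa> \<in> End R\<close>. Hence a polynomial vanishing on its orbit vanishes for all \<open>f\<close> over \<open>R\<close>, and, as the
  orbit of \<open>R\<close> is dense, everywhere. Summands in a common row have no morphisms between them that
  are non-zero at \<open>2\<close>, so an idempotent endomorphism of a row is a scalar at \<open>2\<close> and \<open>n\<close> and
  therefore \<open>0\<close> or \<open>1\<close>.\<close>

section \<open>Matrices\<close>

text \<open>A morphism from summand \<open>p\<close> to summand \<open>q\<close> lets a column
  operation carry entries of the column of \<open>q\<close> into the column of \<open>p\<close>.
  Inside a class all summands have the same left end, so for any two of them one of the two possible
  directions carries a non-zero morphism; between the classes, morphisms that are non-zero at 2 can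
  only run from the second to the first. Each class therefore reaches on its own only the entries on
  one side of its positions. This is the origin of the opposite directions of filling: on the other
  side, a row operation trades an entry for that of the partner in the same row, and the partner is
  then on its reachable side. Rule (c) has two roles. As long as it does not apply, a row with two
  summands has no morphism between them that is non-zero at 2, and stays indecomposable. Once it
  applies, the morphism that triggered it gives, after composition inside the classes, all entries
  still missing. The passage from tangent directions to density cannot use the curves themselves as
  a covering of the fibre: they only leave a point of the orbit in every direction, which forces the
  argument with lowest homogeneous parts.\<close>

lemma mult_mat_assoc:
  fixes A B C :: "'a::semiring_0 mat"
  assumes "dim_col A = dim_row B" "dim_col B = dim_row C"
  shows "A * B * C = A * (B * C)"
  using assms by (intro assoc_mult_mat[of _ "dim_row A" "dim_row B" _ "dim_row C" _ "dim_col C"]) auto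

text \<open>Matrices of all sizes share one type, so an empty sum would have no size; the sum is
  taken entrywise and its dimensions are arguments.\<close>

definition mat_sum :: "nat \<Rightarrow> nat \<Rightarrow> ('i \<Rightarrow> 'a::comm_monoid_add mat) \<Rightarrow> 'i set \<Rightarrow> 'a mat" where
  "mat_sum nr nc f I = mat nr nc (\<lambda>ij. \<Sum>k\<in>I. f k $$ ij)"

lemma mat_sum_carrier [simp]: "mat_sum nr nc f I \<in> carrier_mat nr nc"
  and dim_row_mat_sum [simp]: "dim_row (mat_sum nr nc f I) = nr"
  and dim_col_mat_sum [simp]: "dim_col (mat_sum nr nc f I) = nc"
  by (simp_all add: mat_sum_def)

lemma mat_sum_cong: "(\<And>k. k \<in> I \<Longrightarrow> f k = g k) \<Longrightarrow> mat_sum nr nc f I = mat_sum nr nc g I"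
  by (simp add: mat_sum_def cong: sum.cong)

lemma mat_sum_empty [simp]: "mat_sum nr nc f {} = 0\<^sub>m nr nc"
  by (rule eq_matI) (auto simp: mat_sum_def)

lemma mat_sum_insert:
  assumes "finite I" "k \<notin> I" "f k \<in> carrier_mat nr nc"
  shows "mat_sum nr nc f (insert k I) = f k + mat_sum nr nc f I"
  using assms by (intro eq_matI) (auto simp: mat_sum_def)

lemma mult_mat_sum:
  fixes A :: "'a::semiring_0 mat"
  assumes "A \<in> carrier_mat m nr" "\<And>k. k \<in> I \<Longrightarrow> f k \<in> carrier_mat nr nc"
  shows "A * mat_sum nr nc f I = mat_sum m nc (\<lambda>k. A * f k) I"
proof (rule eq_matI)
  fix i j assume "i < dim_row (mat_sum m nc (\<lambda>k. A * f k) I)" "j < dim_col (mat_sum m nc (\<lambda>k. A * f k) I)"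
  then have ij: "i < m" "j < nc" by auto
  have "(A * mat_sum nr nc f I) $$ (i, j) = (\<Sum>l<nr. A $$ (i, l) * (\<Sum>k\<in>I. f k $$ (l, j)))"
    using assms ij by (auto simp: scalar_prod_def mat_sum_def atLeast0LessThan intro!: sum.cong)
  also have "\<dots> = (\<Sum>k\<in>I. \<Sum>l<nr. A $$ (i, l) * f k $$ (l, j))"
    unfolding sum_distrib_left by (rule sum.swap)
  also have "\<dots> = (\<Sum>k\<in>I. (A * f k) $$ (i, j))"
    using assms ij by (intro sum.cong refl) (force simp: scalar_prod_def atLeast0LessThan)
  finally show "(A * mat_sum nr nc f I) $$ (i, j) = mat_sum m nc (\<lambda>k. A * f k) I $$ (i, j)"
    using ij by (simp add: mat_sum_def)
qed (use assms in auto)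

lemma mat_sum_mult:
  fixes A :: "'a::semiring_0 mat"
  assumes "A \<in> carrier_mat nc m" "\<And>k. k \<in> I \<Longrightarrow> f k \<in> carrier_mat nr nc"
  shows "mat_sum nr nc f I * A = mat_sum nr m (\<lambda>k. f k * A) I"
proof (rule eq_matI)
  fix i j assume "i < dim_row (mat_sum nr m (\<lambda>k. f k * A) I)" "j < dim_col (mat_sum nr m (\<lambda>k. f k * A) I)"
  then have ij: "i < nr" "j < m" by auto
  have "(mat_sum nr nc f I * A) $$ (i, j) = (\<Sum>l<nc. (\<Sum>k\<in>I. f k $$ (i, l)) * A $$ (l, j))"
    using assms ij by (auto simp: scalar_prod_def mat_sum_def atLeast0LessThan intro!: sum.cong)
  also have "\<dots> = (\<Sum>k\<in>I. \<Sum>l<nc. f k $$ (i, l) * A $$ (l, j))"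
    unfolding sum_distrib_right by (rule sum.swap)
  also have "\<dots> = (\<Sum>k\<in>I. (f k * A) $$ (i, j))"
    using assms ij by (intro sum.cong refl) (force simp: scalar_prod_def atLeast0LessThan)
  finally show "(mat_sum nr nc f I * A) $$ (i, j) = mat_sum nr m (\<lambda>k. f k * A) I $$ (i, j)"
    using ij by (simp add: mat_sum_def)
qed (use assms in auto)

lemma mat_sum_single:
  assumes "finite I" "k \<in> I" "f k \<in> carrier_mat nr nc"
    "\<And>l. l \<in> I \<Longrightarrow> l \<noteq> k \<Longrightarrow> f l = 0\<^sub>m nr nc"
  shows "mat_sum nr nc f I = f k"
proof (rule eq_matI)
  fix i j assume "i < dim_row (f k)" "j < dim_col (f k)"
  then have ij: "i < nr" "j < nc" using assms by auto
  then have "(\<Sum>l\<in>I. f l $$ (i, j)) = (\<Sum>l\<in>I. if l = k then f k $$ (i, j) else 0)"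
    using assms(4) by (intro sum.cong) auto
  then show "mat_sum nr nc f I $$ (i, j) = f k $$ (i, j)"
    using assms ij by (simp add: mat_sum_def)
qed (use assms in auto)

lemma mat_sum_UNION:
  assumes "finite W" "\<And>w. w \<in> W \<Longrightarrow> finite (J w)"
    "\<And>w w'. w \<in> W \<Longrightarrow> w' \<in> W \<Longrightarrow> w \<noteq> w' \<Longrightarrow> J w \<inter> J w' = {}"
  shows "mat_sum nr nc f (\<Union>w\<in>W. J w) = mat_sum nr nc (\<lambda>w. mat_sum nr nc f (J w)) W"
  using assms by (intro eq_matI) (auto simp: mat_sum_def sum.UNION_disjoint)

text \<open>With the next three definitions: inclusions and projections that exhibit the space of
  dimension \<open>d + r\<close> as the sum of its first \<open>d\<close> and its last
  \<open>r\<close> coordinates.\<close>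

definition inl_mat :: "nat \<Rightarrow> nat \<Rightarrow> complex mat" where
  "inl_mat d r = mat (d + r) d (\<lambda>(i, j). if i = j then 1 else 0)"
definition inr_mat :: "nat \<Rightarrow> nat \<Rightarrow> complex mat" where
  "inr_mat d r = mat (d + r) r (\<lambda>(i, j). if i = d + j then 1 else 0)"
definition prl_mat :: "nat \<Rightarrow> nat \<Rightarrow> complex mat" where
  "prl_mat d r = mat d (d + r) (\<lambda>(i, j). if i = j then 1 else 0)"
definition prr_mat :: "nat \<Rightarrow> nat \<Rightarrow> complex mat" where
  "prr_mat d r = mat r (d + r) (\<lambda>(i, j). if j = d + i then 1 else 0)"

lemmas block_mat_defs = inl_mat_def inr_mat_def prl_mat_def prr_mat_def

lemma block_mat_carriers [simp]:
  "inl_mat d r \<in> carrier_mat (d + r) d" "inr_mat d r \<in> carrier_mat (d + r) r"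
  "prl_mat d r \<in> carrier_mat d (d + r)" "prr_mat d r \<in> carrier_mat r (d + r)"
  by (simp_all add: block_mat_defs)

lemma block_mat_dims [simp]:
  "dim_row (inl_mat d r) = d + r" "dim_col (inl_mat d r) = d"
  "dim_row (inr_mat d r) = d + r" "dim_col (inr_mat d r) = r"
  "dim_row (prl_mat d r) = d" "dim_col (prl_mat d r) = d + r"
  "dim_row (prr_mat d r) = r" "dim_col (prr_mat d r) = d + r"
  by (simp_all add: block_mat_defs)

lemma block_mat_relations:
  "prl_mat d r * inl_mat d r = 1\<^sub>m d" "prr_mat d r * inr_mat d r = 1\<^sub>m r"
  "prl_mat d r * inr_mat d r = 0\<^sub>m d r" "prr_mat d r * inl_mat d r = 0\<^sub>m r d"
  "inl_mat d r * prl_mat d r + inr_mat d r * prr_mat d r = 1\<^sub>m (d + r)"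
proof -
  show "inl_mat d r * prl_mat d r + inr_mat d r * prr_mat d r = 1\<^sub>m (d + r)"
  proof (rule eq_matI)
    fix i j assume "i < dim_row (1\<^sub>m (d + r) :: complex mat)" "j < dim_col (1\<^sub>m (d + r) :: complex mat)"
    then have ij: "i < d + r" "j < d + r" by auto
    \<comment> \<open>The Kronecker delta is solved for the summation variable \<open>k\<close>, so
      that the sum collapses; the condition \<open>i \<ge> d\<close> guards the truncated
      subtraction.\<close>
    have *: "(i = d + k) \<longleftrightarrow> (k = i - d \<and> i \<ge> d)" for i k by auto
    show "(inl_mat d r * prl_mat d r + inr_mat d r * prr_mat d r) $$ (i, j) = 1\<^sub>m (d + r) $$ (i, j)"
      using ij unfolding block_mat_defs
      by (cases "i < d"; cases "j < d")
        (auto simp: scalar_prod_def if_distrib[where f = "\<lambda>x. x * _"] if_distrib[where f = "(*) _"] * cong: if_cong)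
  qed auto
qed (rule eq_matI; auto simp: block_mat_defs scalar_prod_def if_distrib[where f = "\<lambda>x. x * _"] if_distrib[where f = "(*) _"] sum.delta cong: if_cong)+

text \<open>Here and in the next three lemmas: naturality of the four maps with respect to
  block-diagonal matrices. In \<open>direct_sum_biproduct\<close> it makes them morphisms of
  representations.\<close>

lemma four_block_diag_inl:
  assumes "A \<in> carrier_mat m d" "B \<in> carrier_mat p r"
  shows "four_block_mat A (0\<^sub>m m r) (0\<^sub>m p d) B * inl_mat d r = inl_mat m p * A"
  using assms by (intro eq_matI) (auto simp: block_mat_defs scalar_prod_def if_distrib[where f = "\<lambda>x. x * _"] if_distrib[where f = "(*) _"] sum.delta cong: if_cong)

lemma four_block_diag_inr:
  assumes "A \<in> carrier_mat m d" "B \<in> carrier_mat p r"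
  shows "four_block_mat A (0\<^sub>m m r) (0\<^sub>m p d) B * inr_mat d r = inr_mat m p * B"
proof (rule eq_matI)
  fix i j assume ij: "i < dim_row (inr_mat m p * B)" "j < dim_col (inr_mat m p * B)"
  have *: "(i = m + k) \<longleftrightarrow> (k = i - m \<and> i \<ge> m)" for k by auto
  show "(four_block_mat A (0\<^sub>m m r) (0\<^sub>m p d) B * inr_mat d r) $$ (i, j) = (inr_mat m p * B) $$ (i, j)"
    using assms ij by (cases "i < m")
     (auto simp: block_mat_defs scalar_prod_def * if_distrib[where f = "\<lambda>x. x * _"] if_distrib[where f = "(*) _"] sum.delta cong: if_cong)
qed (use assms in auto)

lemma prl_four_block_diag:
  assumes "A \<in> carrier_mat m d" "B \<in> carrier_mat p r"
  shows "prl_mat m p * four_block_mat A (0\<^sub>m m r) (0\<^sub>m p d) B = A * prl_mat d r"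
proof (rule eq_matI)
  fix i j assume "i < dim_row (A * prl_mat d r)" "j < dim_col (A * prl_mat d r)"
  then have ij: "i < m" "j < d + r" using assms by auto
  have "(prl_mat m p * four_block_mat A (0\<^sub>m m r) (0\<^sub>m p d) B) $$ (i, j)
      = (\<Sum>k = 0..<m + p. prl_mat m p $$ (i, k) * four_block_mat A (0\<^sub>m m r) (0\<^sub>m p d) B $$ (k, j))"
    using assms ij by (auto simp: scalar_prod_def)
  also have "\<dots> = (\<Sum>k = 0..<m + p. if k = i then (if j < d then A $$ (i, j) else 0) else 0)"
    using assms ij by (intro sum.cong refl) (auto simp: block_mat_defs)
  also have "\<dots> = (A * prl_mat d r) $$ (i, j)"
    using assms ij
    by (auto simp: block_mat_defs scalar_prod_def if_distrib[where f = "(*) _"] sum.delta cong: if_cong)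
  finally show "(prl_mat m p * four_block_mat A (0\<^sub>m m r) (0\<^sub>m p d) B) $$ (i, j) = (A * prl_mat d r) $$ (i, j)" .
qed (use assms in auto)

lemma prr_four_block_diag:
  assumes "A \<in> carrier_mat m d" "B \<in> carrier_mat p r"
  shows "prr_mat m p * four_block_mat A (0\<^sub>m m r) (0\<^sub>m p d) B = B * prr_mat d r"
proof (rule eq_matI)
  fix i j assume ij: "i < dim_row (B * prr_mat d r)" "j < dim_col (B * prr_mat d r)"
  have *: "(j = d + k) \<longleftrightarrow> (k = j - d \<and> j \<ge> d)" for k by auto
  have **: "(if k < m then 0 else if k = m + i then x else 0) = (if k = m + i then x else 0)" for k and x :: complex
    by auto
  show "(prr_mat m p * four_block_mat A (0\<^sub>m m r) (0\<^sub>m p d) B) $$ (i, j) = (B * prr_mat d r) $$ (i, j)"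
    using assms ij by (cases "j < d")
     (auto simp: block_mat_defs scalar_prod_def * ** if_distrib[where f = "\<lambda>x. x * _"] if_distrib[where f = "(*) _"] sum.delta cong: if_cong)
qed (use assms in auto)

section \<open>Morphisms and biproducts of representations\<close>

text \<open>If \<open>m < n\<close>, padding \<open>A\<close> with zero columns and \<open>B\<close>
  with zero rows gives square matrices with the same product, although the second has a zero row and
  hence determinant 0. The invariance of dimensions under isomorphism rests on this
  inequality.\<close>

lemma one_mat_factor_le:
  fixes A B :: "complex mat"
  assumes "A \<in> carrier_mat n m" "B \<in> carrier_mat m n" "A * B = 1\<^sub>m n"
  shows "n \<le> m"
proof (rule ccontr)
  assume "\<not> n \<le> m"
  then have nm: "m < n" by simp
  define A' where "A' = mat n n (\<lambda>(i, j). if j < m then A $$ (i, j) else 0)"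
  define B' where "B' = mat n n (\<lambda>(i, j). if i < m then B $$ (i, j) else 0)"
  have "A' * B' = A * B"
  proof (rule eq_matI)
    fix i j assume "i < dim_row (A * B)" "j < dim_col (A * B)"
    then have ij: "i < n" "j < n" using assms by auto
    have "(A' * B') $$ (i, j) = (\<Sum>k = 0..<n. A' $$ (i, k) * B' $$ (k, j))"
      using ij by (auto simp: A'_def B'_def scalar_prod_def)
    also have "\<dots> = (\<Sum>k = 0..<m. A' $$ (i, k) * B' $$ (k, j))"
      using nm ij by (intro sum.mono_neutral_right) (auto simp: A'_def)
    also have "\<dots> = (\<Sum>k = 0..<m. A $$ (i, k) * B $$ (k, j))"
      using nm ij by (intro sum.cong) (auto simp: A'_def B'_def)
    also have "\<dots> = (A * B) $$ (i, j)"
      using ij assms(1,2) by (auto simp: scalar_prod_def)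
    finally show "(A' * B') $$ (i, j) = (A * B) $$ (i, j)" .
  qed (use assms in \<open>auto simp: A'_def B'_def\<close>)
  then have "det A' * det B' = 1"
    using assms(3) by (subst det_mult[symmetric, of _ n]) (auto simp: A'_def B'_def)
  moreover have "det B' = 0"
  proof -
    have "B' = mat\<^sub>r n n (\<lambda>i. if i = n - 1 then 0\<^sub>v n else row B' i)"
      using nm by (intro eq_matI) (auto simp: B'_def)
    moreover have "det (mat\<^sub>r n n (\<lambda>i. if i = n - 1 then 0\<^sub>v n else row B' i)) = 0"
      using nm by (intro det_row_0) (auto simp: B'_def)
    ultimately show ?thesis by simp
  qed
  ultimately show False by simp
qed

text \<open>\<open>Hom_rep\<close> without extensionality, so that morphisms can be given by plain
  functions of the vertex and composed without restricting them each time.\<close>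

definition ishom ::
    "('v, 'b) pre_digraph \<Rightarrow> ('v, 'b) quiver_rep \<Rightarrow> ('v, 'b) quiver_rep \<Rightarrow> ('v \<Rightarrow> complex mat) \<Rightarrow> bool" where
  "ishom Q X Y \<phi> \<longleftrightarrow> (\<forall>x\<in>verts Q. \<phi> x \<in> carrier_mat (dimv Y x) (dimv X x)) \<and>
     (\<forall>a\<in>arcs Q. \<phi> (head Q a) * maps X a = maps Y a * \<phi> (tail Q a))"

lemma ishomD:
  assumes "ishom Q X Y \<phi>"
  shows "x \<in> verts Q \<Longrightarrow> \<phi> x \<in> carrier_mat (dimv Y x) (dimv X x)"
    and "x \<in> verts Q \<Longrightarrow> dim_row (\<phi> x) = dimv Y x"
    and "x \<in> verts Q \<Longrightarrow> dim_col (\<phi> x) = dimv X x"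
    and "a \<in> arcs Q \<Longrightarrow> \<phi> (head Q a) * maps X a = maps Y a * \<phi> (tail Q a)"
  using assms by (auto simp: ishom_def)

lemma is_repD:
  assumes "is_rep Q X"
  shows "a \<in> arcs Q \<Longrightarrow> maps X a \<in> carrier_mat (dimv X (head Q a)) (dimv X (tail Q a))"
    and "a \<in> arcs Q \<Longrightarrow> dim_row (maps X a) = dimv X (head Q a)"
    and "a \<in> arcs Q \<Longrightarrow> dim_col (maps X a) = dimv X (tail Q a)"
    and "x \<notin> verts Q \<Longrightarrow> dimv X x = 0"
  using assms by (auto simp: is_rep_def rep_space_def dim_vectors_def PiE_iff)

lemma is_repI:
  assumes "\<And>x. x \<notin> verts Q \<Longrightarrow> dimv X x = 0" "maps X \<in> extensional (arcs Q)"
    "\<And>a. a \<in> arcs Q \<Longrightarrow> maps X a \<in> carrier_mat (dimv X (head Q a)) (dimv X (tail Q a))"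
  shows "is_rep Q X"
  using assms by (auto simp: is_rep_def rep_space_def dim_vectors_def PiE_iff)

lemma ishom_restrict:
  assumes "wf_digraph Q" "ishom Q X Y \<phi>"
  shows "restrict \<phi> (verts Q) \<in> Hom_rep Q X Y"
proof -
  interpret wf_digraph Q by fact
  show ?thesis using assms(2) by (auto simp: Hom_rep_def ishom_def)
qed

lemma ishom_of_Hom_rep: "\<phi> \<in> Hom_rep Q X Y \<Longrightarrow> ishom Q X Y \<phi>"
  by (auto simp: Hom_rep_def ishom_def)

lemma nonzero_Hom_iff:
  assumes "wf_digraph Q"
  shows "nonzero_Hom Q X Y \<longleftrightarrow> (\<exists>\<phi>. ishom Q X Y \<phi> \<and> (\<exists>x\<in>verts Q. \<phi> x \<noteq> 0\<^sub>m (dimv Y x) (dimv X x)))"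
proof
  assume "\<exists>\<phi>. ishom Q X Y \<phi> \<and> (\<exists>x\<in>verts Q. \<phi> x \<noteq> 0\<^sub>m (dimv Y x) (dimv X x))"
  then obtain \<phi> x where "ishom Q X Y \<phi>" "x \<in> verts Q" "\<phi> x \<noteq> 0\<^sub>m (dimv Y x) (dimv X x)" by blast
  then show "nonzero_Hom Q X Y" using ishom_restrict[OF assms, of X Y \<phi>]
    unfolding nonzero_Hom_def by (intro bexI[of _ "restrict \<phi> (verts Q)"] bexI[of _ x]) auto
qed (auto simp: nonzero_Hom_def dest: ishom_of_Hom_rep)

lemma ishom_comp:
  assumes "wf_digraph Q" "is_rep Q X" "is_rep Q Y" "is_rep Q Z" "ishom Q X Y \<phi>" "ishom Q Y Z \<psi>"
  shows "ishom Q X Z (\<lambda>x. \<psi> x * \<phi> x)"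
proof -
  interpret wf_digraph Q by fact
  note d = ishomD[OF assms(5)] ishomD[OF assms(6)] is_repD[OF assms(2)] is_repD[OF assms(3)] is_repD[OF assms(4)]
  have "\<psi> (head Q a) * \<phi> (head Q a) * maps X a = maps Z a * (\<psi> (tail Q a) * \<phi> (tail Q a))"
    if a: "a \<in> arcs Q" for a
  proof -
    have "\<psi> (head Q a) * \<phi> (head Q a) * maps X a = \<psi> (head Q a) * (\<phi> (head Q a) * maps X a)"
      using a d(2,3,6,7,10,11) by (intro mult_mat_assoc) auto
    also have "\<dots> = \<psi> (head Q a) * maps Y a * \<phi> (tail Q a)"
      unfolding d(4)[OF a] using a d by (intro mult_mat_assoc[symmetric]) auto
    also have "\<dots> = maps Z a * (\<psi> (tail Q a) * \<phi> (tail Q a))"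
      unfolding d(8)[OF a] using a d by (intro mult_mat_assoc) auto
    finally show ?thesis .
  qed
  moreover have "\<psi> x * \<phi> x \<in> carrier_mat (dimv Z x) (dimv X x)" if "x \<in> verts Q" for x
    using d(1,5)[OF that] by auto
  ultimately show ?thesis by (auto simp: ishom_def)
qed

lemma ishom_mat_sum:
  assumes "wf_digraph Q" "is_rep Q X" "is_rep Q Y" "\<And>k. k \<in> I \<Longrightarrow> ishom Q X Y (\<phi> k)"
  shows "ishom Q X Y (\<lambda>x. mat_sum (dimv Y x) (dimv X x) (\<lambda>k. \<phi> k x) I)"
proof -
  interpret wf_digraph Q by fact
  have "mat_sum (dimv Y (head Q a)) (dimv X (head Q a)) (\<lambda>k. \<phi> k (head Q a)) I * maps X a
      = maps Y a * mat_sum (dimv Y (tail Q a)) (dimv X (tail Q a)) (\<lambda>k. \<phi> k (tail Q a)) I"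
    if a: "a \<in> arcs Q" for a
  proof -
    have "mat_sum (dimv Y (head Q a)) (dimv X (head Q a)) (\<lambda>k. \<phi> k (head Q a)) I * maps X a
      = mat_sum (dimv Y (head Q a)) (dimv X (tail Q a)) (\<lambda>k. \<phi> k (head Q a) * maps X a) I"
      using a assms ishomD(1)[OF assms(4)] is_repD(1)[OF assms(2)] by (intro mat_sum_mult) auto
    also have "\<dots> = mat_sum (dimv Y (head Q a)) (dimv X (tail Q a)) (\<lambda>k. maps Y a * \<phi> k (tail Q a)) I"
      using ishomD(4)[OF assms(4) a] by (intro mat_sum_cong) auto
    also have "\<dots> = maps Y a * mat_sum (dimv Y (tail Q a)) (dimv X (tail Q a)) (\<lambda>k. \<phi> k (tail Q a)) I"
      using a assms ishomD(1)[OF assms(4)] is_repD(1)[OF assms(3)] by (intro mult_mat_sum[symmetric]) auto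
    finally show ?thesis .
  qed
  then show ?thesis by (auto simp: ishom_def)
qed

lemma ishom_id:
  assumes "wf_digraph Q" "is_rep Q X"
  shows "ishom Q X X (\<lambda>x. 1\<^sub>m (dimv X x))"
proof -
  interpret wf_digraph Q by fact
  show ?thesis using is_repD[OF assms(2)] by (auto simp: ishom_def)
qed

lemma ishom_smult:
  assumes "wf_digraph Q" "is_rep Q X" "is_rep Q Y" "ishom Q X Y \<phi>"
  shows "ishom Q X Y (\<lambda>x. z \<cdot>\<^sub>m \<phi> x)"
proof -
  interpret wf_digraph Q by fact
  have "z \<cdot>\<^sub>m \<phi> (head Q a) * maps X a = maps Y a * (z \<cdot>\<^sub>m \<phi> (tail Q a))" if a: "a \<in> arcs Q" for a
  proof -
    have "z \<cdot>\<^sub>m \<phi> (head Q a) * maps X a = z \<cdot>\<^sub>m (\<phi> (head Q a) * maps X a)"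
      using a ishomD(1)[OF assms(4)] is_repD(1)[OF assms(2)] by (intro mult_smult_assoc_mat[of _ "dimv Y (head Q a)" "dimv X (head Q a)" _ "dimv X (tail Q a)"]) auto
    also have "\<dots> = maps Y a * (z \<cdot>\<^sub>m \<phi> (tail Q a))"
      unfolding ishomD(4)[OF assms(4) a]
      using a ishomD(1)[OF assms(4)] is_repD(1)[OF assms(3)] by (intro mult_smult_distrib[symmetric, of _ "dimv Y (head Q a)" "dimv Y (tail Q a)" _ "dimv X (tail Q a)"]) auto
    finally show ?thesis .
  qed
  then show ?thesis using ishomD(1)[OF assms(4)] by (auto simp: ishom_def)
qed

lemma ishom_add:
  assumes "wf_digraph Q" "is_rep Q X" "is_rep Q Y" "ishom Q X Y \<phi>" "ishom Q X Y \<psi>"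
  shows "ishom Q X Y (\<lambda>x. \<phi> x + \<psi> x)"
proof -
  interpret wf_digraph Q by fact
  have "(\<phi> (head Q a) + \<psi> (head Q a)) * maps X a = maps Y a * (\<phi> (tail Q a) + \<psi> (tail Q a))"
    if a: "a \<in> arcs Q" for a
  proof -
    have "(\<phi> (head Q a) + \<psi> (head Q a)) * maps X a = \<phi> (head Q a) * maps X a + \<psi> (head Q a) * maps X a"
      using a ishomD(1)[OF assms(4)] ishomD(1)[OF assms(5)] is_repD(1)[OF assms(2)]
      by (intro add_mult_distrib_mat[of _ "dimv Y (head Q a)" "dimv X (head Q a)" _ _ "dimv X (tail Q a)"]) auto
    also have "\<dots> = maps Y a * (\<phi> (tail Q a) + \<psi> (tail Q a))"
      unfolding ishomD(4)[OF assms(4) a] ishomD(4)[OF assms(5) a]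
      using a ishomD(1)[OF assms(4)] ishomD(1)[OF assms(5)] is_repD(1)[OF assms(3)]
      by (intro mult_add_distrib_mat[symmetric, of _ "dimv Y (head Q a)" "dimv Y (tail Q a)" _ "dimv X (tail Q a)"]) auto
    finally show ?thesis .
  qed
  then show ?thesis using ishomD(1)[OF assms(4)] ishomD(1)[OF assms(5)] by (auto simp: ishom_def)
qed

text \<open>The inverse family is carried along, which makes symmetry immediate and composition a
  computation. Squareness of the components is a consequence, see \<open>isom_dimv\<close>.\<close>

definition isom ::
    "('v, 'b) pre_digraph \<Rightarrow> ('v, 'b) quiver_rep \<Rightarrow> ('v, 'b) quiver_rep \<Rightarrow>
     ('v \<Rightarrow> complex mat) \<Rightarrow> ('v \<Rightarrow> complex mat) \<Rightarrow> bool" where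
  "isom Q X Y \<phi> \<psi> \<longleftrightarrow> ishom Q X Y \<phi> \<and> ishom Q Y X \<psi> \<and>
     (\<forall>x\<in>verts Q. \<psi> x * \<phi> x = 1\<^sub>m (dimv X x) \<and> \<phi> x * \<psi> x = 1\<^sub>m (dimv Y x))"

lemma isom_sym: "isom Q X Y \<phi> \<psi> \<Longrightarrow> isom Q Y X \<psi> \<phi>"
  by (auto simp: isom_def)

lemma isom_trans:
  assumes "wf_digraph Q" "is_rep Q X" "is_rep Q Y" "is_rep Q Z" "isom Q X Y \<phi> \<psi>" "isom Q Y Z \<phi>' \<psi>'"
  shows "isom Q X Z (\<lambda>x. \<phi>' x * \<phi> x) (\<lambda>x. \<psi> x * \<psi>' x)"
proof -
  have h: "ishom Q X Y \<phi>" "ishom Q Y X \<psi>" "ishom Q Y Z \<phi>'" "ishom Q Z Y \<psi>'"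
    using assms by (auto simp: isom_def)
  note d = ishomD(2,3)[OF h(1)] ishomD(2,3)[OF h(2)] ishomD(2,3)[OF h(3)] ishomD(2,3)[OF h(4)]
  have "\<psi> x * \<psi>' x * (\<phi>' x * \<phi> x) = 1\<^sub>m (dimv X x) \<and> \<phi>' x * \<phi> x * (\<psi> x * \<psi>' x) = 1\<^sub>m (dimv Z x)"
    if x: "x \<in> verts Q" for x
  proof
    have "\<psi> x * \<psi>' x * (\<phi>' x * \<phi> x) = \<psi> x * (\<psi>' x * \<phi>' x * \<phi> x)"
      using d x by (simp add: mult_mat_assoc)
    also have "\<dots> = 1\<^sub>m (dimv X x)"
      using assms(5,6) x d by (auto simp: isom_def)
    finally show "\<psi> x * \<psi>' x * (\<phi>' x * \<phi> x) = 1\<^sub>m (dimv X x)" .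
    have "\<phi>' x * \<phi> x * (\<psi> x * \<psi>' x) = \<phi>' x * (\<phi> x * \<psi> x * \<psi>' x)"
      using d x by (simp add: mult_mat_assoc)
    also have "\<dots> = 1\<^sub>m (dimv Z x)"
      using assms(5,6) x d by (auto simp: isom_def)
    finally show "\<phi>' x * \<phi> x * (\<psi> x * \<psi>' x) = 1\<^sub>m (dimv Z x)" .
  qed
  with h assms show ?thesis by (auto simp: isom_def intro: ishom_comp)
qed

text \<open>Pointwise inverses of a morphism commute with the arrows by themselves: insert
  \<open>\<phi> \<psi> = 1\<close> at the tail, move \<open>\<phi>\<close> across the arrow, and
  cancel \<open>\<psi> \<phi> = 1\<close> at the head.\<close>

lemma isom_of_inverse:
  assumes "wf_digraph Q" "is_rep Q X" "is_rep Q Y" "ishom Q X Y \<phi>"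
    and inv: "\<And>x. x \<in> verts Q \<Longrightarrow> \<psi> x \<in> carrier_mat (dimv X x) (dimv Y x) \<and>
      \<psi> x * \<phi> x = 1\<^sub>m (dimv X x) \<and> \<phi> x * \<psi> x = 1\<^sub>m (dimv Y x)"
  shows "isom Q X Y \<phi> \<psi>"
proof -
  interpret wf_digraph Q by fact
  note d = ishomD(2,3)[OF assms(4)] is_repD[OF assms(2)] is_repD[OF assms(3)]
  have dp: "dim_row (\<psi> x) = dimv X x" "dim_col (\<psi> x) = dimv Y x" if "x \<in> verts Q" for x
    using inv[OF that] by auto
  have "\<psi> (head Q a) * maps Y a = maps X a * \<psi> (tail Q a)" if a: "a \<in> arcs Q" for a
  proof -
    have "\<psi> (head Q a) * maps Y a = \<psi> (head Q a) * (maps Y a * (\<phi> (tail Q a) * \<psi> (tail Q a)))"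
      using a inv d by auto
    also have "\<dots> = \<psi> (head Q a) * (maps Y a * \<phi> (tail Q a)) * \<psi> (tail Q a)"
      using a d dp by (simp add: mult_mat_assoc)
    also have "\<dots> = \<psi> (head Q a) * \<phi> (head Q a) * (maps X a * \<psi> (tail Q a))"
      unfolding ishomD(4)[OF assms(4) a, symmetric] using a d dp by (simp add: mult_mat_assoc)
    also have "\<dots> = maps X a * \<psi> (tail Q a)"
      using a inv d dp by auto
    finally show ?thesis .
  qed
  then show ?thesis using assms by (auto simp: isom_def ishom_def)
qed

lemma iso_rep_iff:
  assumes "wf_digraph Q" "is_rep Q X" "is_rep Q Y"
  shows "iso_rep Q X Y \<longleftrightarrow> (\<exists>\<phi> \<psi>. isom Q X Y \<phi> \<psi>)"
proof
  assume "iso_rep Q X Y"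
  then obtain \<phi> where \<phi>: "\<phi> \<in> Hom_rep Q X Y" "\<And>x. x \<in> verts Q \<Longrightarrow> invertible_mat (\<phi> x)"
    by (auto simp: iso_rep_def)
  note h = ishom_of_Hom_rep[OF \<phi>(1)]
  have "\<exists>B. B \<in> carrier_mat (dimv X x) (dimv Y x) \<and> B * \<phi> x = 1\<^sub>m (dimv X x) \<and> \<phi> x * B = 1\<^sub>m (dimv Y x)"
    if x: "x \<in> verts Q" for x
  proof -
    obtain B where B: "square_mat (\<phi> x)" "\<phi> x * B = 1\<^sub>m (dim_row (\<phi> x))" "B * \<phi> x = 1\<^sub>m (dim_row B)"
      using \<phi>(2)[OF x] by (auto simp: invertible_mat_def inverts_mat_def)
    have "dim_col B = dim_row (\<phi> x)" using B(2) by (metis index_mult_mat(3) index_one_mat(3))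
    moreover have "dim_row B = dim_col (\<phi> x)" using B(3) by (metis index_mult_mat(3) index_one_mat(3))
    ultimately show ?thesis using B ishomD(2,3)[OF h x] by (intro exI[of _ B]) auto
  qed
  then obtain \<psi> where "\<And>x. x \<in> verts Q \<Longrightarrow> \<psi> x \<in> carrier_mat (dimv X x) (dimv Y x) \<and>
      \<psi> x * \<phi> x = 1\<^sub>m (dimv X x) \<and> \<phi> x * \<psi> x = 1\<^sub>m (dimv Y x)"
    by metis
  then show "\<exists>\<phi> \<psi>. isom Q X Y \<phi> \<psi>" using isom_of_inverse[OF assms h] by blast
next
  assume "\<exists>\<phi> \<psi>. isom Q X Y \<phi> \<psi>"
  then obtain \<phi> \<psi> where i: "isom Q X Y \<phi> \<psi>" by blast
  then have h: "ishom Q X Y \<phi>" "ishom Q Y X \<psi>" by (auto simp: isom_def)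
  have "invertible_mat (\<phi> x)" if x: "x \<in> verts Q" for x
  proof -
    have inv: "\<psi> x * \<phi> x = 1\<^sub>m (dimv X x)" "\<phi> x * \<psi> x = 1\<^sub>m (dimv Y x)" using i x by (auto simp: isom_def)
    note c = ishomD(1)[OF h(1) x] ishomD(1)[OF h(2) x]
    \<comment> \<open>\<open>invertible_mat\<close> includes squareness, which the two one-sided
      identities force together.\<close>
    have "dimv X x = dimv Y x"
    proof (rule antisym)
      show "dimv X x \<le> dimv Y x" using one_mat_factor_le[OF c(2,1) inv(1)] .
      show "dimv Y x \<le> dimv X x" using one_mat_factor_le[OF c(1,2) inv(2)] .
    qed
    then show ?thesis using c inv unfolding invertible_mat_def inverts_mat_def
      by (intro conjI exI[of _ "\<psi> x"]) auto
  qed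
  then show "iso_rep Q X Y" using ishom_restrict[OF assms(1) h(1)] unfolding iso_rep_def by (intro bexI) auto
qed

text \<open>Direct sums are handled through inclusions, projections and their identities over a
  finite index set. This form does not depend on an order of the summands, and it passes to the
  quiver with a vertex deleted and to sums of sums.\<close>

definition biproduct ::
    "('v, 'b) pre_digraph \<Rightarrow> ('v, 'b) quiver_rep \<Rightarrow> 'i set \<Rightarrow> ('i \<Rightarrow> ('v, 'b) quiver_rep) \<Rightarrow>
     ('i \<Rightarrow> 'v \<Rightarrow> complex mat) \<Rightarrow> ('i \<Rightarrow> 'v \<Rightarrow> complex mat) \<Rightarrow> bool" where
  "biproduct Q X I F \<iota> \<pi> \<longleftrightarrow> finite I \<and> is_rep Q X \<and>
     (\<forall>k\<in>I. is_rep Q (F k) \<and> ishom Q (F k) X (\<iota> k) \<and> ishom Q X (F k) (\<pi> k)) \<and>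
     (\<forall>x\<in>verts Q. (\<forall>k\<in>I. \<forall>l\<in>I. \<pi> k x * \<iota> l x =
         (if k = l then 1\<^sub>m (dimv (F k) x) else 0\<^sub>m (dimv (F k) x) (dimv (F l) x))) \<and>
       mat_sum (dimv X x) (dimv X x) (\<lambda>k. \<iota> k x * \<pi> k x) I = 1\<^sub>m (dimv X x))"

lemma biproductD:
  assumes "biproduct Q X I F \<iota> \<pi>"
  shows "finite I" "is_rep Q X"
    and "k \<in> I \<Longrightarrow> is_rep Q (F k)" "k \<in> I \<Longrightarrow> ishom Q (F k) X (\<iota> k)" "k \<in> I \<Longrightarrow> ishom Q X (F k) (\<pi> k)"
    and "x \<in> verts Q \<Longrightarrow> k \<in> I \<Longrightarrow> \<pi> k x * \<iota> k x = 1\<^sub>m (dimv (F k) x)"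
    and "x \<in> verts Q \<Longrightarrow> k \<in> I \<Longrightarrow> l \<in> I \<Longrightarrow> k \<noteq> l \<Longrightarrow>
      \<pi> k x * \<iota> l x = 0\<^sub>m (dimv (F k) x) (dimv (F l) x)"
    and "x \<in> verts Q \<Longrightarrow> mat_sum (dimv X x) (dimv X x) (\<lambda>k. \<iota> k x * \<pi> k x) I = 1\<^sub>m (dimv X x)"
  using assms unfolding biproduct_def by auto

lemma biproduct_carriers:
  assumes "biproduct Q X I F \<iota> \<pi>" "x \<in> verts Q" "k \<in> I"
  shows "\<iota> k x \<in> carrier_mat (dimv X x) (dimv (F k) x)" "\<pi> k x \<in> carrier_mat (dimv (F k) x) (dimv X x)"
  using ishomD(1)[OF biproductD(4)[OF assms(1,3)] assms(2)]
    ishomD(1)[OF biproductD(5)[OF assms(1,3)] assms(2)] by auto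

lemma biproduct_pi_sum:
  assumes b: "biproduct Q X I F \<iota> \<pi>" and x: "x \<in> verts Q" and k: "k \<in> I"
    and m: "\<And>l. l \<in> I \<Longrightarrow> m l \<in> carrier_mat (dimv (F l) x) p"
  shows "\<pi> k x * mat_sum (dimv X x) p (\<lambda>l. \<iota> l x * m l) I = m k"
proof -
  note c = biproduct_carriers[OF b x]
  have "\<pi> k x * mat_sum (dimv X x) p (\<lambda>l. \<iota> l x * m l) I
      = mat_sum (dimv (F k) x) p (\<lambda>l. \<pi> k x * (\<iota> l x * m l)) I"
    using c k m by (intro mult_mat_sum mult_carrier_mat[OF c(1) m]) auto
  also have "\<dots> = mat_sum (dimv (F k) x) p (\<lambda>l. \<pi> k x * \<iota> l x * m l) I"
    by (intro mat_sum_cong assoc_mult_mat[symmetric, OF c(2)[OF k] c(1) m]) auto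
  also have "\<dots> = \<pi> k x * \<iota> k x * m k"
  proof (rule mat_sum_single)
    show "\<pi> k x * \<iota> k x * m k \<in> carrier_mat (dimv (F k) x) p"
      using c[OF k] m[OF k] by auto
    show "\<pi> k x * \<iota> l x * m l = 0\<^sub>m (dimv (F k) x) p" if "l \<in> I" "l \<noteq> k" for l
      using biproductD(7)[OF b x k that(1)] that m[OF that(1)] by auto
  qed (use biproductD(1)[OF b] k in auto)
  finally show ?thesis using biproductD(6)[OF b x k] m[OF k] by auto
qed

text \<open>The projections of one sum followed by the inclusions of the other. This compares
  decompositions that list the same summands in another order or grouping.\<close>

lemma isom_of_biproducts:
  assumes "wf_digraph Q" "biproduct Q X I F \<iota> \<pi>" "biproduct Q Y I F \<iota>' \<pi>'"
  shows "isom Q X Y (\<lambda>x. mat_sum (dimv Y x) (dimv X x) (\<lambda>k. \<iota>' k x * \<pi> k x) I)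
                    (\<lambda>x. mat_sum (dimv X x) (dimv Y x) (\<lambda>k. \<iota> k x * \<pi>' k x) I)"
proof -
  have inv: "mat_sum (dimv X x) (dimv Y x) (\<lambda>k. \<iota> k x * \<pi>' k x) I *
      mat_sum (dimv Y x) (dimv X x) (\<lambda>k. \<iota>' k x * \<pi> k x) I = 1\<^sub>m (dimv X x)"
    if x: "x \<in> verts Q" and b: "biproduct Q X I F \<iota> \<pi>" "biproduct Q Y I F \<iota>' \<pi>'" for x X Y \<iota> \<pi> \<iota>' \<pi>'
  proof -
    let ?M = "mat_sum (dimv Y x) (dimv X x) (\<lambda>k. \<iota>' k x * \<pi> k x) I"
    note c = biproduct_carriers[OF b(1) x] biproduct_carriers[OF b(2) x]
    have "mat_sum (dimv X x) (dimv Y x) (\<lambda>k. \<iota> k x * \<pi>' k x) I * ?M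
        = mat_sum (dimv X x) (dimv X x) (\<lambda>k. \<iota> k x * \<pi>' k x * ?M) I"
      by (intro mat_sum_mult mult_carrier_mat[OF c(1,4)]) auto
    also have "\<dots> = mat_sum (dimv X x) (dimv X x) (\<lambda>k. \<iota> k x * \<pi> k x) I"
    proof (rule mat_sum_cong)
      fix k assume k: "k \<in> I"
      have "\<iota> k x * \<pi>' k x * ?M = \<iota> k x * (\<pi>' k x * ?M)"
        by (intro assoc_mult_mat[OF c(1,4)[OF k]]) auto
      also have "\<pi>' k x * ?M = \<pi> k x"
        using c by (intro biproduct_pi_sum[OF b(2) x k]) auto
      finally show "\<iota> k x * \<pi>' k x * ?M = \<iota> k x * \<pi> k x" .
    qed
    finally show ?thesis using biproductD(8)[OF b(1) x] by simp
  qed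
  have hom: "ishom Q X Y (\<lambda>x. mat_sum (dimv Y x) (dimv X x) (\<lambda>k. \<iota>' k x * \<pi> k x) I)"
    if b: "biproduct Q X I F \<iota> \<pi>" "biproduct Q Y I F \<iota>' \<pi>'" for X Y \<iota> \<pi> \<iota>' \<pi>'
    by (intro ishom_mat_sum assms(1) biproductD(2)[OF b(1)] biproductD(2)[OF b(2)]
      ishom_comp[OF assms(1) biproductD(2)[OF b(1)] biproductD(3)[OF b(1)] biproductD(2)[OF b(2)]
        biproductD(5)[OF b(1)] biproductD(4)[OF b(2)]])
  show ?thesis unfolding isom_def
    by (intro conjI ballI hom[OF assms(2,3)] hom[OF assms(3,2)] inv[OF _ assms(2,3)] inv[OF _ assms(3,2)])
qed

text \<open>The function \<open>own\<close> recovers the group of an index. It makes the groups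
  disjoint and lets the composite structure maps be indexed by \<open>p\<close> alone.\<close>

lemma biproduct_nest:
  assumes wf: "wf_digraph Q" and b: "biproduct Q X W G \<iota> \<pi>"
    and b': "\<And>w. w \<in> W \<Longrightarrow> biproduct Q (G w) (J w) F (\<iota>' w) (\<pi>' w)"
    and own: "\<And>w p. w \<in> W \<Longrightarrow> p \<in> J w \<Longrightarrow> own p = w"
  shows "biproduct Q X (\<Union>w\<in>W. J w) F (\<lambda>p x. \<iota> (own p) x * \<iota>' (own p) p x)
           (\<lambda>p x. \<pi>' (own p) p x * \<pi> (own p) x)"
  unfolding biproduct_def
proof (intro conjI ballI)
  show "finite (\<Union>w\<in>W. J w)" using biproductD(1)[OF b] biproductD(1)[OF b'] by auto
  show "is_rep Q X" by (rule biproductD(2)[OF b])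
  fix p assume "p \<in> (\<Union>w\<in>W. J w)"
  then obtain w where w: "w \<in> W" and p: "p \<in> J w" by blast
  note o = own[OF w p]
  show "is_rep Q (F p)" using biproductD(3)[OF b'[OF w] p] .
  show "ishom Q (F p) X (\<lambda>x. \<iota> (own p) x * \<iota>' (own p) p x)"
    unfolding o by (rule ishom_comp[OF wf biproductD(3)[OF b'[OF w] p] biproductD(3)[OF b w] biproductD(2)[OF b]
      biproductD(4)[OF b'[OF w] p] biproductD(4)[OF b w]])
  show "ishom Q X (F p) (\<lambda>x. \<pi>' (own p) p x * \<pi> (own p) x)"
    unfolding o by (rule ishom_comp[OF wf biproductD(2)[OF b] biproductD(3)[OF b w] biproductD(3)[OF b'[OF w] p]
      biproductD(5)[OF b w] biproductD(5)[OF b'[OF w] p]])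
next
  fix x p q assume x: "x \<in> verts Q" and "p \<in> (\<Union>w\<in>W. J w)" "q \<in> (\<Union>w\<in>W. J w)"
  then obtain w v where w: "w \<in> W" "p \<in> J w" and v: "v \<in> W" "q \<in> J v" by blast
  note c = biproduct_carriers[OF b x w(1)] biproduct_carriers[OF b x v(1)]
    biproduct_carriers[OF b'[OF w(1)] x w(2)] biproduct_carriers[OF b'[OF v(1)] x v(2)]
  have "\<pi>' w p x * \<pi> w x * (\<iota> v x * \<iota>' v q x) = \<pi>' w p x * (\<pi> w x * \<iota> v x) * \<iota>' v q x"
    using c by (simp add: mult_mat_assoc)
  also have "\<dots> = (if p = q then 1\<^sub>m (dimv (F p) x) else 0\<^sub>m (dimv (F p) x) (dimv (F q) x))"
  proof (cases "w = v")
    case True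
    then show ?thesis using c biproductD(6)[OF b x w(1)] biproductD(6,7)[OF b'[OF w(1)] x w(2)] v by auto
  next
    case False
    then have "p \<noteq> q" using own[OF w] own[OF v] by auto
    then show ?thesis using c biproductD(7)[OF b x w(1) v(1) False] by auto
  qed
  finally show "\<pi>' (own p) p x * \<pi> (own p) x * (\<iota> (own q) x * \<iota>' (own q) q x)
      = (if p = q then 1\<^sub>m (dimv (F p) x) else 0\<^sub>m (dimv (F p) x) (dimv (F q) x))"
    unfolding own[OF w] own[OF v] .
next
  fix x assume x: "x \<in> verts Q"
  let ?d = "dimv X x"
  have "mat_sum ?d ?d (\<lambda>k. \<iota> (own k) x * \<iota>' (own k) k x * (\<pi>' (own k) k x * \<pi> (own k) x)) (\<Union>w\<in>W. J w)
      = mat_sum ?d ?d (\<lambda>w. mat_sum ?d ?d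
          (\<lambda>k. \<iota> (own k) x * \<iota>' (own k) k x * (\<pi>' (own k) k x * \<pi> (own k) x)) (J w)) W"
  proof (rule mat_sum_UNION)
    show "J w \<inter> J w' = {}" if "w \<in> W" "w' \<in> W" "w \<noteq> w'" for w w'
    proof (rule equals0I)
      fix p assume "p \<in> J w \<inter> J w'"
      then show False using own[OF that(1), of p] own[OF that(2), of p] that(3) by simp
    qed
  qed (rule biproductD(1)[OF b], rule biproductD(1)[OF b'])
  also have "\<dots> = mat_sum ?d ?d (\<lambda>w. \<iota> w x * \<pi> w x) W"
  proof (rule mat_sum_cong)
    fix w assume w: "w \<in> W"
    note c = biproduct_carriers[OF b x w] biproduct_carriers[OF b'[OF w] x]
    let ?e = "dimv (G w) x"
    have "mat_sum ?d ?d (\<lambda>k. \<iota> (own k) x * \<iota>' (own k) k x * (\<pi>' (own k) k x * \<pi> (own k) x)) (J w)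
        = mat_sum ?d ?d (\<lambda>k. \<iota> w x * (\<iota>' w k x * \<pi>' w k x) * \<pi> w x) (J w)"
    proof (rule mat_sum_cong)
      fix k assume k: "k \<in> J w"
      show "\<iota> (own k) x * \<iota>' (own k) k x * (\<pi>' (own k) k x * \<pi> (own k) x)
          = \<iota> w x * (\<iota>' w k x * \<pi>' w k x) * \<pi> w x"
        unfolding own[OF w k] using c(1,2) c(3,4)[OF k] by (simp add: mult_mat_assoc)
    qed
    also have "\<dots> = mat_sum ?d ?e (\<lambda>k. \<iota> w x * (\<iota>' w k x * \<pi>' w k x)) (J w) * \<pi> w x"
      using c(2) by (intro mat_sum_mult[symmetric] mult_carrier_mat[OF c(1) mult_carrier_mat[OF c(3,4)]]) auto
    also have "mat_sum ?d ?e (\<lambda>k. \<iota> w x * (\<iota>' w k x * \<pi>' w k x)) (J w)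
        = \<iota> w x * mat_sum ?e ?e (\<lambda>k. \<iota>' w k x * \<pi>' w k x) (J w)"
      using c(1) by (intro mult_mat_sum[symmetric] mult_carrier_mat[OF c(3,4)]) auto
    finally show "mat_sum ?d ?d (\<lambda>k. \<iota> (own k) x * \<iota>' (own k) k x * (\<pi>' (own k) k x * \<pi> (own k) x)) (J w)
        = \<iota> w x * \<pi> w x"
      using biproductD(8)[OF b'[OF w] x] c(1) by auto
  qed
  finally show "mat_sum ?d ?d (\<lambda>k. \<iota> (own k) x * \<iota>' (own k) k x * (\<pi>' (own k) k x * \<pi> (own k) x))
      (\<Union>w\<in>W. J w) = 1\<^sub>m ?d"
    using biproductD(8)[OF b x] by simp
qed

lemma dimv_direct_sum: "dimv (direct_sum Q Xs) x = (\<Sum>X\<leftarrow>Xs. dimv X x)"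
  by (simp add: direct_sum_def)

lemma is_rep_direct_sum:
  assumes "\<And>X. X \<in> set Xs \<Longrightarrow> is_rep Q X"
  shows "is_rep Q (direct_sum Q Xs)"
proof (rule is_repI)
  show "dimv (direct_sum Q Xs) x = 0" if x: "x \<notin> verts Q" for x
  proof -
    have "dimv X x = 0" if "X \<in> set Xs" for X by (rule is_repD(4)[OF assms[OF that] x])
    then have "map (\<lambda>X. dimv X x) Xs = map (\<lambda>_. 0) Xs" by (intro map_cong) auto
    then show ?thesis unfolding dimv_direct_sum by (simp del: map_eq_conv add: map_replicate_const)
  qed
  show "maps (direct_sum Q Xs) \<in> extensional (arcs Q)" by (simp add: direct_sum_def)
  fix a assume a: "a \<in> arcs Q"
  have "dim_row (maps X a) = dimv X (head Q a)" "dim_col (maps X a) = dimv X (tail Q a)" if "X \<in> set Xs" for X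
    by (rule is_repD(2)[OF assms[OF that] a], rule is_repD(3)[OF assms[OF that] a])
  then have m: "map (\<lambda>X. dim_row (maps X a)) Xs = map (\<lambda>X. dimv X (head Q a)) Xs"
    "map (\<lambda>X. dim_col (maps X a)) Xs = map (\<lambda>X. dimv X (tail Q a)) Xs"
    by (intro map_cong; simp)+
  have e: "maps (direct_sum Q Xs) a = diag_block_mat (map (\<lambda>X. maps X a) Xs)"
    using a by (simp add: direct_sum_def)
  have r: "dim_row (diag_block_mat (map (\<lambda>X. maps X a) Xs)) = sum_list (map (\<lambda>X. dim_row (maps X a)) Xs)"
    "dim_col (diag_block_mat (map (\<lambda>X. maps X a) Xs)) = sum_list (map (\<lambda>X. dim_col (maps X a)) Xs)"
    unfolding dim_diag_block_mat by (simp_all add: o_def)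
  show "maps (direct_sum Q Xs) a \<in> carrier_mat (dimv (direct_sum Q Xs) (head Q a)) (dimv (direct_sum Q Xs) (tail Q a))"
    by (intro carrier_matI) (simp_all only: dimv_direct_sum e r m)
qed

lemma maps_direct_sum_Cons:
  assumes "a \<in> arcs Q" "\<And>Y. Y \<in> set (X # Xs) \<Longrightarrow> is_rep Q Y"
  shows "maps (direct_sum Q (X # Xs)) a =
    four_block_mat (maps X a) (0\<^sub>m (dimv X (head Q a)) (dimv (direct_sum Q Xs) (tail Q a)))
      (0\<^sub>m (dimv (direct_sum Q Xs) (head Q a)) (dimv X (tail Q a))) (maps (direct_sum Q Xs) a)"
proof -
  have "is_rep Q X" "is_rep Q (direct_sum Q Xs)"
    by (rule assms(2), simp) (rule is_rep_direct_sum, rule assms(2), simp)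
  note d = is_repD(2,3)[OF this(1) assms(1)] is_repD(2,3)[OF this(2) assms(1)]
  have e: "diag_block_mat (map (\<lambda>X. maps X a) Xs) = maps (direct_sum Q Xs) a"
    using assms(1) by (simp add: direct_sum_def)
  have "maps (direct_sum Q (X # Xs)) a =
      four_block_mat (maps X a) (0\<^sub>m (dim_row (maps X a)) (dim_col (diag_block_mat (map (\<lambda>X. maps X a) Xs))))
      (0\<^sub>m (dim_row (diag_block_mat (map (\<lambda>X. maps X a) Xs))) (dim_col (maps X a)))
      (diag_block_mat (map (\<lambda>X. maps X a) Xs))"
    using assms(1) by (simp add: direct_sum_def Let_def)
  then show ?thesis unfolding e d .
qed

text \<open>The list \<open>ks\<close> holds distinct labels, so that a summand of higher
  multiplicity gets several indices. The induction splits off the first diagonal block.\<close>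

lemma direct_sum_biproduct:
  assumes wf: "wf_digraph Q" and "distinct ks" "\<And>k. k \<in> set ks \<Longrightarrow> is_rep Q (F k)"
  shows "\<exists>\<iota> \<pi>. biproduct Q (direct_sum Q (map F ks)) (set ks) F \<iota> \<pi>"
  using assms(2,3)
proof (induction ks)
  case Nil
  have "is_rep Q (direct_sum Q [])" by (rule is_rep_direct_sum) simp
  then have "biproduct Q (direct_sum Q (map F [])) (set []) F (\<lambda>_ _. 0\<^sub>m 0 0) (\<lambda>_ _. 0\<^sub>m 0 0)"
    unfolding biproduct_def by (simp add: dimv_direct_sum) (auto intro!: eq_matI)
  then show ?case by (intro exI)
next
  case (Cons k ks)
  let ?S = "direct_sum Q (map F ks)"
  define T where "T = direct_sum Q (map F (k # ks))"
  have "\<exists>\<iota> \<pi>. biproduct Q ?S (set ks) F \<iota> \<pi>"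
  proof (rule Cons.IH)
    show "is_rep Q (F j)" if "j \<in> set ks" for j using Cons.prems(2)[of j] that by simp
  qed (use Cons.prems(1) in simp)
  then obtain \<iota>' \<pi>' where b: "biproduct Q ?S (set ks) F \<iota>' \<pi>'" by (elim exE)
  have S: "is_rep Q ?S"
  proof (rule is_rep_direct_sum)
    fix X assume "X \<in> set (map F ks)"
    then obtain j where "j \<in> set (k # ks)" "X = F j" by auto
    then show "is_rep Q X" using Cons.prems(2)[of j] by simp
  qed
  have fam: "is_rep Q X" if "X \<in> set (F k # map F ks)" for X
  proof -
    obtain j where "j \<in> set (k # ks)" "X = F j" using \<open>X \<in> set (F k # map F ks)\<close> by auto
    then show "is_rep Q X" using Cons.prems(2)[of j] by simp
  qed
  have k: "is_rep Q (F k)" by (rule Cons.prems(2)) simp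
  have T: "is_rep Q T" unfolding T_def list.map by (rule is_rep_direct_sum) (rule fam)
  let ?d = "dimv (F k)" and ?r = "dimv ?S"
  have dT: "dimv T x = ?d x + ?r x" for x by (simp add: T_def dimv_direct_sum)
  have maps: "maps T a = four_block_mat (maps (F k) a) (0\<^sub>m (?d (head Q a)) (?r (tail Q a)))
      (0\<^sub>m (?r (head Q a)) (?d (tail Q a))) (maps ?S a)" if "a \<in> arcs Q" for a
    unfolding T_def list.map by (rule maps_direct_sum_Cons[OF that]) (rule fam)
  note car = is_repD(1)[OF k] is_repD(1)[OF S]
  have hl: "ishom Q (F k) T (\<lambda>x. inl_mat (?d x) (?r x))"
    and hr: "ishom Q ?S T (\<lambda>x. inr_mat (?d x) (?r x))"
    and pl: "ishom Q T (F k) (\<lambda>x. prl_mat (?d x) (?r x))"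
    and pr: "ishom Q T ?S (\<lambda>x. prr_mat (?d x) (?r x))"
    unfolding ishom_def dT
    by (auto simp: maps four_block_diag_inl[OF car] four_block_diag_inr[OF car]
        prl_four_block_diag[OF car] prr_four_block_diag[OF car])
  define \<iota> where "\<iota> = (\<lambda>j x. if j = k then inl_mat (?d x) (?r x) else inr_mat (?d x) (?r x) * \<iota>' j x)"
  define \<pi> where "\<pi> = (\<lambda>j x. if j = k then prl_mat (?d x) (?r x) else \<pi>' j x * prr_mat (?d x) (?r x))"
  have "biproduct Q T (set (k # ks)) F \<iota> \<pi>"
    unfolding biproduct_def
  proof (intro conjI ballI)
    show "finite (set (k # ks))" "is_rep Q T" by (simp, rule T)
    fix j assume j: "j \<in> set (k # ks)"
    show Fj: "is_rep Q (F j)" by (rule Cons.prems(2)[OF j])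
    show "ishom Q (F j) T (\<iota> j)"
    proof (cases "j = k")
      case False
      then have "j \<in> set ks" using j by auto
      then show ?thesis using False ishom_comp[OF wf Fj S T biproductD(4)[OF b \<open>j \<in> set ks\<close>] hr] by (simp add: \<iota>_def)
    qed (use hl in \<open>simp add: \<iota>_def\<close>)
    show "ishom Q T (F j) (\<pi> j)"
    proof (cases "j = k")
      case False
      then have "j \<in> set ks" using j by auto
      then show ?thesis using False ishom_comp[OF wf T S Fj pr biproductD(5)[OF b \<open>j \<in> set ks\<close>]] by (simp add: \<pi>_def)
    qed (use pl in \<open>simp add: \<pi>_def\<close>)
  next
    fix x i j assume x: "x \<in> verts Q" and i: "i \<in> set (k # ks)" and j: "j \<in> set (k # ks)"
    note c = biproduct_carriers[OF b x]
    show "\<pi> i x * \<iota> j x = (if i = j then 1\<^sub>m (dimv (F i) x) else 0\<^sub>m (dimv (F i) x) (dimv (F j) x))"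
    proof (cases "i = k"; cases "j = k")
      assume ij: "i \<noteq> k" "j \<noteq> k"
      then have "i \<in> set ks" "j \<in> set ks" using i j by auto
      note c = c[OF this(1)] c[OF this(2)] biproductD(6,7)[OF b x this(1)] this
      have "\<pi> i x * \<iota> j x = \<pi>' i x * (prr_mat (?d x) (?r x) * inr_mat (?d x) (?r x)) * \<iota>' j x"
        using ij c(1-4) by (simp add: \<iota>_def \<pi>_def mult_mat_assoc)
      then show ?thesis using c by (auto simp: block_mat_relations)
    next
      assume ij: "i = k" "j \<noteq> k"
      then have "j \<in> set ks" using j by auto
      note c = c[OF this]
      have "\<pi> i x * \<iota> j x = (prl_mat (?d x) (?r x) * inr_mat (?d x) (?r x)) * \<iota>' j x"
        using ij c by (simp add: \<iota>_def \<pi>_def mult_mat_assoc)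
      then show ?thesis using c ij by (auto simp: block_mat_relations)
    next
      assume ij: "i \<noteq> k" "j = k"
      then have "i \<in> set ks" using i by auto
      note c = c[OF this]
      have "\<pi> i x * \<iota> j x = \<pi>' i x * (prr_mat (?d x) (?r x) * inl_mat (?d x) (?r x))"
        using ij c by (simp add: \<iota>_def \<pi>_def mult_mat_assoc)
      then show ?thesis using c ij by (auto simp: block_mat_relations)
    qed (simp add: \<iota>_def \<pi>_def block_mat_relations)
  next
    fix x assume x: "x \<in> verts Q"
    note c = biproduct_carriers[OF b x]
    let ?t = "dimv T x"
    have "mat_sum ?t ?t (\<lambda>j. \<iota> j x * \<pi> j x) (set (k # ks))
        = \<iota> k x * \<pi> k x + mat_sum ?t ?t (\<lambda>j. \<iota> j x * \<pi> j x) (set ks)"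
      unfolding list.set(2) using Cons.prems(1)
      by (intro mat_sum_insert) (auto simp: \<iota>_def \<pi>_def dT)
    also have "mat_sum ?t ?t (\<lambda>j. \<iota> j x * \<pi> j x) (set ks)
        = mat_sum ?t ?t (\<lambda>j. inr_mat (?d x) (?r x) * (\<iota>' j x * \<pi>' j x) * prr_mat (?d x) (?r x)) (set ks)"
    proof (rule mat_sum_cong)
      fix j assume j: "j \<in> set ks"
      then have "j \<noteq> k" using Cons.prems(1) by auto
      then show "\<iota> j x * \<pi> j x = inr_mat (?d x) (?r x) * (\<iota>' j x * \<pi>' j x) * prr_mat (?d x) (?r x)"
        using c[OF j] by (simp add: \<iota>_def \<pi>_def mult_mat_assoc)
    qed
    also have "\<dots> = mat_sum ?t (?r x) (\<lambda>j. inr_mat (?d x) (?r x) * (\<iota>' j x * \<pi>' j x)) (set ks) * prr_mat (?d x) (?r x)"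
      unfolding dT
      by (intro mat_sum_mult[symmetric] mult_carrier_mat[OF block_mat_carriers(2) mult_carrier_mat[OF c(1,2)]]) auto
    also have "mat_sum ?t (?r x) (\<lambda>j. inr_mat (?d x) (?r x) * (\<iota>' j x * \<pi>' j x)) (set ks)
        = inr_mat (?d x) (?r x) * mat_sum (?r x) (?r x) (\<lambda>j. \<iota>' j x * \<pi>' j x) (set ks)"
      unfolding dT by (intro mult_mat_sum[symmetric] mult_carrier_mat[OF c(1,2)]) auto
    finally show "mat_sum ?t ?t (\<lambda>j. \<iota> j x * \<pi> j x) (set (k # ks)) = 1\<^sub>m ?t"
      using biproductD(8)[OF b x] by (simp add: \<iota>_def \<pi>_def dT block_mat_relations)
  qed
  then show ?case unfolding T_def by (intro exI)
qed

section \<open>Idempotent endomorphisms\<close>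

lemma mat_add_mult:
  fixes A B C :: "'a::semiring_0 mat"
  assumes "dim_row A = dim_row B" "dim_col A = dim_col B" "dim_col B = dim_row C"
  shows "(A + B) * C = A * C + B * C"
  using assms by (intro add_mult_distrib_mat[of _ "dim_row A" "dim_col A" _ _ "dim_col C"]) auto

lemma mat_mult_add:
  fixes A B C :: "'a::semiring_0 mat"
  assumes "dim_row B = dim_row C" "dim_col B = dim_col C" "dim_col A = dim_row B"
  shows "A * (B + C) = A * B + A * C"
  using assms by (intro mult_add_distrib_mat[of _ "dim_row A" "dim_col A" _ "dim_col B"]) auto

lemma mat_minus_mult:
  fixes A B C :: "'a::ring mat"
  assumes "dim_row A = dim_row B" "dim_col A = dim_col B" "dim_col B = dim_row C"
  shows "(A - B) * C = A * C - B * C"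
  using assms by (intro minus_mult_distrib_mat[of _ "dim_row A" "dim_col A" _ _ "dim_col C"]) auto

lemma mat_mult_minus:
  fixes A B C :: "'a::ring mat"
  assumes "dim_row B = dim_row C" "dim_col B = dim_col C" "dim_col A = dim_row B"
  shows "A * (B - C) = A * B - A * C"
  using assms by (intro mult_minus_distrib_mat[of _ "dim_row A" "dim_col A" _ "dim_col B"]) auto

lemma minus_mat_self [simp]:
  fixes A :: "'a::group_add mat"
  shows "A - A = 0\<^sub>m (dim_row A) (dim_col A)"
  by (rule eq_matI) auto

lemma minus_zero_mat:
  fixes A :: "'a::group_add mat"
  assumes "A \<in> carrier_mat n m"
  shows "A - 0\<^sub>m n m = A"
  using assms by (intro eq_matI) auto

lemma mult_mat_zero_dim:
  fixes A B :: "'a::semiring_0 mat"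
  assumes "A \<in> carrier_mat n 0" "B \<in> carrier_mat 0 m"
  shows "A * B = 0\<^sub>m n m"
  using assms by (intro eq_matI) (auto simp: scalar_prod_def)

text \<open>Maximality replaces the choice of a basis of the image. Take \<open>r\<close> maximal
  such that some \<open>P\<close>, \<open>P'\<close> satisfy all claims except
  \<open>P P' = E\<close> and are absorbed by \<open>E\<close>. If \<open>D = E - P P'\<close> were
  non-zero, it would be an idempotent orthogonal to \<open>P\<close> and \<open>P'\<close>, and one
  of its columns together with one of its rows would enlarge the pair.\<close>

lemma idempotent_mat_factor:
  fixes E :: "complex mat"
  assumes E: "E \<in> carrier_mat d d" "E * E = E"
  obtains r P P' where "P \<in> carrier_mat d r" "P' \<in> carrier_mat r d" "P' * P = 1\<^sub>m r" "P * P' = E"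
proof -
  define S where "S = {r. \<exists>P P'. P \<in> carrier_mat d r \<and> P' \<in> carrier_mat r d \<and> P' * P = 1\<^sub>m r \<and> E * P = P \<and> P' * E = P'}"
  have "S \<subseteq> {..d}" unfolding S_def using one_mat_factor_le by auto
  then have fin: "finite S" by (rule finite_subset) simp
  have "0 \<in> S" unfolding S_def
    by (rule CollectI, rule exI[of _ "0\<^sub>m d 0"], rule exI[of _ "0\<^sub>m 0 d"]) (use E in \<open>auto intro!: eq_matI\<close>)
  then have "Max S \<in> S" using fin by (intro Max_in) auto
  then obtain r P P' where r: "r = Max S" and P: "P \<in> carrier_mat d r" "P' \<in> carrier_mat r d"
    "P' * P = 1\<^sub>m r" "E * P = P" "P' * E = P'" unfolding S_def by auto
  have "P * P' = E"
  proof (rule ccontr)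
    assume ne: "P * P' \<noteq> E"
    define D where "D = E - P * P'"
    have D: "D \<in> carrier_mat d d" using E P by (auto simp: D_def)
    have dims [simp]: "dim_row E = d" "dim_col E = d" "dim_row P = d" "dim_col P = r" "dim_row P' = r" "dim_col P' = d"
      "dim_row D = d" "dim_col D = d"
      using E P D by auto
    have "E * (P * P') = P * P'" using P(4) by (simp flip: mult_mat_assoc)
    moreover have "P * P' * P = P" "P' * (P * P') = P'"
      using P by (simp add: mult_mat_assoc, simp flip: mult_mat_assoc)
    ultimately have DP: "D * P = 0\<^sub>m d r" and PD: "P' * D = 0\<^sub>m r d"
      using P by (simp_all add: D_def mat_minus_mult mat_mult_minus)
    have ED: "E * D = D" unfolding D_def using \<open>E * (P * P') = P * P'\<close> E by (simp add: mat_mult_minus)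
    have DE: "D * E = D" unfolding D_def using P(5) E by (simp add: mat_minus_mult mult_mat_assoc)
    have "D * (P * P') = 0\<^sub>m d d" using DP P(2) by (simp flip: mult_mat_assoc)
    then have DD: "D * D = D"
      using DE minus_zero_mat[OF D] by (subst (2) D_def) (simp add: mat_mult_minus)
    have "\<exists>i<d. \<exists>j<d. D $$ (i, j) \<noteq> 0"
    proof (rule ccontr)
      assume "\<not> ?thesis"
      then have *: "(E - P * P') $$ (i, j) = 0" if "i < d" "j < d" for i j using that D_def by auto
      have "P * P' = E"
      proof (rule eq_matI)
        fix i j assume "i < dim_row E" "j < dim_col E"
        then show "(P * P') $$ (i, j) = E $$ (i, j)" using *[of i j] by simp
      qed auto
      then show False using ne by contradiction
    qed
    then obtain i j where ij: "i < d" "j < d" "D $$ (i, j) \<noteq> 0" by blast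
    \<comment> \<open>Column \<open>j\<close> of \<open>D\<close>, and below row \<open>i\<close> of
      \<open>D\<close> divided by the entry at \<open>(i, j)\<close>: because
      \<open>D * D = D\<close>, their product is that entry divided by itself.\<close>
    define u where "u = mat d 1 (\<lambda>(k, _). D $$ (k, j))"
    define l where "l = mat 1 d (\<lambda>(_, k). D $$ (i, k) / D $$ (i, j))"
    have col: "(M * u) $$ (k, 0) = (M * D) $$ (k, j)" if "k < m" "M \<in> carrier_mat m d" for M k m
      using that ij(2) by (simp add: u_def scalar_prod_def)
    have row: "(l * M) $$ (0, k) = (D * M) $$ (i, k) / D $$ (i, j)" if "k < m" "M \<in> carrier_mat d m" for M k m
      using that ij(1) by (simp add: l_def scalar_prod_def sum_divide_distrib)
    have uc: "u \<in> carrier_mat d 1" and lc: "l \<in> carrier_mat 1 d" by (auto simp: u_def l_def)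
    have d1 [simp]: "dim_row u = d" "dim_col u = 1" "dim_row l = 1" "dim_col l = d" using uc lc by auto
    have lu: "l * u = 1\<^sub>m 1"
    proof (rule eq_matI)
      fix a b assume "a < dim_row (1\<^sub>m 1 :: complex mat)" "b < dim_col (1\<^sub>m 1 :: complex mat)"
      then have "a = 0" "b = 0" by auto
      then show "(l * u) $$ (a, b) = 1\<^sub>m 1 $$ (a, b)"
        using row[OF _ uc, of 0] col[OF ij(1) D] DD ij by simp
    qed auto
    have Pu: "P' * u = 0\<^sub>m r 1"
      using col[OF _ P(2)] PD ij by (intro eq_matI) auto
    have lP: "l * P = 0\<^sub>m 1 r"
      using row[OF _ P(1)] DP ij by (intro eq_matI) auto
    have Eu: "E * u = u"
      using col[OF _ E(1)] ED ij by (intro eq_matI) (auto simp: u_def)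
    have lE: "l * E = l"
      using row[OF _ E(1)] DE ij by (intro eq_matI) (auto simp: l_def)
    \<comment> \<open>The column \<open>u\<close> is appended to \<open>P\<close> and the row
      \<open>l\<close> to \<open>P'\<close>; the mixed products \<open>Pu\<close> and
      \<open>lP\<close> vanish.\<close>
    let ?P = "P * prl_mat r 1 + u * prr_mat r 1" and ?P' = "inl_mat r 1 * P' + inr_mat r 1 * l"
    have "?P' * ?P = inl_mat r 1 * (P' * P) * prl_mat r 1 + inr_mat r 1 * (l * P) * prl_mat r 1
        + (inl_mat r 1 * (P' * u) * prr_mat r 1 + inr_mat r 1 * (l * u) * prr_mat r 1)"
      by (simp add: mat_add_mult mat_mult_add mult_mat_assoc)
    also have "\<dots> = inl_mat r 1 * prl_mat r 1 + 0\<^sub>m (r + 1) (r + 1) + (0\<^sub>m (r + 1) (r + 1) + inr_mat r 1 * prr_mat r 1)"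
      using P(3) by (simp add: Pu lP lu)
    also have "\<dots> = inl_mat r 1 * prl_mat r 1 + inr_mat r 1 * prr_mat r 1"
      using right_add_zero_mat[OF mult_carrier_mat[OF block_mat_carriers(1)[of r 1] block_mat_carriers(3)[of r 1]]]
        left_add_zero_mat[OF mult_carrier_mat[OF block_mat_carriers(2)[of r 1] block_mat_carriers(4)[of r 1]]] by simp
    also have "\<dots> = 1\<^sub>m (r + 1)" by (rule block_mat_relations)
    finally have 1: "?P' * ?P = 1\<^sub>m (r + 1)" .
    have 2: "E * ?P = ?P" using P(4) Eu by (simp add: mat_mult_add flip: mult_mat_assoc)
    have 3: "?P' * E = ?P'" using P(5) lE by (simp add: mat_add_mult mult_mat_assoc)
    have "r + 1 \<in> S" unfolding S_def
      by (rule CollectI, rule exI[of _ ?P], rule exI[of _ ?P']) (use 1 2 3 in auto)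
    then have "r + 1 \<le> Max S" using fin by (intro Max_ge)
    then show False using r by simp
  qed
  with P that show ?thesis by blast
qed

text \<open>Factors \<open>E\<close> and the complementary idempotent \<open>1 - E\<close>. The
  mixed products vanish since each factor absorbs its own idempotent.\<close>

lemma idempotent_mat_split:
  fixes E :: "complex mat"
  assumes E: "E \<in> carrier_mat d d" "E * E = E"
  shows "\<exists>r P P' s S S'. P \<in> carrier_mat d r \<and> P' \<in> carrier_mat r d \<and> S \<in> carrier_mat d s \<and> S' \<in> carrier_mat s d
    \<and> P' * P = 1\<^sub>m r \<and> S' * S = 1\<^sub>m s \<and> P' * S = 0\<^sub>m r s \<and> S' * P = 0\<^sub>m s r
    \<and> P * P' = E \<and> P * P' + S * S' = 1\<^sub>m d"
proof -
  have dE [simp]: "dim_row E = d" "dim_col E = d" using E by auto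
  obtain r P P' where P: "P \<in> carrier_mat d r" "P' \<in> carrier_mat r d" "P' * P = 1\<^sub>m r" "P * P' = E"
    using idempotent_mat_factor[OF E] .
  have c: "1\<^sub>m d - E \<in> carrier_mat d d" using E by auto
  have "(1\<^sub>m d - E) * (1\<^sub>m d - E) = 1\<^sub>m d - E"
    using E minus_zero_mat[OF c] by (simp add: mat_minus_mult mat_mult_minus)
  then obtain s S S' where S: "S \<in> carrier_mat d s" "S' \<in> carrier_mat s d" "S' * S = 1\<^sub>m s" "S * S' = 1\<^sub>m d - E"
    using idempotent_mat_factor[OF c] by metis
  have dims [simp]: "dim_row P = d" "dim_col P = r" "dim_row P' = r" "dim_col P' = d"
    "dim_row S = d" "dim_col S = s" "dim_row S' = s" "dim_col S' = d"
    using P S by auto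
  have EP: "E * P = P" "P' * E = P'"
    unfolding P(4)[symmetric] using P(1-3) by (simp add: mult_mat_assoc, simp flip: mult_mat_assoc)
  have ES: "(1\<^sub>m d - E) * S = S" "S' * (1\<^sub>m d - E) = S'"
    unfolding S(4)[symmetric] using S(1-3) by (simp add: mult_mat_assoc, simp flip: mult_mat_assoc)
  have "P' * S = P' * (1\<^sub>m d - E) * S"
    using ES(1) by (simp add: mult_mat_assoc)
  also have "P' * (1\<^sub>m d - E) = 0\<^sub>m r d"
    using EP(2) P(2) by (simp add: mat_mult_minus)
  finally have PS: "P' * S = 0\<^sub>m r s" using S by simp
  have "S' * P = S' * ((1\<^sub>m d - E) * P)"
    using ES(2) by (simp flip: mult_mat_assoc)
  also have "(1\<^sub>m d - E) * P = 0\<^sub>m d r"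
    using EP(1) P(1) by (simp add: mat_minus_mult)
  finally have SP: "S' * P = 0\<^sub>m s r" using S by simp
  have "P * P' + S * S' = 1\<^sub>m d" unfolding P(4) S(4) using E by (intro eq_matI) auto
  then show ?thesis using P S PS SP by blast
qed

text \<open>The images of \<open>e x\<close> and of \<open>1 - e x\<close> form complementary
  subrepresentations, so one of them is zero. Bases chosen at each vertex separately suffice,
  because only the products \<open>P P' = e\<close> and \<open>S S' = 1 - e\<close> have to commute
  with the arrows.\<close>

lemma indecomposable_idempotent:
  assumes wf: "wf_digraph Q" and ind: "indecomposable_rep Q X" and e: "ishom Q X X e"
    and idem: "\<And>x. x \<in> verts Q \<Longrightarrow> e x * e x = e x"
  shows "(\<forall>x\<in>verts Q. e x = 0\<^sub>m (dimv X x) (dimv X x)) \<or> (\<forall>x\<in>verts Q. e x = 1\<^sub>m (dimv X x))"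
proof -
  interpret wf_digraph Q by fact
  have X: "is_rep Q X" using ind by (simp add: indecomposable_rep_def)
  have "\<forall>x\<in>verts Q. \<exists>r P P' s S S'. P \<in> carrier_mat (dimv X x) r \<and> P' \<in> carrier_mat r (dimv X x)
    \<and> S \<in> carrier_mat (dimv X x) s \<and> S' \<in> carrier_mat s (dimv X x)
    \<and> P' * P = 1\<^sub>m r \<and> S' * S = 1\<^sub>m s \<and> P' * S = 0\<^sub>m r s \<and> S' * P = 0\<^sub>m s r
    \<and> P * P' = e x \<and> P * P' + S * S' = 1\<^sub>m (dimv X x)"
    using idempotent_mat_split[OF ishomD(1)[OF e] idem] by blast
  then obtain r P P' s S S' where spl: "\<And>x. x \<in> verts Q \<Longrightarrow> P x \<in> carrier_mat (dimv X x) (r x)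
    \<and> P' x \<in> carrier_mat (r x) (dimv X x) \<and> S x \<in> carrier_mat (dimv X x) (s x) \<and> S' x \<in> carrier_mat (s x) (dimv X x)
    \<and> P' x * P x = 1\<^sub>m (r x) \<and> S' x * S x = 1\<^sub>m (s x) \<and> P' x * S x = 0\<^sub>m (r x) (s x) \<and> S' x * P x = 0\<^sub>m (s x) (r x)
    \<and> P x * P' x = e x \<and> P x * P' x + S x * S' x = 1\<^sub>m (dimv X x)"
    by (metis (no_types))
  have sum1: "P x * P' x + S x * S' x = 1\<^sub>m (dimv X x)" "e x + S x * S' x = 1\<^sub>m (dimv X x)" if "x \<in> verts Q" for x
  proof -
    have "P x * P' x = e x" "P x * P' x + S x * S' x = 1\<^sub>m (dimv X x)" using spl[OF that] by blast+
    then show "P x * P' x + S x * S' x = 1\<^sub>m (dimv X x)" "e x + S x * S' x = 1\<^sub>m (dimv X x)" by simp_all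
  qed
  \<comment> \<open>Compression of \<open>X\<close> to the image of the idempotent
    \<open>P P'\<close>, in the coordinates given by \<open>P\<close>. Off the quiver the dimension
    is set to 0, as \<open>dim_vectors\<close> demands.\<close>
  define cut :: "('a \<Rightarrow> nat) \<Rightarrow> ('a \<Rightarrow> complex mat) \<Rightarrow> ('a \<Rightarrow> complex mat) \<Rightarrow> ('a, 'b) quiver_rep"
    where "cut = (\<lambda>r P P'. \<lparr>dimv = (\<lambda>x. if x \<in> verts Q then r x else 0),
      maps = (\<lambda>a\<in>arcs Q. P' (head Q a) * maps X a * P (tail Q a))\<rparr>)"
  have cut: "is_rep Q (cut r P P') \<and> ishom Q (cut r P P') X P \<and> ishom Q X (cut r P P') P'"
    if c: "\<And>x. x \<in> verts Q \<Longrightarrow> P x \<in> carrier_mat (dimv X x) (r x)"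
      "\<And>x. x \<in> verts Q \<Longrightarrow> P' x \<in> carrier_mat (r x) (dimv X x)"
      and PP: "\<And>x. x \<in> verts Q \<Longrightarrow> P' x * P x = 1\<^sub>m (r x)"
      and h: "\<And>a. a \<in> arcs Q \<Longrightarrow> P (head Q a) * P' (head Q a) * maps X a = maps X a * (P (tail Q a) * P' (tail Q a))"
    for r P P'
  proof (intro conjI)
    note car = is_repD(1)[OF X]
    have m: "maps (cut r P P') a = P' (head Q a) * maps X a * P (tail Q a)" if "a \<in> arcs Q" for a
      using that by (simp add: cut_def)
    have dv: "dimv (cut r P P') x = r x" if "x \<in> verts Q" for x using that by (simp add: cut_def)
    show "is_rep Q (cut r P P')"
    proof (rule is_repI)
      fix a assume a: "a \<in> arcs Q"
      then show "maps (cut r P P') a \<in> carrier_mat (dimv (cut r P P') (head Q a)) (dimv (cut r P P') (tail Q a))"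
        unfolding m[OF a] dv[OF head_in_verts[OF a]] dv[OF tail_in_verts[OF a]]
        by (intro mult_carrier_mat[OF mult_carrier_mat[OF c(2) car] c(1)]) simp_all
    qed (simp_all add: cut_def)
    have d: "dim_row (P x) = dimv X x" "dim_col (P x) = r x" "dim_row (P' x) = r x" "dim_col (P' x) = dimv X x"
      if "x \<in> verts Q" for x using c[OF that] by auto
    have dm: "dim_row (maps X a) = dimv X (head Q a)" "dim_col (maps X a) = dimv X (tail Q a)" if "a \<in> arcs Q" for a
      using car[OF that] by auto
    show "ishom Q (cut r P P') X P"
      unfolding ishom_def
    proof (intro conjI ballI)
      fix a assume a: "a \<in> arcs Q"
      have "P (head Q a) * maps (cut r P P') a = P (head Q a) * P' (head Q a) * maps X a * P (tail Q a)"
        using a by (simp add: m d dm mult_mat_assoc)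
      also have "\<dots> = maps X a * P (tail Q a) * (P' (tail Q a) * P (tail Q a))"
        unfolding h[OF a] using a by (simp add: d dm mult_mat_assoc)
      finally show "P (head Q a) * maps (cut r P P') a = maps X a * P (tail Q a)"
        using PP[OF tail_in_verts[OF a]] right_mult_one_mat[OF mult_carrier_mat[OF car[OF a] c(1)[OF tail_in_verts[OF a]]]] by simp
    qed (use c dv in simp)
    show "ishom Q X (cut r P P') P'"
      unfolding ishom_def
    proof (intro conjI ballI)
      fix a assume a: "a \<in> arcs Q"
      have "maps (cut r P P') a * P' (tail Q a) = P' (head Q a) * (maps X a * (P (tail Q a) * P' (tail Q a)))"
        using a by (simp add: m d dm mult_mat_assoc)
      also have "\<dots> = P' (head Q a) * P (head Q a) * (P' (head Q a) * maps X a)"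
        unfolding h[OF a, symmetric] using a by (simp add: d dm mult_mat_assoc)
      finally show "P' (head Q a) * maps X a = maps (cut r P P') a * P' (tail Q a)"
        using PP[OF head_in_verts[OF a]] left_mult_one_mat[OF mult_carrier_mat[OF c(2)[OF head_in_verts[OF a]] car[OF a]]] by simp
    qed (use c dv in simp)
  qed
  have dX: "dim_row (maps X a) = dimv X (head Q a)" "dim_col (maps X a) = dimv X (tail Q a)" if "a \<in> arcs Q" for a
    using is_repD(1)[OF X that] by auto
  \<comment> \<open>The complementary idempotent is \<open>1 - e\<close>, so it commutes with the
    arrows just as \<open>e\<close> does.\<close>
  have compl: "S x * S' x = 1\<^sub>m (dimv X x) - e x" if x: "x \<in> verts Q" for x
  proof (rule eq_matI)
    have sp: "e x + S x * S' x = 1\<^sub>m (dimv X x)" by (rule sum1[OF x])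
    have ce: "e x \<in> carrier_mat (dimv X x) (dimv X x)" by (rule ishomD(1)[OF e x])
    fix i j assume "i < dim_row (1\<^sub>m (dimv X x) - e x)" "j < dim_col (1\<^sub>m (dimv X x) - e x)"
    then have ij: "i < dimv X x" "j < dimv X x" using ce by auto
    have "(e x + S x * S' x) $$ (i, j) = e x $$ (i, j) + (S x * S' x) $$ (i, j)"
      using ij spl[OF x] by (intro index_add_mat) auto
    then show "(S x * S' x) $$ (i, j) = (1\<^sub>m (dimv X x) - e x) $$ (i, j)"
      unfolding sp using ij ce by (simp add: algebra_simps)
  qed (use spl[OF x] ishomD(2,3)[OF e x] in auto)
  define F where "F = (\<lambda>k::nat. if k = 0 then cut r P P' else cut s S S')"
  define \<iota> where "\<iota> = (\<lambda>k::nat. if k = 0 then P else S)"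
  define \<pi> where "\<pi> = (\<lambda>k::nat. if k = 0 then P' else S')"
  have cP: "is_rep Q (cut r P P') \<and> ishom Q (cut r P P') X P \<and> ishom Q X (cut r P P') P'"
  proof (rule cut)
    fix a assume a: "a \<in> arcs Q"
    then show "P (head Q a) * P' (head Q a) * maps X a = maps X a * (P (tail Q a) * P' (tail Q a))"
      using spl[of "head Q a"] spl[of "tail Q a"] ishomD(4)[OF e a] by simp
  qed (use spl in auto)
  have cS: "is_rep Q (cut s S S') \<and> ishom Q (cut s S S') X S \<and> ishom Q X (cut s S S') S'"
  proof (rule cut)
    fix a assume a: "a \<in> arcs Q"
    then have ht: "head Q a \<in> verts Q" "tail Q a \<in> verts Q" by auto
    show "S (head Q a) * S' (head Q a) * maps X a = maps X a * (S (tail Q a) * S' (tail Q a))"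
      unfolding compl[OF ht(1)] compl[OF ht(2)]
      using ishomD(4)[OF e a] ishomD(2,3)[OF e ht(1)] ishomD(2,3)[OF e ht(2)] dX[OF a]
      by (simp add: mat_minus_mult mat_mult_minus left_mult_one_mat[OF is_repD(1)[OF X a]] right_mult_one_mat[OF is_repD(1)[OF X a]])
  qed (use spl in auto)
  have bX: "biproduct Q X (set [0, 1::nat]) F \<iota> \<pi>"
    unfolding biproduct_def
  proof (intro conjI ballI)
    fix x assume x: "x \<in> verts Q"
    have "mat_sum (dimv X x) (dimv X x) (\<lambda>k. \<iota> k x * \<pi> k x) (set [0, 1::nat]) = P x * P' x + S x * S' x"
    proof -
      have "P x * P' x \<in> carrier_mat (dimv X x) (dimv X x)" "S x * S' x \<in> carrier_mat (dimv X x) (dimv X x)"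
        using spl[OF x] mult_carrier_mat by blast+
      then show ?thesis by (simp add: mat_sum_insert \<iota>_def \<pi>_def)
    qed
    then show "mat_sum (dimv X x) (dimv X x) (\<lambda>k. \<iota> k x * \<pi> k x) (set [0, 1::nat]) = 1\<^sub>m (dimv X x)"
      using sum1(1)[OF x] by simp
    fix k l assume "k \<in> set [0, 1::nat]" "l \<in> set [0, 1::nat]"
    then show "\<pi> k x * \<iota> l x = (if k = l then 1\<^sub>m (dimv (F k) x) else 0\<^sub>m (dimv (F k) x) (dimv (F l) x))"
      using spl[OF x] x by (auto simp: F_def \<iota>_def \<pi>_def cut_def)
  qed (use X cP cS in \<open>auto simp: F_def \<iota>_def \<pi>_def\<close>)
  have rF: "is_rep Q (F k)" for k using cP cS by (simp add: F_def)
  have "\<exists>\<iota> \<pi>. biproduct Q (direct_sum Q (map F [0, 1::nat])) (set [0, 1::nat]) F \<iota> \<pi>"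
    by (rule direct_sum_biproduct[OF wf]) (simp, rule rF)
  then obtain \<iota>' \<pi>' where "biproduct Q (direct_sum Q (map F [0, 1::nat])) (set [0, 1::nat]) F \<iota>' \<pi>'"
    by (elim exE)
  from isom_of_biproducts[OF wf bX this] have "\<exists>\<phi> \<psi>. isom Q X (direct_sum Q (map F [0, 1::nat])) \<phi> \<psi>"
    by (intro exI)
  then have "iso_rep Q X (direct_sum Q [F 0, F 1])"
    using iso_rep_iff[OF wf X is_rep_direct_sum, of "[F 0, F 1]"] rF by auto
  then have "zero_rep Q (F 0) \<or> zero_rep Q (F 1)"
    using ind rF unfolding indecomposable_rep_def by blast
  then show ?thesis
  proof
    assume z: "zero_rep Q (F 0)"
    have "e x = 0\<^sub>m (dimv X x) (dimv X x)" if x: "x \<in> verts Q" for x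
    proof -
      have "r x = 0" using z x by (simp add: zero_rep_def F_def cut_def)
      then have "P x \<in> carrier_mat (dimv X x) 0" "P' x \<in> carrier_mat 0 (dimv X x)" using spl[OF x] by auto
      then have "P x * P' x = 0\<^sub>m (dimv X x) (dimv X x)" by (rule mult_mat_zero_dim)
      then show ?thesis using spl[OF x] by simp
    qed
    then show ?thesis by simp
  next
    assume z: "zero_rep Q (F 1)"
    have "e x = 1\<^sub>m (dimv X x)" if x: "x \<in> verts Q" for x
    proof -
      have "s x = 0" using z x by (simp add: zero_rep_def F_def cut_def)
      then have "S x \<in> carrier_mat (dimv X x) 0" "S' x \<in> carrier_mat 0 (dimv X x)" using spl[OF x] by auto
      then have "S x * S' x = 0\<^sub>m (dimv X x) (dimv X x)" by (rule mult_mat_zero_dim)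
      then have "e x + 0\<^sub>m (dimv X x) (dimv X x) = 1\<^sub>m (dimv X x)" using sum1(2)[OF x] by simp
      then show ?thesis using right_add_zero_mat[OF ishomD(1)[OF e x]] by simp
    qed
    then show ?thesis by simp
  qed
qed

section \<open>Indecomposable representations of chains\<close>

text \<open>Induction on the last coordinate. If it vanishes on all of \<open>K\<close>, then either
  it separates \<open>v\<close> already or \<open>v\<close> lives in the first \<open>d\<close>
  coordinates as well. Otherwise \<open>K\<close> contains some \<open>k0\<close> with last
  coordinate 1, and subtracting multiples of \<open>k0\<close> moves the problem into the first
  \<open>d\<close> coordinates.\<close>

lemma separating_functional_fun:
  fixes K :: "(nat \<Rightarrow> complex) set"
  assumes "\<And>u. u \<in> K \<Longrightarrow> (\<forall>i\<ge>d. u i = 0)" "(\<lambda>_. 0) \<in> K"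
    "\<And>u w c. u \<in> K \<Longrightarrow> w \<in> K \<Longrightarrow> (\<lambda>i. u i + c * w i) \<in> K"
    "\<forall>i\<ge>d. v i = 0" "v \<notin> K"
  shows "\<exists>l. (\<Sum>i<d. l i * v i) = 1 \<and> (\<forall>k\<in>K. (\<Sum>i<d. l i * k i) = 0)"
  using assms
proof (induction d arbitrary: K v)
  case 0
  then have "v = (\<lambda>_. 0)" by auto
  with 0 show ?case by simp
next
  case (Suc d)
  note sub = Suc.prems(3)
  define K0 where "K0 = {k \<in> K. k d = 0}"
  have K0: "\<forall>i\<ge>d. u i = 0" if "u \<in> K0" for u
  proof (intro allI impI)
    fix i assume "i \<ge> d"
    then show "u i = 0" using that Suc.prems(1)[of u] by (cases "i = d") (auto simp: K0_def)
  qed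
  have K0': "(\<lambda>_. 0) \<in> K0" "\<And>u w c. u \<in> K0 \<Longrightarrow> w \<in> K0 \<Longrightarrow> (\<lambda>i. u i + c * w i) \<in> K0"
    using Suc.prems(2) sub by (auto simp: K0_def)
  show ?case
  proof (cases "K0 = K")
    case True
    show ?thesis
    proof (cases "v d = 0")
      case False
      have "(\<Sum>i<Suc d. (if i = d then 1 / v d else 0) * v i) = 1" using False by simp
      moreover have "(\<Sum>i<Suc d. (if i = d then 1 / v d else 0) * k i) = 0" if "k \<in> K" for k
        using that True by (auto simp: K0_def)
      ultimately show ?thesis by (intro exI conjI ballI)
    next
      case v: True
      then have "\<forall>i\<ge>d. v i = 0" using Suc.prems(4) by (metis le_antisym not_less_eq_eq)
      from Suc.IH[OF K0 K0' this] Suc.prems(5) True obtain l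
        where l: "(\<Sum>i<d. l i * v i) = 1" "\<forall>k\<in>K. (\<Sum>i<d. l i * k i) = 0" by auto
      have "(\<Sum>i<Suc d. l i * k i) = 0" if "k \<in> K" for k
        using l(2) that True by (auto simp: K0_def)
      with l(1) v show ?thesis by (intro exI[of _ l]) simp
    qed
  next
    case False
    then obtain k1 where k1: "k1 \<in> K" "k1 d \<noteq> 0" by (auto simp: K0_def)
    define k0 where "k0 = (\<lambda>i. k1 i / k1 d)"
    have "(\<lambda>i. 0 + (1 / k1 d) * k1 i) \<in> K" by (rule sub[OF Suc.prems(2) k1(1)])
    then have k0: "k0 \<in> K" "k0 d = 1" using k1 by (auto simp: k0_def)
    define w where "w = (\<lambda>i. v i - v d * k0 i)"
    have "w \<notin> K0"
    proof
      assume "w \<in> K0"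
      then have "w \<in> K" by (simp add: K0_def)
      from sub[OF this k0(1), of "v d"] show False using Suc.prems(5) by (simp add: w_def)
    qed
    moreover have "\<forall>i\<ge>d. w i = 0"
    proof (intro allI impI)
      fix i assume "i \<ge> d"
      then show "w i = 0" using k0 Suc.prems(4) Suc.prems(1)[OF k0(1)] by (cases "i = d") (auto simp: w_def)
    qed
    ultimately obtain l where l: "(\<Sum>i<d. l i * w i) = 1" "\<forall>k\<in>K0. (\<Sum>i<d. l i * k i) = 0"
      using Suc.IH[OF K0 K0'] by blast
    \<comment> \<open>The last coefficient is chosen so that \<open>l'\<close> vanishes on
      \<open>k0\<close>; its value at \<open>u\<close> is then that of \<open>l\<close> at
      \<open>u\<close> reduced by \<open>k0\<close>.\<close>
    define l' where "l' = l(d := - (\<Sum>i<d. l i * k0 i))"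
    have l'k: "(\<Sum>i<Suc d. l' i * u i) = (\<Sum>i<d. l i * (u i - u d * k0 i))" for u
      by (simp add: l'_def right_diff_distrib sum_subtractf sum_distrib_left sum_distrib_right mult.left_commute mult.commute)
    have "(\<Sum>i<Suc d. l' i * v i) = 1" unfolding l'k using l(1) by (simp add: w_def)
    moreover have "(\<Sum>i<Suc d. l' i * k i) = 0" if "k \<in> K" for k
    proof -
      have "(\<lambda>i. k i + (- k d) * k0 i) \<in> K0"
        using sub[OF that k0(1), of "- k d"] k0(2) by (simp add: K0_def)
      then show ?thesis unfolding l'k using l(2) by simp
    qed
    ultimately show ?thesis by (intro exI conjI ballI)
  qed
qed

text \<open>A linear subspace, with vectors as one-column matrices so that arrows act by matrix
  multiplication.\<close>

definition column_space :: "nat \<Rightarrow> complex mat set \<Rightarrow> bool" where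
  "column_space d K \<longleftrightarrow> K \<subseteq> carrier_mat d 1 \<and> 0\<^sub>m d 1 \<in> K \<and> (\<forall>u\<in>K. \<forall>w\<in>K. \<forall>c. u + c \<cdot>\<^sub>m w \<in> K)"

lemma column_spaceD:
  assumes "column_space d K"
  shows "u \<in> K \<Longrightarrow> u \<in> carrier_mat d 1" "0\<^sub>m d 1 \<in> K" "u \<in> K \<Longrightarrow> w \<in> K \<Longrightarrow> u + c \<cdot>\<^sub>m w \<in> K"
  using assms by (auto simp: column_space_def)

lemma row_column_mult:
  assumes "l \<in> carrier_mat 1 d" "v \<in> carrier_mat d 1"
  shows "(l * v :: complex mat) = (\<Sum>i<d. l $$ (0, i) * v $$ (i, 0)) \<cdot>\<^sub>m 1\<^sub>m 1"
  using assms by (intro eq_matI) (auto simp: scalar_prod_def atLeast0LessThan)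

lemma separating_functional:
  assumes K: "column_space d K" and v: "v \<in> carrier_mat d 1" "v \<notin> K"
  shows "\<exists>l\<in>carrier_mat 1 d. l * v = 1\<^sub>m 1 \<and> (\<forall>k\<in>K. l * k = 0\<^sub>m 1 1)"
proof -
  define fn where "fn = (\<lambda>(u :: complex mat) i. if i < d then u $$ (i, 0) else 0)"
  have inj: "u = w" if "u \<in> carrier_mat d 1" "w \<in> carrier_mat d 1" "fn u = fn w" for u w
  proof (rule eq_matI)
    fix i j assume "i < dim_row w" "j < dim_col w"
    then have "i < d" "j = 0" using that by auto
    moreover have "fn u i = fn w i" using that(3) by simp
    ultimately show "u $$ (i, j) = w $$ (i, j)" by (simp add: fn_def)
  qed (use that in auto)
  have "\<exists>l. (\<Sum>i<d. l i * fn v i) = 1 \<and> (\<forall>k\<in>fn ` K. (\<Sum>i<d. l i * k i) = 0)"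
  proof (rule separating_functional_fun)
    show "(\<lambda>_. 0) \<in> fn ` K" using column_spaceD(2)[OF K] by (intro image_eqI[of _ _ "0\<^sub>m d 1"]) (auto simp: fn_def)
    fix u w c assume "u \<in> fn ` K" "w \<in> fn ` K"
    then obtain u' w' where *: "u' \<in> K" "u = fn u'" "w' \<in> K" "w = fn w'" by auto
    then have "fn (u' + c \<cdot>\<^sub>m w') = (\<lambda>i. u i + c * w i)"
      using column_spaceD(1)[OF K *(1)] column_spaceD(1)[OF K *(3)] by (auto simp: fn_def)
    then show "(\<lambda>i. u i + c * w i) \<in> fn ` K" using column_spaceD(3)[OF K *(1,3)] by (metis image_eqI)
  next
    show "fn v \<notin> fn ` K"
    proof
      assume "fn v \<in> fn ` K"
      then obtain k where "k \<in> K" "fn v = fn k" by auto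
      then show False using inj[OF v(1) column_spaceD(1)[OF K]] v(2) by auto
    qed
  qed (auto simp: fn_def)
  then obtain l where l: "(\<Sum>i<d. l i * fn v i) = 1" "\<forall>k\<in>fn ` K. (\<Sum>i<d. l i * k i) = 0" by blast
  define l' where "l' = mat 1 d (\<lambda>(_, i). l i)"
  have l': "l' \<in> carrier_mat 1 d" by (simp add: l'_def)
  have e: "l' * u = (\<Sum>i<d. l i * fn u i) \<cdot>\<^sub>m 1\<^sub>m 1" if "u \<in> carrier_mat d 1" for u
    unfolding row_column_mult[OF l' that] by (simp add: l'_def fn_def)
  have "l' * v = 1\<^sub>m 1" unfolding e[OF v(1)] l(1) by (intro eq_matI) auto
  moreover have "l' * k = 0\<^sub>m 1 1" if "k \<in> K" for k
    unfolding e[OF column_spaceD(1)[OF K that]] using l(2) that by (intro eq_matI) auto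
  ultimately show ?thesis using l' by blast
qed

lemma mat_eq_by_columns:
  fixes A B :: "complex mat"
  assumes "A \<in> carrier_mat n m" "B \<in> carrier_mat n m" "\<And>u. u \<in> carrier_mat m 1 \<Longrightarrow> A * u = B * u"
  shows "A = B"
proof (rule eq_matI)
  fix i j assume "i < dim_row B" "j < dim_col B"
  then have ij: "i < n" "j < m" using assms by auto
  define u :: "complex mat" where "u = mat m 1 (\<lambda>(k, _). if k = j then 1 else 0)"
  have u: "u \<in> carrier_mat m 1" by (simp add: u_def)
  have "(C * u) $$ (i, 0) = C $$ (i, j)" if C: "C \<in> carrier_mat n m" for C
  proof -
    have "(C * u) $$ (i, 0) = (\<Sum>k = 0..<m. C $$ (i, k) * (if k = j then 1 else 0))"
      using C ij by (simp add: u_def scalar_prod_def)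
    also have "\<dots> = C $$ (i, j)" using ij by (simp add: if_distrib[where f = "(*) _"] cong: if_cong)
    finally show ?thesis .
  qed
  then show "A $$ (i, j) = B $$ (i, j)" using assms(1,2) assms(3)[OF u] by metis
qed (use assms in auto)

lemma mat_eq_zero_dim:
  assumes "A \<in> carrier_mat n m" "B \<in> carrier_mat n m" "n = 0 \<or> m = 0"
  shows "A = B"
  using assms by (intro eq_matI) auto

lemma smult_one_mat [simp]: "(1::'a::semiring_1) \<cdot>\<^sub>m A = A"
  by (intro eq_matI) auto

lemma column_diff_scaled:
  fixes u w :: "complex mat"
  assumes "u \<in> carrier_mat d 1" "w \<in> carrier_mat d 1"
  shows "u + (-1) \<cdot>\<^sub>m w = u - w" "w + (u - w) = u"
  using assms by (auto intro!: eq_matI)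

lemma column_add_cancel:
  fixes u w :: "complex mat"
  assumes "u \<in> carrier_mat d 1" "w \<in> carrier_mat d 1"
  shows "u + w + (-1) \<cdot>\<^sub>m w = u"
  using assms by (intro eq_matI) auto

text \<open>A retraction onto an interval representation starting at \<open>j\<close> is given by vectors \<open>v i\<close> and
  functionals \<open>l i\<close>. Prescribing \<open>v j \<in> W\<close> and \<open>l j\<close> vanishing on \<open>K\<close> is what makes the induction
  along the chain work, for either orientation of the next arrow.\<close>

lemma chain_retract:
  fixes f :: "nat \<Rightarrow> complex mat" and d :: "nat \<Rightarrow> nat"
  assumes f: "\<And>i. j \<le> i \<Longrightarrow> i < m \<Longrightarrow>
      f i \<in> (if fwd i then carrier_mat (d (Suc i)) (d i) else carrier_mat (d i) (d (Suc i)))"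
    and "j \<le> m" "column_space (d j) W" "column_space (d j) K" "K \<subset> W"
  shows "\<exists>b v l. j \<le> b \<and> b \<le> m \<and>
    (\<forall>i\<in>{j..b}. v i \<in> carrier_mat (d i) 1 \<and> l i \<in> carrier_mat 1 (d i) \<and> l i * v i = 1\<^sub>m 1) \<and>
    (\<forall>i\<in>{j..<b}. if fwd i then f i * v i = v (Suc i) \<and> l (Suc i) * f i = l i
                  else f i * v (Suc i) = v i \<and> l i * f i = l (Suc i)) \<and>
    (b < m \<longrightarrow> (if fwd b then f b * v b = 0\<^sub>m (d (Suc b)) 1 else l b * f b = 0\<^sub>m 1 (d (Suc b)))) \<and>
    v j \<in> W \<and> (\<forall>k\<in>K. l j * k = 0\<^sub>m 1 1)"
    (is "\<exists>b v l. ?P j W K b v l")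
  using assms(2) f assms(3-5)
proof (induction arbitrary: W K rule: inc_induct)
  case base
  obtain v where v: "v \<in> W" "v \<notin> K" using base by auto
  note vc = column_spaceD(1)[OF base(2) v(1)]
  obtain l where "l \<in> carrier_mat 1 (d m)" "l * v = 1\<^sub>m 1" "\<And>k. k \<in> K \<Longrightarrow> l * k = 0\<^sub>m 1 1"
    using separating_functional[OF base(3) vc v(2)] by blast
  then have "?P m W K m (\<lambda>_. v) (\<lambda>_. l)" using v vc by auto
  then show ?case by (rule exI[of _ m, OF exI[of _ "(\<lambda>_. v)", OF exI[of _ "(\<lambda>_. l)"]]])
next
  case (step j)
  note W = column_spaceD[OF step.prems(2)] and K = column_spaceD[OF step.prems(3)]
  have KW: "k \<in> W" if "k \<in> K" for k using that step.prems(4) by auto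
  have IH: "\<exists>b v l. ?P (Suc j) W' K' b v l"
    if "column_space (d (Suc j)) W'" "column_space (d (Suc j)) K'" "K' \<subset> W'" for W' K'
    by (rule step.IH[OF step.prems(1) that]) auto
  show ?case
  proof (cases "fwd j")
    case fwd: True
    have fj: "f j \<in> carrier_mat (d (Suc j)) (d j)" using step.prems(1)[of j] step.hyps fwd by auto
    have fadd: "f j * (u + c \<cdot>\<^sub>m w) = f j * u + c \<cdot>\<^sub>m (f j * w)"
      if "u \<in> carrier_mat (d j) 1" "w \<in> carrier_mat (d j) 1" for u w c
      using mult_add_distrib_mat[OF fj that(1) smult_carrier_mat[OF that(2)]] mult_smult_distrib[OF fj that(2)] by simp
    show ?thesis
    proof (cases "\<exists>v\<in>W. f j * v = 0\<^sub>m (d (Suc j)) 1 \<and> v \<notin> K")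
      \<comment> \<open>A vector of \<open>W\<close> outside \<open>K\<close> that dies along the
        arrow ends the interval at \<open>j\<close>.\<close>
      case True
      then obtain v where v: "v \<in> W" "f j * v = 0\<^sub>m (d (Suc j)) 1" "v \<notin> K" by blast
      obtain l where "l \<in> carrier_mat 1 (d j)" "l * v = 1\<^sub>m 1" "\<And>k. k \<in> K \<Longrightarrow> l * k = 0\<^sub>m 1 1"
    using separating_functional[OF step.prems(3) W(1)[OF v(1)] v(3)] by blast
      then have "?P j W K j (\<lambda>_. v) (\<lambda>_. l)" using v W(1)[OF v(1)] fwd step.hyps by auto
      then show ?thesis by (rule exI[of _ j, OF exI[of _ "(\<lambda>_. v)", OF exI[of _ "(\<lambda>_. l)"]]])
    next
      case False
      have img: "column_space (d (Suc j)) ((*) (f j) ` V)" if V: "column_space (d j) V" for V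
        unfolding column_space_def
      proof (intro conjI ballI allI subsetI)
        show "0\<^sub>m (d (Suc j)) 1 \<in> (*) (f j) ` V"
          using column_spaceD(2)[OF V] fj by (intro image_eqI[of _ _ "0\<^sub>m (d j) 1"]) auto
        fix u w c assume "u \<in> (*) (f j) ` V" "w \<in> (*) (f j) ` V"
        then obtain u' w' where *: "u = f j * u'" "u' \<in> V" "w = f j * w'" "w' \<in> V" by auto
        have "u + c \<cdot>\<^sub>m w = f j * (u' + c \<cdot>\<^sub>m w')"
          unfolding *(1,3) using column_spaceD(1)[OF V] *(2,4) by (intro fadd[symmetric]) auto
        then show "u + c \<cdot>\<^sub>m w \<in> (*) (f j) ` V" by (rule image_eqI) (rule column_spaceD(3)[OF V *(2,4)])
      qed (use column_spaceD(1)[OF V] fj in auto)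
      obtain w where w: "w \<in> W" "w \<notin> K" using step.prems(4) by auto
      \<comment> \<open>Two vectors of \<open>W\<close> with the same image differ by a vector of
        \<open>W\<close> that the arrow kills, and in this case all of those lie in
        \<open>K\<close>. So the images of \<open>K\<close> and \<open>W\<close> are still strictly
        nested, and the functional found at \<open>Suc j\<close> is pulled back along the
        arrow.\<close>
      have "f j * w \<notin> (*) (f j) ` K"
      proof
        assume "f j * w \<in> (*) (f j) ` K"
        then obtain k where k: "k \<in> K" "f j * w = f j * k" by auto
        note c = W(1)[OF w(1)] K(1)[OF k(1)]
        have "f j * (w + (-1) \<cdot>\<^sub>m k) = 0\<^sub>m (d (Suc j)) 1"
          unfolding fadd[OF c] k(2) using fj c by (subst column_diff_scaled(1)) auto
        then have "w + (-1) \<cdot>\<^sub>m k \<in> K" using False W(3)[OF w(1) KW[OF k(1)]] by blast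
        from K(3)[OF k(1) this, of 1] have "k + (w + (-1) \<cdot>\<^sub>m k) \<in> K" by simp
        then show False using w(2) column_diff_scaled(1,2)[OF c] by simp
      qed
      then have "(*) (f j) ` K \<subset> (*) (f j) ` W" using w(1) KW by blast
      from IH[OF img[OF step.prems(2)] img[OF step.prems(3)] this] obtain b v l
        where P: "?P (Suc j) ((*) (f j) ` W) ((*) (f j) ` K) b v l" by blast
      then obtain v0 where v0: "v0 \<in> W" "v (Suc j) = f j * v0" by auto
      define l0 where "l0 = l (Suc j) * f j"
      have lS: "l (Suc j) \<in> carrier_mat 1 (d (Suc j))" "l (Suc j) * v (Suc j) = 1\<^sub>m 1" using P by auto
      have "l0 \<in> carrier_mat 1 (d j)" using lS fj by (auto simp: l0_def)
      moreover have "l0 * u = l (Suc j) * (f j * u)" if "u \<in> W" for u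
        unfolding l0_def by (rule assoc_mult_mat[OF lS(1) fj W(1)[OF that]])
      ultimately have l0: "l0 \<in> carrier_mat 1 (d j)" "l0 * v0 = 1\<^sub>m 1" "\<And>k. k \<in> K \<Longrightarrow> l0 * k = 0\<^sub>m 1 1"
        using lS v0 KW P by auto
      have "?P j W K b (v(j := v0)) (l(j := l0))"
      proof (intro conjI ballI)
        fix i assume "i \<in> {j..<b}"
        then show "if fwd i then f i * (v(j := v0)) i = (v(j := v0)) (Suc i) \<and> (l(j := l0)) (Suc i) * f i = (l(j := l0)) i
          else f i * (v(j := v0)) (Suc i) = (v(j := v0)) i \<and> (l(j := l0)) i * f i = (l(j := l0)) (Suc i)"
          using P fwd v0 by (cases "i = j") (auto simp: l0_def)
      next
        fix i assume i: "i \<in> {j..b}"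
        show "(v(j := v0)) i \<in> carrier_mat (d i) 1" "(l(j := l0)) i \<in> carrier_mat 1 (d i)"
          "(l(j := l0)) i * (v(j := v0)) i = 1\<^sub>m 1"
          using P i l0 W(1)[OF v0(1)] by (cases "i = j"; auto)+
      qed (use P v0 l0 in auto)
      then show ?thesis by (rule exI[of _ b, OF exI[of _ "(v(j := v0))", OF exI[of _ "(l(j := l0))"]]])
    qed
  next
    case bwd: False
    have fj: "f j \<in> carrier_mat (d j) (d (Suc j))" using step.prems(1)[of j] step.hyps bwd by auto
    have fadd: "f j * (u + c \<cdot>\<^sub>m w) = f j * u + c \<cdot>\<^sub>m (f j * w)"
      if "u \<in> carrier_mat (d (Suc j)) 1" "w \<in> carrier_mat (d (Suc j)) 1" for u w c
      using mult_add_distrib_mat[OF fj that(1) smult_carrier_mat[OF that(2)]] mult_smult_distrib[OF fj that(2)] by simp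
    have sumsp: "column_space (d j) {k + f j * u | k u. k \<in> K \<and> u \<in> V}"
      if V: "column_space (d (Suc j)) V" for V
      unfolding column_space_def
    proof (intro conjI ballI allI subsetI)
      show "0\<^sub>m (d j) 1 \<in> {k + f j * u | k u. k \<in> K \<and> u \<in> V}"
        using K(2) column_spaceD(2)[OF V] fj
        by (intro CollectI exI[of _ "0\<^sub>m (d j) 1"] exI[of _ "0\<^sub>m (d (Suc j)) 1"]) auto
      fix u w c assume "u \<in> {k + f j * u | k u. k \<in> K \<and> u \<in> V}" "w \<in> {k + f j * u | k u. k \<in> K \<and> u \<in> V}"
      then obtain k1 u1 k2 u2 where *: "u = k1 + f j * u1" "k1 \<in> K" "u1 \<in> V" "w = k2 + f j * u2" "k2 \<in> K" "u2 \<in> V"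
        by blast
      note c = K(1)[OF *(2)] K(1)[OF *(5)] column_spaceD(1)[OF V *(3)] column_spaceD(1)[OF V *(6)]
      have "u + c \<cdot>\<^sub>m w = (k1 + c \<cdot>\<^sub>m k2) + f j * (u1 + c \<cdot>\<^sub>m u2)"
        unfolding *(1,4) fadd[OF c(3,4)] using c fj by (intro eq_matI) (auto simp: algebra_simps simp del: index_mult_mat(1))
      moreover have "(k1 + c \<cdot>\<^sub>m k2) + f j * (u1 + c \<cdot>\<^sub>m u2) \<in> {k + f j * u | k u. k \<in> K \<and> u \<in> V}"
        using K(3)[OF *(2,5)] column_spaceD(3)[OF V *(3,6)] by blast
      ultimately show "u + c \<cdot>\<^sub>m w \<in> {k + f j * u | k u. k \<in> K \<and> u \<in> V}" by (simp only:)
    qed (use column_spaceD(1)[OF V] K(1) fj in auto)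
    have full: "column_space (d (Suc j)) (carrier_mat (d (Suc j)) 1)" by (auto simp: column_space_def)
    \<comment> \<open>\<open>K\<close> plus the image of the arrow. A vector of \<open>W\<close>
      outside \<open>S\<close> admits a functional that vanishes on \<open>K\<close> and kills the
      arrow, which ends the interval at \<open>j\<close>.\<close>
    define S where "S = {k + f j * u | k u. k \<in> K \<and> u \<in> carrier_mat (d (Suc j)) 1}"
    have S: "column_space (d j) S" unfolding S_def by (rule sumsp[OF full])
    have memS: "k + f j * u \<in> S" if "k \<in> K" "u \<in> carrier_mat (d (Suc j)) 1" for k u using that unfolding S_def by blast
    show ?thesis
    proof (cases "W \<subseteq> S")
      case False
      then obtain v where v: "v \<in> W" "v \<notin> S" by blast
      obtain l where l: "l \<in> carrier_mat 1 (d j)" "l * v = 1\<^sub>m 1" "\<And>k. k \<in> S \<Longrightarrow> l * k = 0\<^sub>m 1 1"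
    using separating_functional[OF S W(1)[OF v(1)] v(2)] by blast
      have "l * k = 0\<^sub>m 1 1" if k: "k \<in> K" for k
      proof (rule l(3))
        have "k + f j * 0\<^sub>m (d (Suc j)) 1 \<in> S" by (rule memS[OF k]) simp
        moreover have "k + f j * 0\<^sub>m (d (Suc j)) 1 = k" using K(1)[OF k] fj by simp
        ultimately show "k \<in> S" by (simp only:)
      qed
      moreover have "l * f j = 0\<^sub>m 1 (d (Suc j))"
      proof (rule mat_eq_by_columns)
        fix u :: "complex mat" assume u: "u \<in> carrier_mat (d (Suc j)) 1"
        have "0\<^sub>m (d j) 1 + f j * u \<in> S" by (rule memS[OF K(2) u])
        from l(3)[OF this] have "l * (f j * u) = 0\<^sub>m 1 1" using mult_carrier_mat[OF fj u] by simp
        then show "l * f j * u = 0\<^sub>m 1 (d (Suc j)) * u" using assoc_mult_mat[OF l(1) fj u] u by simp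
      qed (use l fj in auto)
      ultimately have "?P j W K j (\<lambda>_. v) (\<lambda>_. l)" using v W(1)[OF v(1)] bwd step.hyps l by auto
      then show ?thesis by (rule exI[of _ j, OF exI[of _ "(\<lambda>_. v)", OF exI[of _ "(\<lambda>_. l)"]]])
    next
      case True
      have pre: "column_space (d (Suc j)) {u \<in> carrier_mat (d (Suc j)) 1. f j * u \<in> V}" if V: "column_space (d j) V" for V
        using column_spaceD(2,3)[OF V] fj fadd unfolding column_space_def by auto
      \<comment> \<open>Now \<open>W\<close> lies in \<open>K\<close> plus the image. The image part
        of a vector in \<open>W\<close> but not in \<open>K\<close> shows that the preimages of
        \<open>K\<close> and \<open>W\<close> are still strictly nested.\<close>
      define W2 where "W2 = {u \<in> carrier_mat (d (Suc j)) 1. f j * u \<in> W}"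
      define K2 where "K2 = {u \<in> carrier_mat (d (Suc j)) 1. f j * u \<in> K}"
      have W2: "column_space (d (Suc j)) W2" and K2: "column_space (d (Suc j)) K2"
        unfolding W2_def K2_def by (rule pre[OF step.prems(2)], rule pre[OF step.prems(3)])
      obtain w where w: "w \<in> W" "w \<notin> K" using step.prems(4) by auto
      then obtain k u where ku: "w = k + f j * u" "k \<in> K" "u \<in> carrier_mat (d (Suc j)) 1" using True unfolding S_def by blast
      note c = W(1)[OF w(1)] K(1)[OF ku(2)] mult_carrier_mat[OF fj ku(3)]
      have "f j * u = w + (-1) \<cdot>\<^sub>m k" unfolding ku(1) using c by (intro eq_matI) (auto simp del: index_mult_mat(1))
      then have "f j * u \<in> W" using W(3)[OF w(1) KW[OF ku(2)]] by simp
      moreover have "f j * u \<notin> K" using K(3)[OF ku(2), of "f j * u" 1] w(2) ku(1) by auto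
      ultimately have "K2 \<subset> W2" using KW ku(3) unfolding K2_def W2_def by blast
      from IH[OF W2 K2 this] obtain b v l
        where P: "?P (Suc j) W2 K2 b v l" by blast
      define x where "x = v (Suc j)"
      define l2 where "l2 = l (Suc j)"
      have x: "x \<in> carrier_mat (d (Suc j)) 1" "f j * x \<in> W" and l2: "l2 \<in> carrier_mat 1 (d (Suc j))" "l2 * x = 1\<^sub>m 1"
        and l2K: "\<And>k. k \<in> K2 \<Longrightarrow> l2 * k = 0\<^sub>m 1 1"
        using P by (auto simp: x_def l2_def W2_def)
      have l2add: "l2 * (u + c \<cdot>\<^sub>m w) = l2 * u + c \<cdot>\<^sub>m (l2 * w)"
        if "u \<in> carrier_mat (d (Suc j)) 1" "w \<in> carrier_mat (d (Suc j)) 1" for u w c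
        using mult_add_distrib_mat[OF l2(1) that(1) smult_carrier_mat[OF that(2)]] mult_smult_distrib[OF l2(1) that(2)] by simp
      let ?N = "{y \<in> carrier_mat (d (Suc j)) 1. l2 * y = 0\<^sub>m 1 1}"
      have N: "column_space (d (Suc j)) ?N"
        using l2(1) l2add unfolding column_space_def by auto
      \<comment> \<open>The functional at \<open>j\<close> has to restrict to \<open>l2\<close>
        along the arrow, so it must vanish on the image of the kernel of \<open>l2\<close> besides
        \<open>K\<close>. Since \<open>f j * x\<close> avoids \<open>T\<close>, the value 1 can be
        prescribed there.\<close>
      define T where "T = {k + f j * u | k u. k \<in> K \<and> u \<in> ?N}"
      have T: "column_space (d j) T" unfolding T_def by (rule sumsp[OF N])
      have memT: "k + f j * u \<in> T" if "k \<in> K" "u \<in> carrier_mat (d (Suc j)) 1" "l2 * u = 0\<^sub>m 1 1" for k u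
        using that unfolding T_def by blast
      have "f j * x \<notin> T"
      proof
        assume "f j * x \<in> T"
        then obtain k y where ky: "f j * x = k + f j * y" "k \<in> K" "y \<in> carrier_mat (d (Suc j)) 1" "l2 * y = 0\<^sub>m 1 1" unfolding T_def by blast
        note c = K(1)[OF ky(2)] mult_carrier_mat[OF fj ky(3)]
        have "f j * (x + (-1) \<cdot>\<^sub>m y) = k"
          unfolding fadd[OF x(1) ky(3)] ky(1) by (rule column_add_cancel[OF c])
        then have "l2 * (x + (-1) \<cdot>\<^sub>m y) = 0\<^sub>m 1 1" using ky x by (intro l2K) (auto simp: K2_def)
        then have "1\<^sub>m 1 + (-1) \<cdot>\<^sub>m 0\<^sub>m 1 1 = (0\<^sub>m 1 1 :: complex mat)"
          unfolding l2add[OF x(1) ky(3)] l2(2) ky(4) .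
        from arg_cong[OF this, of "\<lambda>M. M $$ (0, 0)"] show False by simp
      qed
      then obtain l0 where l0: "l0 \<in> carrier_mat 1 (d j)" "l0 * (f j * x) = 1\<^sub>m 1" "\<And>k. k \<in> T \<Longrightarrow> l0 * k = 0\<^sub>m 1 1"
        using separating_functional[OF T W(1)[OF x(2)]] by blast
      have l0K: "l0 * k = 0\<^sub>m 1 1" if k: "k \<in> K" for k
      proof (rule l0(3))
        have "k + f j * 0\<^sub>m (d (Suc j)) 1 \<in> T" using column_spaceD(2)[OF N] by (intro memT[OF k]) auto
        moreover have "k + f j * 0\<^sub>m (d (Suc j)) 1 = k" using K(1)[OF k] fj by simp
        ultimately show "k \<in> T" by (simp only:)
      qed
      \<comment> \<open>Every \<open>u\<close> is a multiple of \<open>x\<close> plus a vector in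
        the kernel of \<open>l2\<close>, and the two functionals agree on both parts.\<close>
      have l0f: "l0 * f j = l2"
      proof (rule mat_eq_by_columns)
        fix u :: "complex mat" assume u: "u \<in> carrier_mat (d (Suc j)) 1"
        define c where "c = (l2 * u) $$ (0, 0)"
        have lu: "l2 * u = c \<cdot>\<^sub>m 1\<^sub>m 1" using l2 u by (intro eq_matI) (auto simp: c_def simp del: index_mult_mat(1))
        define y where "y = u + (- c) \<cdot>\<^sub>m x"
        have y: "y \<in> carrier_mat (d (Suc j)) 1" using u x by (auto simp: y_def)
        have "l2 * y = 0\<^sub>m 1 1" unfolding y_def l2add[OF u x(1)] lu l2(2) by (intro eq_matI) auto
        then have "0\<^sub>m (d j) 1 + f j * y \<in> T" by (rule memT[OF K(2) y])
        from l0(3)[OF this] have "l0 * (f j * y) = 0\<^sub>m 1 1" using mult_carrier_mat[OF fj y] by simp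
        moreover have "u = y + c \<cdot>\<^sub>m x" using u x by (intro eq_matI) (auto simp: y_def)
        ultimately have "l0 * (f j * u) = 0\<^sub>m 1 1 + c \<cdot>\<^sub>m (l0 * (f j * x))"
          using fadd[OF y x(1), of c] mult_add_distrib_mat[OF l0(1) mult_carrier_mat[OF fj y] smult_carrier_mat[OF mult_carrier_mat[OF fj x(1)]]]
            mult_smult_distrib[OF l0(1) mult_carrier_mat[OF fj x(1)]] by simp
        also have "\<dots> = c \<cdot>\<^sub>m 1\<^sub>m 1" unfolding l0(2) by (intro eq_matI) auto
        finally show "l0 * f j * u = l2 * u" using assoc_mult_mat[OF l0(1) fj u] lu by simp
      qed (use l0 l2 fj in auto)
      have "?P j W K b (v(j := f j * x)) (l(j := l0))"
      proof (intro conjI ballI)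
        fix i assume "i \<in> {j..<b}"
        then show "if fwd i then f i * (v(j := f j * x)) i = (v(j := f j * x)) (Suc i) \<and> (l(j := l0)) (Suc i) * f i = (l(j := l0)) i
          else f i * (v(j := f j * x)) (Suc i) = (v(j := f j * x)) i \<and> (l(j := l0)) i * f i = (l(j := l0)) (Suc i)"
          using P bwd l0f by (cases "i = j") (auto simp: x_def l2_def)
      next
        fix i assume i: "i \<in> {j..b}"
        show "(v(j := f j * x)) i \<in> carrier_mat (d i) 1" "(l(j := l0)) i \<in> carrier_mat 1 (d i)"
          "(l(j := l0)) i * (v(j := f j * x)) i = 1\<^sub>m 1"
          using P i l0 W(1)[OF x(2)] by (cases "i = j"; auto)+
      qed (use P x l0 l0K in auto)
      then show ?thesis by (rule exI[of _ b, OF exI[of _ "(v(j := f j * x))", OF exI[of _ "(l(j := l0))"]]])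
    qed
  qed
qed

text \<open>In the given labelling the numerical order of the vertices other than \<open>n\<close>
  is the order along the path, and \<open>e i\<close> names the arrow between \<open>i\<close> and
  \<open>i + 1\<close>, whatever its orientation.\<close>

definition chain_quiver :: "nat \<Rightarrow> (nat, 'b) pre_digraph \<Rightarrow> (nat \<Rightarrow> 'b) \<Rightarrow> bool" where
  "chain_quiver m Q e \<longleftrightarrow> wf_digraph Q \<and> verts Q = {1..m} \<and> arcs Q = e ` {1..<m} \<and>
     (\<forall>i\<in>{1..<m}. tail Q (e i) = i \<and> head Q (e i) = Suc i \<or> tail Q (e i) = Suc i \<and> head Q (e i) = i)"

text \<open>The scalars \<open>v i\<close> are basis vectors respected by all arrows inside the
  interval, that is, an isomorphism with the interval representation whose inner maps are 1. They
  are non-zero outside the interval too, so that quotients of two such families need no case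
  distinction.\<close>

definition interval_rep ::
    "(nat, 'b) pre_digraph \<Rightarrow> nat \<Rightarrow> nat \<Rightarrow> (nat, 'b) quiver_rep \<Rightarrow> (nat \<Rightarrow> complex) \<Rightarrow> bool" where
  "interval_rep Q j b X v \<longleftrightarrow> is_rep Q X \<and> (\<forall>i. dimv X i = (if j \<le> i \<and> i \<le> b then 1 else 0)) \<and>
     (\<forall>i. v i \<noteq> 0) \<and>
     (\<forall>a\<in>arcs Q. tail Q a \<in> {j..b} \<longrightarrow> head Q a \<in> {j..b} \<longrightarrow> maps X a $$ (0, 0) * v (tail Q a) = v (head Q a))"

lemma one_by_one_mult:
  assumes "A \<in> carrier_mat 1 1" "B \<in> carrier_mat 1 1"
  shows "(A * B :: complex mat) $$ (0, 0) = A $$ (0, 0) * B $$ (0, 0)"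
  using assms by (simp add: scalar_prod_def)

text \<open>Apply \<open>chain_retract\<close> at the first vertex \<open>j\<close> of the support,
  with the full space as \<open>W\<close> and zero as \<open>K\<close>. The retraction yields an
  idempotent endomorphism of rank one on \<open>{j..b}\<close>; it is not zero, so by
  indecomposability it is the identity, which forces dimension 1 on the interval and 0
  elsewhere.\<close>

lemma indecomposable_chain_interval:
  assumes chain: "chain_quiver m Q e" and ind: "indecomposable_rep Q X"
    and j: "1 \<le> j" "j \<le> m" "dimv X j \<noteq> 0" "\<And>i. 1 \<le> i \<Longrightarrow> i < j \<Longrightarrow> dimv X i = 0"
  obtains b v where "j \<le> b" "b \<le> m" "interval_rep Q j b X v"
proof -
  have wf: "wf_digraph Q" and V: "verts Q = {1..m}" and A: "arcs Q = e ` {1..<m}"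
    and o: "\<And>i. i \<in> {1..<m} \<Longrightarrow> tail Q (e i) = i \<and> head Q (e i) = Suc i \<or> tail Q (e i) = Suc i \<and> head Q (e i) = i"
    using chain by (auto simp: chain_quiver_def)
  have X: "is_rep Q X" using ind by (simp add: indecomposable_rep_def)
  define d where "d = dimv X"
  define fwd where "fwd = (\<lambda>i. tail Q (e i) = i)"
  define f where "f = (\<lambda>i. maps X (e i))"
  have car: "f i \<in> (if fwd i then carrier_mat (d (Suc i)) (d i) else carrier_mat (d i) (d (Suc i)))"
    if "1 \<le> i" "i < m" for i
    using is_repD(1)[OF X, of "e i"] o[of i] that by (auto simp: A f_def fwd_def d_def)
  have full: "column_space (d j) (carrier_mat (d j) 1)" and null: "column_space (d j) {0\<^sub>m (d j) 1}"
    by (auto simp: column_space_def)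
  define u :: "complex mat" where "u = mat (d j) 1 (\<lambda>_. 1)"
  have u: "u \<in> carrier_mat (d j) 1" by (simp add: u_def)
  have "u $$ (0, 0) \<noteq> 0\<^sub>m (d j) 1 $$ (0, 0)" using j(3) by (simp add: u_def d_def)
  then have "u \<noteq> 0\<^sub>m (d j) 1" by metis
  then have sub: "{0\<^sub>m (d j) 1} \<subset> (carrier_mat (d j) 1 :: complex mat set)"
  proof (intro psubsetI notI)
    assume "{0\<^sub>m (d j) 1} = (carrier_mat (d j) 1 :: complex mat set)"
    then have "u \<in> {0\<^sub>m (d j) 1}" using u by (simp only:)
    then show False using \<open>u \<noteq> 0\<^sub>m (d j) 1\<close> by simp
  qed simp
  have car': "f i \<in> (if fwd i then carrier_mat (d (Suc i)) (d i) else carrier_mat (d i) (d (Suc i)))"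
    if "j \<le> i" "i < m" for i
    by (rule car[OF le_trans[OF j(1) that(1)] that(2)])
  note retract = chain_retract[of j m f fwd d, OF car' j(2) full null sub]
  obtain b v l where P: "j \<le> b \<and> b \<le> m \<and>
    (\<forall>i\<in>{j..b}. v i \<in> carrier_mat (d i) 1 \<and> l i \<in> carrier_mat 1 (d i) \<and> l i * v i = 1\<^sub>m 1) \<and>
    (\<forall>i\<in>{j..<b}. if fwd i then f i * v i = v (Suc i) \<and> l (Suc i) * f i = l i
                  else f i * v (Suc i) = v i \<and> l i * f i = l (Suc i)) \<and>
    (b < m \<longrightarrow> (if fwd b then f b * v b = 0\<^sub>m (d (Suc b)) 1 else l b * f b = 0\<^sub>m 1 (d (Suc b)))) \<and>
    v j \<in> carrier_mat (d j) 1 \<and> (\<forall>k\<in>{0\<^sub>m (d j) 1}. l j * k = 0\<^sub>m 1 1)"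
    by (atomize_elim, rule retract; assumption)
  have b: "j \<le> b" "b \<le> m" by (rule conjunct1[OF P], rule conjunct1[OF conjunct2[OF P]])
  have vl: "v i \<in> carrier_mat (d i) 1 \<and> l i \<in> carrier_mat 1 (d i) \<and> l i * v i = 1\<^sub>m 1" if "i \<in> {j..b}" for i
    by (rule bspec[OF conjunct1[OF conjunct2[OF conjunct2[OF P]]] that])
  have arr: "if fwd i then f i * v i = v (Suc i) \<and> l (Suc i) * f i = l i
                  else f i * v (Suc i) = v i \<and> l i * f i = l (Suc i)" if "i \<in> {j..<b}" for i
    by (rule bspec[OF conjunct1[OF conjunct2[OF conjunct2[OF conjunct2[OF P]]]] that])
  have bd: "if fwd b then f b * v b = 0\<^sub>m (d (Suc b)) 1 else l b * f b = 0\<^sub>m 1 (d (Suc b))" if "b < m"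
    by (rule mp[OF conjunct1[OF conjunct2[OF conjunct2[OF conjunct2[OF conjunct2[OF P]]]]] that])
  define E where "E = (\<lambda>i. if i \<in> {j..b} then v i * l i else 0\<^sub>m (d i) (d i))"
  have Ec: "E i \<in> carrier_mat (d i) (d i)" for i
    using vl[of i] by (auto simp: E_def)
  have comm: "if fwd i then E (Suc i) * f i = f i * E i else E i * f i = f i * E (Suc i)" if i: "1 \<le> i" "i < m" for i
  proof -
    consider "j \<le> i" "i < b" | "i = b" | "i > b" | "Suc i = j" | "Suc i < j" by linarith
    then show ?thesis
    proof cases
      case 1
      then have vs: "v i \<in> carrier_mat (d i) 1" "l i \<in> carrier_mat 1 (d i)"
        "v (Suc i) \<in> carrier_mat (d (Suc i)) 1" "l (Suc i) \<in> carrier_mat 1 (d (Suc i))"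
        using vl[of i] vl[of "Suc i"] by auto
      show ?thesis
      proof (cases "fwd i")
        case True
        then have fi: "f i \<in> carrier_mat (d (Suc i)) (d i)" using car[OF i] by simp
        show ?thesis using True 1 arr[of i] assoc_mult_mat[OF vs(3,4) fi] assoc_mult_mat[OF fi vs(1,2)]
          by (simp add: E_def)
      next
        case False
        then have fi: "f i \<in> carrier_mat (d i) (d (Suc i))" using car[OF i] by simp
        show ?thesis using False 1 arr[of i] assoc_mult_mat[OF vs(1,2) fi] assoc_mult_mat[OF fi vs(3,4)]
          by (simp add: E_def)
      qed
    next
      case 2
      then have vs: "v i \<in> carrier_mat (d i) 1" "l i \<in> carrier_mat 1 (d i)"
        using vl[of i] b by auto
      show ?thesis
      proof (cases "fwd i")
        case True
        then have fi: "f i \<in> carrier_mat (d (Suc i)) (d i)" using car[OF i] by simp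
        show ?thesis using True 2 b bd i vs fi assoc_mult_mat[OF fi vs(1,2)] by (simp add: E_def)
      next
        case False
        then have fi: "f i \<in> carrier_mat (d i) (d (Suc i))" using car[OF i] by simp
        show ?thesis using False 2 b bd i vs fi assoc_mult_mat[OF vs(1,2) fi] by (simp add: E_def)
      qed
    next
      case 3
      then show ?thesis using car[OF i] by (auto simp: E_def split: if_splits)
    next
      case 4
      \<comment> \<open>The retraction says nothing about the arrow between \<open>j - 1\<close> and
        \<open>j\<close>; it is harmless because the space at \<open>j - 1\<close> is zero,
        \<open>j\<close> being the first vertex of the support.\<close>
      then have "d i = 0" using j(4)[of i] i by (simp add: d_def)
      note z = this Ec[of i] Ec[of "Suc i"] car[OF i]
      show ?thesis
      proof (cases "fwd i")
        case True
        then have "E (Suc i) * f i = f i * E i" using z by (intro mat_eq_zero_dim[of _ "d (Suc i)" 0]) auto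
        then show ?thesis using True by simp
      next
        case False
        then have "E i * f i = f i * E (Suc i)" using z by (intro mat_eq_zero_dim[of _ 0 "d (Suc i)"]) auto
        then show ?thesis using False by simp
      qed
    next
      case 5
      then show ?thesis using car[OF i] by (auto simp: E_def split: if_splits)
    qed
  qed
  have hom: "ishom Q X X E"
    unfolding ishom_def
  proof (intro conjI ballI)
    fix a assume "a \<in> arcs Q"
    then obtain i where i: "i \<in> {1..<m}" "a = e i" by (auto simp: A)
    then show "E (head Q a) * maps X a = maps X a * E (tail Q a)"
      using o[OF i(1)] comm[of i] by (auto simp: fwd_def f_def)
  qed (use Ec in \<open>auto simp: d_def\<close>)
  have idem: "E x * E x = E x" for x
  proof (cases "x \<in> {j..b}")
    case True
    have c: "v x \<in> carrier_mat (d x) 1" "l x \<in> carrier_mat 1 (d x)" "l x * v x = 1\<^sub>m 1"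
      using vl[OF True] by auto
    have "v x * l x * (v x * l x) = v x * (l x * (v x * l x))"
      by (rule assoc_mult_mat[OF c(1,2) mult_carrier_mat[OF c(1,2)]])
    also have "l x * (v x * l x) = l x * v x * l x" by (rule assoc_mult_mat[OF c(2,1,2), symmetric])
    also have "\<dots> = l x" using c by simp
    finally show ?thesis using True by (auto simp: E_def)
  qed (auto simp: E_def)
  have jV: "j \<in> {j..b}" "j \<in> verts Q" using b j V by auto
  note cj = vl[OF jV(1)]
  have "E j \<noteq> 0\<^sub>m (d j) (d j)"
  proof
    assume *: "E j = 0\<^sub>m (d j) (d j)"
    have c: "v j \<in> carrier_mat (d j) 1" "l j \<in> carrier_mat 1 (d j)" using cj by auto
    have "E j * v j = v j * (l j * v j)"
      using jV assoc_mult_mat[OF c(1,2,1)] by (simp add: E_def)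
    then have "l j * (E j * v j) = l j * v j * (l j * v j)"
      using assoc_mult_mat[OF c(2,1) mult_carrier_mat[OF c(2,1)]] by simp
    also have "\<dots> = 1\<^sub>m 1" using cj by simp
    finally have "0\<^sub>m 1 1 = (1\<^sub>m 1 :: complex mat)" unfolding * using cj by auto
    from arg_cong[OF this, of "\<lambda>M. M $$ (0, 0)"] show False by simp
  qed
  then have one: "E x = 1\<^sub>m (d x)" if "x \<in> verts Q" for x
    using indecomposable_idempotent[OF wf ind hom idem] jV that by (auto simp: d_def)
  have d1: "d i = 1" if i: "i \<in> {j..b}" for i
  proof (rule antisym)
    have iV: "i \<in> verts Q" using i b j V by auto
    note c = vl[OF i]
    have "v i * l i = 1\<^sub>m (d i)" using one[OF iV] i by (simp add: E_def)
    then show "d i \<le> 1" using c one_mat_factor_le by blast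
    show "1 \<le> d i" using c one_mat_factor_le by blast
  qed
  have d0: "d i = 0" if i: "i \<notin> {j..b}" for i
  proof (cases "i \<in> verts Q")
    case True
    have "E i = 0\<^sub>m (d i) (d i)" using i by (auto simp: E_def)
    then have *: "0\<^sub>m (d i) (d i) = (1\<^sub>m (d i) :: complex mat)" using one[OF True] by simp
    show ?thesis
    proof (rule ccontr)
      assume "d i \<noteq> 0"
      then show False using arg_cong[OF *, of "\<lambda>M. M $$ (0, 0)"] by simp
    qed
  qed (use is_repD(4)[OF X] in \<open>simp add: d_def\<close>)
  define s where "s = (\<lambda>i. if i \<in> {j..b} then v i $$ (0, 0) else 1)"
  have c1: "v i \<in> carrier_mat 1 1" "l i \<in> carrier_mat 1 1" if "i \<in> {j..b}" for i
    using vl[OF that] d1[OF that] by auto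
  have s0: "s i \<noteq> 0" for i
  proof (cases "i \<in> {j..b}")
    case True
    have "l i $$ (0, 0) * v i $$ (0, 0) = 1"
      using one_by_one_mult[OF c1(2,1)[OF True]] vl[OF True] by simp
    then show ?thesis using True by (auto simp: s_def)
  qed (auto simp: s_def)
  have "maps X a $$ (0, 0) * s (tail Q a) = s (head Q a)"
    if a: "a \<in> arcs Q" "tail Q a \<in> {j..b}" "head Q a \<in> {j..b}" for a
  proof -
    obtain i where i: "i \<in> {1..<m}" "a = e i" using a by (auto simp: A)
    then have ij: "i \<in> {j..<b}" using a(2,3) o[OF i(1)] by auto
    then have "f i \<in> carrier_mat 1 1" using car[of i] i d1[of i] d1[of "Suc i"] by (auto split: if_splits)
    then have "f i $$ (0, 0) * v k $$ (0, 0) = (f i * v k) $$ (0, 0)" if "k \<in> {j..b}" for k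
      using one_by_one_mult c1(1)[OF that] by simp
    then show ?thesis using arr[OF ij] o[OF i(1)] ij a(2,3) by (auto simp: s_def f_def fwd_def i(2) split: if_splits)
  qed
  then have "interval_rep Q j b X s"
    using X s0 d1 d0 unfolding interval_rep_def d_def by auto
  then show ?thesis using that b by blast
qed

lemma interval_dims:
  assumes "interval_rep Q j b X v"
  shows "is_rep Q X" "dimv X i = (if j \<le> i \<and> i \<le> b then 1 else 0)"
  using assms by (auto simp: interval_rep_def)

lemma interval_map_nonzero:
  assumes "interval_rep Q j b X v" "a \<in> arcs Q" "tail Q a \<in> {j..b}" "head Q a \<in> {j..b}"
  shows "maps X a $$ (0, 0) \<noteq> 0" "maps X a \<in> carrier_mat 1 1"
proof -
  show "maps X a $$ (0, 0) \<noteq> 0" using assms by (auto simp: interval_rep_def)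
  show "maps X a \<in> carrier_mat 1 1"
    using is_repD(1)[OF interval_dims(1)[OF assms(1)] assms(2)] assms by (auto simp: interval_dims(2)[OF assms(1)])
qed

lemma interval_hom_step:
  assumes X: "interval_rep Q j b X v" and Y: "interval_rep Q j' b' Y w" and h: "ishom Q X Y \<phi>"
    and wf: "wf_digraph Q" and a: "a \<in> arcs Q" "tail Q a \<in> {j..b} \<inter> {j'..b'}" "head Q a \<in> {j..b} \<inter> {j'..b'}"
  shows "\<phi> (tail Q a) $$ (0, 0) = 0 \<longleftrightarrow> \<phi> (head Q a) $$ (0, 0) = 0"
proof -
  interpret wf_digraph Q by fact
  have c: "\<phi> (tail Q a) \<in> carrier_mat 1 1" "\<phi> (head Q a) \<in> carrier_mat 1 1"
    using ishomD(1)[OF h, of "tail Q a"] ishomD(1)[OF h, of "head Q a"] a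
    by (auto simp: interval_dims(2)[OF X] interval_dims(2)[OF Y])
  have m: "maps X a $$ (0, 0) \<noteq> 0" "maps X a \<in> carrier_mat 1 1" "maps Y a $$ (0, 0) \<noteq> 0" "maps Y a \<in> carrier_mat 1 1"
    using interval_map_nonzero[OF X a(1)] interval_map_nonzero[OF Y a(1)] a(2,3) by auto
  have "\<phi> (head Q a) $$ (0, 0) * maps X a $$ (0, 0) = maps Y a $$ (0, 0) * \<phi> (tail Q a) $$ (0, 0)"
    using arg_cong[OF ishomD(4)[OF h a(1)], of "\<lambda>M. M $$ (0, 0)"] one_by_one_mult[OF c(2) m(2)] one_by_one_mult[OF m(4) c(1)]
    by simp
  then show ?thesis using m by auto
qed

text \<open>Two intervals through 2 meet in an interval through 2, and on it all arrow maps of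
  \<open>X\<close> and \<open>Y\<close> are non-zero scalars. Hence a morphism vanishes at all
  common vertices or at none, and vertex 2 decides.\<close>

lemma interval_hom_nonzero_at_2:
  assumes chain: "chain_quiver m Q e"
    and X: "interval_rep Q j b X v" and Y: "interval_rep Q j' b' Y w" and h: "ishom Q X Y \<phi>"
    and jb: "1 \<le> j" "j \<le> 2" "2 \<le> b" "b \<le> m" "1 \<le> j'" "j' \<le> 2" "2 \<le> b'" "b' \<le> m"
    and nz: "x \<in> verts Q" "\<phi> x \<noteq> 0\<^sub>m (dimv Y x) (dimv X x)"
  shows "\<phi> 2 $$ (0, 0) \<noteq> 0"
proof -
  have wf: "wf_digraph Q" and V: "verts Q = {1..m}" and A: "arcs Q = e ` {1..<m}"
    and o: "\<And>i. i \<in> {1..<m} \<Longrightarrow> tail Q (e i) = i \<and> head Q (e i) = Suc i \<or> tail Q (e i) = Suc i \<and> head Q (e i) = i"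
    using chain by (auto simp: chain_quiver_def)
  have adj: "\<phi> i $$ (0, 0) = 0 \<longleftrightarrow> \<phi> (Suc i) $$ (0, 0) = 0"
    if "i \<in> {j..b} \<inter> {j'..b'}" "Suc i \<in> {j..b} \<inter> {j'..b'}" for i
  proof -
    have i: "i \<in> {1..<m}" "e i \<in> arcs Q" using that jb A by auto
    show ?thesis using interval_hom_step[OF X Y h wf i(2)] o[OF i(1)] that by auto
  qed
  note c = ishomD(1)[OF h nz(1)]
  have x: "x \<in> {j..b} \<inter> {j'..b'}"
  proof (rule ccontr)
    assume "x \<notin> {j..b} \<inter> {j'..b'}"
    then have "dimv Y x = 0 \<or> dimv X x = 0" by (auto simp: interval_dims(2)[OF X] interval_dims(2)[OF Y])
    then have "\<phi> x = 0\<^sub>m (dimv Y x) (dimv X x)" using c by (intro mat_eq_zero_dim) auto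
    then show False using nz by simp
  qed
  then have d: "dimv X x = 1" "dimv Y x = 1" by (auto simp: interval_dims(2)[OF X] interval_dims(2)[OF Y])
  have nz0: "\<phi> x $$ (0, 0) \<noteq> 0"
  proof
    assume "\<phi> x $$ (0, 0) = 0"
    then have "\<phi> x = 0\<^sub>m 1 1" using c d by (intro eq_matI) auto
    then show False using nz d by simp
  qed
  show ?thesis
  proof (cases "x \<ge> 2")
    case True
    have "2 \<le> y \<longrightarrow> \<phi> y $$ (0, 0) \<noteq> 0" if "y \<le> x" for y
      using that
    proof (induction rule: inc_induct)
      case base
      show ?case using nz0 by simp
    next
      case (step y)
      show ?case
      proof
        assume "2 \<le> y"
        then show "\<phi> y $$ (0, 0) \<noteq> 0" using adj[of y] step x jb by auto
      qed
    qed
    then show ?thesis using True by blast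
  next
    case False
    then have "x = 1" "Suc x = 2" using x jb by auto
    then show ?thesis using adj[of 1] x jb nz0 by (auto simp: numeral_2_eq_2)
  qed
qed

section \<open>Dense orbits\<close>

text \<open>A product of functions cuts out the intersection of their non-vanishing loci, so these
  loci form a base and every open neighbourhood of a point contains one around it.\<close>

lemma zariski_dense_iff:
  assumes "U \<subseteq> rep_space Q \<alpha>"
  shows "zariski Q \<alpha> closure_of U = rep_space Q \<alpha> \<longleftrightarrow>
    (\<forall>h\<in>regular_functions Q \<alpha>. (\<forall>S\<in>U. h S = 0) \<longrightarrow> (\<forall>S\<in>rep_space Q \<alpha>. h S = 0))"
proof -
  let ?B = "(\<lambda>f. {R \<in> rep_space Q \<alpha>. f R \<noteq> 0}) ` regular_functions Q \<alpha>"
  have top: "topspace (zariski Q \<alpha>) = rep_space Q \<alpha>"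
    unfolding zariski_def topology_generated_by_topspace
  proof (intro equalityI subsetI)
    fix S assume S: "S \<in> rep_space Q \<alpha>"
    show "S \<in> \<Union>?B"
      by (rule UnionI[OF image_eqI[OF refl regular_functions.const[of 1 Q \<alpha>]]]) (use S in simp)
  next
    fix S assume "S \<in> \<Union>?B"
    then show "S \<in> rep_space Q \<alpha>" by (elim UnionE imageE) simp
  qed
  have base: "\<exists>h\<in>regular_functions Q \<alpha>. h S \<noteq> 0 \<and> {R \<in> rep_space Q \<alpha>. h R \<noteq> 0} \<subseteq> T"
    if "generate_topology_on ?B T" "S \<in> T" for T S
    using that
  proof (induction arbitrary: S)
    case Empty
    then show ?case by simp
  next
    case (Int a b)
    then have "S \<in> a" "S \<in> b" by simp_all
    from Int.IH(1)[OF this(1)] obtain g where g: "g \<in> regular_functions Q \<alpha>" "g S \<noteq> 0" "{R \<in> rep_space Q \<alpha>. g R \<noteq> 0} \<subseteq> a"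
      by (elim bexE conjE)
    from Int.IH(2)[OF \<open>S \<in> b\<close>] obtain h where h: "h \<in> regular_functions Q \<alpha>" "h S \<noteq> 0" "{R \<in> rep_space Q \<alpha>. h R \<noteq> 0} \<subseteq> b"
      by (elim bexE conjE)
    show ?case
    proof (intro bexI[of _ "\<lambda>R. g R * h R"] conjI)
      show "(\<lambda>R. g R * h R) \<in> regular_functions Q \<alpha>" using g(1) h(1) by (rule regular_functions.mult)
      show "{R \<in> rep_space Q \<alpha>. g R * h R \<noteq> 0} \<subseteq> a \<inter> b" using g(3) h(3) by auto
    qed (use g(2) h(2) in simp)
  next
    case (UN K)
    then obtain k where k: "k \<in> K" "S \<in> k" by auto
    from UN.IH[OF this] obtain h where "h \<in> regular_functions Q \<alpha>" "h S \<noteq> 0" "{R \<in> rep_space Q \<alpha>. h R \<noteq> 0} \<subseteq> k"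
      by (elim bexE conjE)
    then show ?case using k(1) by (intro bexI[of _ h]) auto
  next
    case (Basis s)
    then show ?case by auto
  qed
  show ?thesis
  proof
    assume cl: "zariski Q \<alpha> closure_of U = rep_space Q \<alpha>"
    show "\<forall>h\<in>regular_functions Q \<alpha>. (\<forall>S\<in>U. h S = 0) \<longrightarrow> (\<forall>S\<in>rep_space Q \<alpha>. h S = 0)"
    proof (intro ballI impI, rule ccontr)
      fix h S assume h: "h \<in> regular_functions Q \<alpha>" "\<forall>S\<in>U. h S = 0" "S \<in> rep_space Q \<alpha>" "h S \<noteq> 0"
      let ?T = "{R \<in> rep_space Q \<alpha>. h R \<noteq> 0}"
      have "S \<in> ?T \<and> openin (zariski Q \<alpha>) ?T"
      proof
        show "openin (zariski Q \<alpha>) ?T"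
          unfolding zariski_def by (rule topology_generated_by_Basis, rule image_eqI[OF refl h(1)])
      qed (use h(3,4) in simp)
      moreover have "S \<in> zariski Q \<alpha> closure_of U" using cl h(3) by simp
      ultimately have "\<exists>y. y \<in> U \<and> y \<in> ?T"
        unfolding in_closure_of by (elim conjE allE[of _ ?T] impE) auto
      then obtain S' where "S' \<in> U" "h S' \<noteq> 0" by (elim exE conjE) simp
      then show False using h(2) by blast
    qed
  next
    assume v: "\<forall>h\<in>regular_functions Q \<alpha>. (\<forall>S\<in>U. h S = 0) \<longrightarrow> (\<forall>S\<in>rep_space Q \<alpha>. h S = 0)"
    show "zariski Q \<alpha> closure_of U = rep_space Q \<alpha>"
    proof (rule equalityI)
      show "zariski Q \<alpha> closure_of U \<subseteq> rep_space Q \<alpha>" using closure_of_subset_topspace[of "zariski Q \<alpha>" U] top by simp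
      show "rep_space Q \<alpha> \<subseteq> zariski Q \<alpha> closure_of U"
      proof
        fix S assume S: "S \<in> rep_space Q \<alpha>"
        have "\<exists>y. y \<in> U \<and> y \<in> T" if T: "S \<in> T \<and> openin (zariski Q \<alpha>) T" for T
        proof -
          have "generate_topology_on ?B T"
            using conjunct2[OF T] unfolding zariski_def openin_topology_generated_by_iff .
          from base[OF this conjunct1[OF T]] obtain h where h: "h \<in> regular_functions Q \<alpha>" "h S \<noteq> 0"
            "{R \<in> rep_space Q \<alpha>. h R \<noteq> 0} \<subseteq> T" by (elim bexE conjE)
          have "\<not> (\<forall>y\<in>U. h y = 0)" using bspec[OF v h(1)] S h(2) by auto
          then obtain y where y: "y \<in> U" "h y \<noteq> 0" by auto
          then have "y \<in> {R \<in> rep_space Q \<alpha>. h R \<noteq> 0}" using subsetD[OF assms y(1)] by simp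
          then show ?thesis using h(3) y(1) by auto
        qed
        then show "S \<in> zariski Q \<alpha> closure_of U" using S top unfolding in_closure_of by simp
      qed
    qed
  qed
qed

text \<open>What a regular function becomes when all arrows but one are fixed: a polynomial in the
  entries of a single matrix.\<close>

inductive_set entry_polynomials :: "nat \<Rightarrow> nat \<Rightarrow> (complex mat \<Rightarrow> complex) set" for c d :: nat where
  const: "(\<lambda>F. z) \<in> entry_polynomials c d"
| coord: "i < c \<Longrightarrow> j < d \<Longrightarrow> (\<lambda>F. F $$ (i, j)) \<in> entry_polynomials c d"
| add: "p \<in> entry_polynomials c d \<Longrightarrow> q \<in> entry_polynomials c d \<Longrightarrow> (\<lambda>F. p F + q F) \<in> entry_polynomials c d"
| mult: "p \<in> entry_polynomials c d \<Longrightarrow> q \<in> entry_polynomials c d \<Longrightarrow> (\<lambda>F. p F * q F) \<in> entry_polynomials c d"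

lemma entry_polynomials_sum:
  assumes "\<And>i. i \<in> I \<Longrightarrow> p i \<in> entry_polynomials c d"
  shows "(\<lambda>F. \<Sum>i\<in>I. p i F) \<in> entry_polynomials c d"
  using assms
proof (induction I rule: infinite_finite_induct)
  case (insert x I)
  have "(\<lambda>F. p x F + (\<Sum>i\<in>I. p i F)) \<in> entry_polynomials c d"
    by (rule entry_polynomials.add) (use insert in auto)
  then show ?case using insert.hyps by simp
qed (auto intro: entry_polynomials.const)

lemma entry_polynomials_isCont:
  assumes "p \<in> entry_polynomials c d" "F \<in> carrier_mat c d" "G \<in> carrier_mat c d"
  shows "isCont (\<lambda>z. p (F + z \<cdot>\<^sub>m G)) 0"
  using assms(1)
proof induction
  case (coord i j)
  then have "(\<lambda>z. (F + z \<cdot>\<^sub>m G) $$ (i, j)) = (\<lambda>z. F $$ (i, j) + z * G $$ (i, j))"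
    using assms(2,3) by auto
  then show ?case by (simp only:) (intro continuous_intros)
next
  case (add p q)
  from continuous_add[OF add.IH] show ?case .
next
  case (mult p q)
  from continuous_mult[OF mult.IH] show ?case .
qed simp

text \<open>For \<open>F\<close> of the right size, \<open>coeff (P F) k\<close> is the homogeneous
  component of degree \<open>k\<close> of \<open>p\<close> at \<open>F\<close>. It is again an entry
  polynomial, hence continuous along curves, and the bound \<open>N\<close> on the degrees is
  uniform in \<open>F\<close>.\<close>

lemma entry_polynomials_scale:
  assumes "p \<in> entry_polynomials c d"
  shows "\<exists>P N. (\<forall>k. (\<lambda>F. coeff (P F) k) \<in> entry_polynomials c d) \<and> (\<forall>F. degree (P F) \<le> N) \<and>
    (\<forall>F\<in>carrier_mat c d. \<forall>z. p (z \<cdot>\<^sub>m F) = poly (P F) z)"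
  using assms
proof induction
  case (const z)
  show ?case
    by (rule exI[of _ "\<lambda>F. [:z:]"], rule exI[of _ 0]) (auto intro: entry_polynomials.const)
next
  case (coord i j)
  have "(\<lambda>F. coeff [:0, F $$ (i, j):] k) \<in> entry_polynomials c d" for k :: nat
  proof (cases "k = 1")
    case True
    then show ?thesis using entry_polynomials.coord[OF coord] by simp
  next
    case False
    then have "coeff [:0, F $$ (i, j):] k = 0" for F :: "complex mat" by (auto simp: coeff_pCons split: nat.split)
    then show ?thesis by (simp add: entry_polynomials.const)
  qed
  then show ?case using coord
    by (intro exI[of _ "\<lambda>F. [:0, F $$ (i, j):]"] exI[of _ 1]) auto
next
  case (add p q)
  obtain P N where "\<forall>k. (\<lambda>F. coeff (P F) k) \<in> entry_polynomials c d" "\<forall>F. degree (P F) \<le> N"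
    "\<forall>F\<in>carrier_mat c d. \<forall>z. p (z \<cdot>\<^sub>m F) = poly (P F) z" using add.IH(1) by (elim exE conjE) (rule that)
  note 1 = this(1,2)[rule_format] bspec[OF this(3), rule_format]
  obtain P' N' where "\<forall>k. (\<lambda>F. coeff (P' F) k) \<in> entry_polynomials c d" "\<forall>F. degree (P' F) \<le> N'"
    "\<forall>F\<in>carrier_mat c d. \<forall>z. q (z \<cdot>\<^sub>m F) = poly (P' F) z" using add.IH(2) by (elim exE conjE) (rule that)
  note 2 = this(1,2)[rule_format] bspec[OF this(3), rule_format]
  show ?case
  proof (rule exI[of _ "\<lambda>F. P F + P' F"], rule exI[of _ "max N N'"], intro conjI allI ballI)
    show "(\<lambda>F. coeff (P F + P' F) k) \<in> entry_polynomials c d" for k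
      unfolding coeff_add by (intro entry_polynomials.add 1(1) 2(1))
    show "degree (P F + P' F) \<le> max N N'" for F
      using degree_add_le_max[of "P F" "P' F"] 1(2)[of F] 2(2)[of F] by linarith
    show "p (z \<cdot>\<^sub>m F) + q (z \<cdot>\<^sub>m F) = poly (P F + P' F) z" if "F \<in> carrier_mat c d" for F z
      using 1(3)[OF that] 2(3)[OF that] by simp
  qed
next
  case (mult p q)
  obtain P N where "\<forall>k. (\<lambda>F. coeff (P F) k) \<in> entry_polynomials c d" "\<forall>F. degree (P F) \<le> N"
    "\<forall>F\<in>carrier_mat c d. \<forall>z. p (z \<cdot>\<^sub>m F) = poly (P F) z" using mult.IH(1) by (elim exE conjE) (rule that)
  note 1 = this(1,2)[rule_format] bspec[OF this(3), rule_format]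
  obtain P' N' where "\<forall>k. (\<lambda>F. coeff (P' F) k) \<in> entry_polynomials c d" "\<forall>F. degree (P' F) \<le> N'"
    "\<forall>F\<in>carrier_mat c d. \<forall>z. q (z \<cdot>\<^sub>m F) = poly (P' F) z" using mult.IH(2) by (elim exE conjE) (rule that)
  note 2 = this(1,2)[rule_format] bspec[OF this(3), rule_format]
  show ?case
  proof (rule exI[of _ "\<lambda>F. P F * P' F"], rule exI[of _ "N + N'"], intro conjI allI ballI)
    show "(\<lambda>F. coeff (P F * P' F) k) \<in> entry_polynomials c d" for k
      unfolding coeff_mult by (intro entry_polynomials_sum entry_polynomials.mult 1(1) 2(1))
    show "degree (P F * P' F) \<le> N + N'" for F
      using degree_mult_le[of "P F" "P' F"] 1(2)[of F] 2(2)[of F] by linarith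
    show "p (z \<cdot>\<^sub>m F) * q (z \<cdot>\<^sub>m F) = poly (P F * P' F) z" if "F \<in> carrier_mat c d" for F z
      using 1(3)[OF that] 2(3)[OF that] by simp
  qed
qed

text \<open>If the tangent directions of a family of curves through the origin exhaust the whole space,
  the lowest homogeneous part of a polynomial vanishing on the curves must vanish.\<close>

lemma entry_polynomial_vanishes:
  assumes p: "p \<in> entry_polynomials c d"
    and curve: "\<And>F. F \<in> carrier_mat c d \<Longrightarrow>
      \<exists>G\<in>carrier_mat c d. eventually (\<lambda>z. p (z \<cdot>\<^sub>m (F + z \<cdot>\<^sub>m G)) = 0) (at 0)"
    and F: "F \<in> carrier_mat c d"
  shows "p F = 0"
proof -
  obtain P N where "\<forall>k. (\<lambda>F. coeff (P F) k) \<in> entry_polynomials c d" "\<forall>F. degree (P F) \<le> N"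
    "\<forall>F\<in>carrier_mat c d. \<forall>z. p (z \<cdot>\<^sub>m F) = poly (P F) z"
    using entry_polynomials_scale[OF p] by (elim exE conjE) (rule that)
  note P = this(1,2)[rule_format] bspec[OF this(3), rule_format]
  \<comment> \<open>Induction on the degree: once the components below \<open>k\<close> vanish
    identically, the value of \<open>p\<close> along the curve is \<open>z ^ k\<close> times a
    continuous function whose value at 0 is the component of degree \<open>k\<close> at
    \<open>F\<close>.\<close>
  have "\<forall>F\<in>carrier_mat c d. coeff (P F) k = 0" for k
  proof (induction k rule: less_induct)
    case (less k)
    show ?case
    proof
      fix F :: "complex mat" assume F: "F \<in> carrier_mat c d"
      obtain G where G: "G \<in> carrier_mat c d" "eventually (\<lambda>z. p (z \<cdot>\<^sub>m (F + z \<cdot>\<^sub>m G)) = 0) (at 0)"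
        using curve[OF F] by blast
      let ?M = "\<lambda>z. F + z \<cdot>\<^sub>m G"
      let ?q = "\<lambda>z. \<Sum>j\<le>N. coeff (P (?M z)) (k + j) * z ^ j"
      have M: "?M z \<in> carrier_mat c d" for z using F G by auto
      have fac: "p (z \<cdot>\<^sub>m ?M z) = z ^ k * ?q z" for z
      proof -
        have "p (z \<cdot>\<^sub>m ?M z) = (\<Sum>j\<le>k + N. coeff (P (?M z)) j * z ^ j)"
          unfolding P(3)[OF M] poly_altdef
          by (rule sum.mono_neutral_left) (use P(2)[of "?M z"] in \<open>auto simp: coeff_eq_0\<close>)
        also have "\<dots> = (\<Sum>j\<in>{k..k + N}. coeff (P (?M z)) j * z ^ j)"
          using less M by (intro sum.mono_neutral_right) auto
        also have "\<dots> = (\<Sum>j\<le>N. coeff (P (?M z)) (k + j) * z ^ (k + j))"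
          by (rule sum.reindex_bij_witness[of _ "\<lambda>j. k + j" "\<lambda>j. j - k"]) auto
        also have "\<dots> = z ^ k * ?q z" by (simp add: sum_distrib_left power_add mult_ac)
        finally show ?thesis .
      qed
      have "eventually (\<lambda>z::complex. z \<noteq> 0) (at 0)" by (rule eventually_neq_at_within)
      with G(2) have "eventually (\<lambda>z. ?q z = 0) (at 0)"
        by eventually_elim (simp add: fac)
      \<comment> \<open>Near 0 the factor \<open>z ^ k\<close> can be cancelled, and at 0 only the
        term \<open>j = 0\<close> survives.\<close>
      then have "(?q \<longlongrightarrow> 0) (at 0)" by (rule tendsto_eventually)
      moreover have "isCont ?q 0"
        by (intro continuous_sum continuous_mult continuous_power continuous_ident entry_polynomials_isCont[OF P(1) F G(1)])
      then have "(?q \<longlongrightarrow> ?q 0) (at 0)" by (simp add: isCont_def)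
      ultimately have "?q 0 = 0" by (intro tendsto_unique[of "at (0::complex)"]) auto
      moreover have "?q 0 = (\<Sum>j\<le>N. if j = 0 then coeff (P (?M 0)) k else 0)"
        by (intro sum.cong) auto
      moreover have "?M 0 = F" using F G(1) by (intro eq_matI) auto
      ultimately show "coeff (P F) k = 0" by simp
    qed
  qed
  then have "P F = 0" using F by (intro poly_eqI) simp
  then show ?thesis using P(3)[OF F, of 1] by simp
qed

text \<open>The determinant is continuous in \<open>z\<close> and equals 1 at
  \<open>z = 0\<close>.\<close>

lemma eventually_invertible_near_one:
  fixes A :: "complex mat"
  assumes A: "A \<in> carrier_mat d d"
  shows "eventually (\<lambda>z. \<exists>B\<in>carrier_mat d d. (1\<^sub>m d + z \<cdot>\<^sub>m A) * B = 1\<^sub>m d \<and> B * (1\<^sub>m d + z \<cdot>\<^sub>m A) = 1\<^sub>m d) (at 0)"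
proof -
  let ?M = "\<lambda>z. 1\<^sub>m d + z \<cdot>\<^sub>m A"
  have M: "?M z \<in> carrier_mat d d" for z using A by auto
  have "isCont (\<lambda>z. ?M z $$ (i, j)) 0" if "i < d" "j < d" for i j
  proof -
    have "(\<lambda>z. ?M z $$ (i, j)) = (\<lambda>z. 1\<^sub>m d $$ (i, j) + z * A $$ (i, j))" using A that by auto
    then show ?thesis by (simp only:) (intro continuous_intros)
  qed
  then have "isCont (\<lambda>z. ?M z $$ (i, p i)) 0" if "p permutes {0..<d}" "i \<in> {0..<d}" for i p
    using that permutes_in_image[OF that(1), of i] by simp
  then have "isCont (\<lambda>z. \<Sum>p\<in>{p. p permutes {0..<d}}. signof p * (\<Prod>i\<in>{0..<d}. ?M z $$ (i, p i))) 0"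
    by (intro continuous_sum continuous_mult continuous_const continuous_prod) simp
  moreover have "det (?M z) = (\<Sum>p\<in>{p. p permutes {0..<d}}. signof p * (\<Prod>i\<in>{0..<d}. ?M z $$ (i, p i)))" for z
    using A by (simp add: det_def)
  ultimately have "isCont (\<lambda>z. det (?M z)) 0" by simp
  then have "((\<lambda>z. det (?M z)) \<longlongrightarrow> det (?M 0)) (at 0)" by (simp add: isCont_def)
  moreover have "?M 0 = 1\<^sub>m d" using A by (intro eq_matI) auto
  ultimately have "eventually (\<lambda>z. det (?M z) \<noteq> 0) (at 0)"
    by (intro tendsto_imp_eventually_ne[of _ 1]) auto
  then show ?thesis
  proof eventually_elim
    case (elim z)
    have "?M z \<in> Units (ring_mat TYPE(complex) d ())" by (rule det_non_zero_imp_unit[OF M elim])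
    then have "\<exists>B\<in>carrier_mat d d. B * ?M z = 1\<^sub>m d \<and> ?M z * B = 1\<^sub>m d"
      by (simp add: Units_def ring_mat_def)
    then show ?case by (elim bexE conjE) (intro bexI conjI)
  qed
qed

text \<open>Isolates what the density argument uses of the arrow from 2 to \<open>n\<close>: a sink
  attached by one arrow to an otherwise arbitrary finite quiver.\<close>

definition pendant_arrow :: "('v, 'b) pre_digraph \<Rightarrow> 'v \<Rightarrow> 'b \<Rightarrow> bool" where
  "pendant_arrow Q n a0 \<longleftrightarrow> fin_digraph Q \<and> n \<in> verts Q \<and> a0 \<in> arcs Q \<and> head Q a0 = n \<and> tail Q a0 \<noteq> n \<and>
     (\<forall>a\<in>arcs Q. a \<noteq> a0 \<longrightarrow> head Q a \<noteq> n \<and> tail Q a \<noteq> n)"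

definition restrict_rep :: "('v, 'b) pre_digraph \<Rightarrow> 'v \<Rightarrow> ('v, 'b) quiver_rep \<Rightarrow> ('v, 'b) quiver_rep" where
  "restrict_rep Q n X = \<lparr>dimv = (dimv X)(n := 0), maps = restrict (maps X) (arcs (pre_digraph.del_vert Q n))\<rparr>"

lemma del_vert_simps:
  "verts (pre_digraph.del_vert Q n) = verts Q - {n}"
  "arcs (pre_digraph.del_vert Q n) = {a \<in> arcs Q. tail Q a \<noteq> n \<and> head Q a \<noteq> n}"
  "tail (pre_digraph.del_vert Q n) = tail Q" "head (pre_digraph.del_vert Q n) = head Q"
  by (simp_all add: pre_digraph.del_vert_def)

lemma wf_del_vert: "wf_digraph Q \<Longrightarrow> wf_digraph (pre_digraph.del_vert Q n)"
  by (auto simp: wf_digraph_def del_vert_simps)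

lemma pendant_arrowD:
  assumes "pendant_arrow Q n a0"
  shows "wf_digraph Q" "finite (verts Q)" "n \<in> verts Q" "a0 \<in> arcs Q" "head Q a0 = n" "tail Q a0 \<noteq> n"
    "tail Q a0 \<in> verts Q" "arcs (pre_digraph.del_vert Q n) = arcs Q - {a0}"
    "a \<in> arcs Q \<Longrightarrow> a \<noteq> a0 \<Longrightarrow> head Q a \<noteq> n \<and> tail Q a \<noteq> n"
    "wf_digraph (pre_digraph.del_vert Q n)"
proof -
  interpret fin_digraph Q using assms by (simp add: pendant_arrow_def)
  show "wf_digraph Q" "finite (verts Q)" by (unfold_locales, simp)
  show "n \<in> verts Q" "a0 \<in> arcs Q" "head Q a0 = n" "tail Q a0 \<noteq> n"
    "a \<in> arcs Q \<Longrightarrow> a \<noteq> a0 \<Longrightarrow> head Q a \<noteq> n \<and> tail Q a \<noteq> n"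
    using assms by (auto simp: pendant_arrow_def)
  then show "tail Q a0 \<in> verts Q" by simp
  show "arcs (pre_digraph.del_vert Q n) = arcs Q - {a0}"
    using assms by (auto simp: pendant_arrow_def del_vert_simps)
  show "wf_digraph (pre_digraph.del_vert Q n)" by (rule wf_del_vert) unfold_locales
qed

lemma is_rep_restrict_rep:
  assumes "is_rep Q X"
  shows "is_rep (pre_digraph.del_vert Q n) (restrict_rep Q n X)"
  using is_repD[OF assms] by (intro is_repI) (auto simp: restrict_rep_def del_vert_simps)

lemma ishom_restrict_rep:
  assumes "wf_digraph Q" "ishom Q X Y \<phi>"
  shows "ishom (pre_digraph.del_vert Q n) (restrict_rep Q n X) (restrict_rep Q n Y) \<phi>"
  using assms(2) by (auto simp: ishom_def restrict_rep_def del_vert_simps)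

text \<open>The slice is centred at \<open>B\<close>, so that curves starting at a point of the
  orbit become curves through the origin, as \<open>entry_polynomial_vanishes\<close>
  expects.\<close>

lemma regular_slice_entry_polynomial:
  assumes h: "h \<in> regular_functions Q \<alpha>" and a0: "a0 \<in> arcs Q"
    and B: "B \<in> carrier_mat (\<alpha> (head Q a0)) (\<alpha> (tail Q a0))"
  shows "\<exists>p\<in>entry_polynomials (\<alpha> (head Q a0)) (\<alpha> (tail Q a0)).
    \<forall>F\<in>carrier_mat (\<alpha> (head Q a0)) (\<alpha> (tail Q a0)). h (S(a0 := B + F)) = p F"
  using h
proof induction
  case (const c)
  show ?case by (rule bexI[OF _ entry_polynomials.const[of c]]) simp
next
  case (coord a i j)
  show ?case
  proof (cases "a = a0")
    case True
    have "(\<lambda>F. B $$ (i, j) + F $$ (i, j)) \<in> entry_polynomials (\<alpha> (head Q a0)) (\<alpha> (tail Q a0))"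
      using coord True by (intro entry_polynomials.intros) auto
    then show ?thesis
    proof (rule bexI[rotated], intro ballI)
      fix F :: "complex mat" assume "F \<in> carrier_mat (\<alpha> (head Q a0)) (\<alpha> (tail Q a0))"
      then show "(S(a0 := B + F)) a $$ (i, j) = B $$ (i, j) + F $$ (i, j)"
        unfolding True fun_upd_same using coord True B by (intro index_add_mat) auto
    qed
  next
    case False
    then show ?thesis by (intro bexI[OF _ entry_polynomials.const[of "S a $$ (i, j)"]]) simp
  qed
next
  case (add f g)
  from add.IH obtain p q where "p \<in> entry_polynomials (\<alpha> (head Q a0)) (\<alpha> (tail Q a0))"
    "\<forall>F\<in>carrier_mat (\<alpha> (head Q a0)) (\<alpha> (tail Q a0)). f (S(a0 := B + F)) = p F"
    "q \<in> entry_polynomials (\<alpha> (head Q a0)) (\<alpha> (tail Q a0))"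
    "\<forall>F\<in>carrier_mat (\<alpha> (head Q a0)) (\<alpha> (tail Q a0)). g (S(a0 := B + F)) = q F" by (elim bexE)
  note pq = this
  show ?case
    by (rule bexI[OF _ entry_polynomials.add[OF pq(1,3)]], rule ballI) (simp only: pq(2,4)[rule_format])
next
  case (mult f g)
  from mult.IH obtain p q where "p \<in> entry_polynomials (\<alpha> (head Q a0)) (\<alpha> (tail Q a0))"
    "\<forall>F\<in>carrier_mat (\<alpha> (head Q a0)) (\<alpha> (tail Q a0)). f (S(a0 := B + F)) = p F"
    "q \<in> entry_polynomials (\<alpha> (head Q a0)) (\<alpha> (tail Q a0))"
    "\<forall>F\<in>carrier_mat (\<alpha> (head Q a0)) (\<alpha> (tail Q a0)). g (S(a0 := B + F)) = q F" by (elim bexE)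
  note pq = this
  show ?case
    by (rule bexI[OF _ entry_polynomials.mult[OF pq(1,3)]], rule ballI) (simp only: pq(2,4)[rule_format])
qed

text \<open>The complementary slice: with the matrix of the pendant arrow fixed, a regular function
  of the smaller quiver remains, to which the density of the orbit of \<open>R\<close>
  applies.\<close>

lemma regular_slice_del_vert:
  assumes h: "h \<in> regular_functions Q \<alpha>" and P: "pendant_arrow Q n a0"
  shows "(\<lambda>S. h (S(a0 := F))) \<in> regular_functions (pre_digraph.del_vert Q n) (\<alpha>(n := 0))"
  using h
proof induction
  case (coord a i j)
  show ?case
  proof (cases "a = a0")
    case False
    then have "(\<lambda>S. S a $$ (i, j)) \<in> regular_functions (pre_digraph.del_vert Q n) (\<alpha>(n := 0))"
      using coord pendant_arrowD(8,9)[OF P] by (intro regular_functions.coord) (auto simp: del_vert_simps)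
    then show ?thesis unfolding fun_upd_other[OF False] .
  qed (simp add: regular_functions.const)
next
  case (const c)
  show ?case by (rule regular_functions.const)
next
  case (add f g)
  from regular_functions.add[OF add.IH] show ?case .
next
  case (mult f g)
  from regular_functions.mult[OF mult.IH] show ?case .
qed

lemma orbit_rep_subset:
  assumes "wf_digraph Q" "R \<in> rep_space Q \<alpha>"
  shows "orbit_rep Q \<alpha> R \<subseteq> rep_space Q \<alpha>"
proof
  interpret wf_digraph Q by fact
  fix S assume "S \<in> orbit_rep Q \<alpha> R"
  then obtain g h where S: "S = (\<lambda>a\<in>arcs Q. g (head Q a) * R a * h (tail Q a))"
    and "\<forall>x\<in>verts Q. g x \<in> carrier_mat (\<alpha> x) (\<alpha> x) \<and> h x \<in> carrier_mat (\<alpha> x) (\<alpha> x) \<and>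
       inverts_mat (g x) (h x) \<and> inverts_mat (h x) (g x)"
    unfolding orbit_rep_def mem_Collect_eq by (elim exE conjE) (rule that)
  then have gh: "g x \<in> carrier_mat (\<alpha> x) (\<alpha> x)" "h x \<in> carrier_mat (\<alpha> x) (\<alpha> x)" if "x \<in> verts Q" for x
    using that by simp_all
  have "g (head Q a) * R a * h (tail Q a) \<in> carrier_mat (\<alpha> (head Q a)) (\<alpha> (tail Q a))" if a: "a \<in> arcs Q" for a
  proof -
    have "R a \<in> carrier_mat (\<alpha> (head Q a)) (\<alpha> (tail Q a))" using assms(2) a by (auto simp: rep_space_def)
    then show ?thesis
      by (rule mult_carrier_mat[OF mult_carrier_mat[OF gh(1)[OF head_in_verts[OF a]]] gh(2)[OF tail_in_verts[OF a]]])
  qed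
  then show "S \<in> rep_space Q \<alpha>" unfolding S rep_space_def by auto
qed

text \<open>Exact expansion of the curve \<open>(1 + z \<gamma>) f (1 + z \<kappa>)\<close> after a
  base change \<open>K\<close>, arranged as the starting point \<open>f K\<close> plus
  \<open>z (F + z G)\<close>.\<close>

lemma mult_three_expand:
  fixes f \<gamma> \<kappa> K :: "complex mat"
  assumes "f \<in> carrier_mat c d" "\<gamma> \<in> carrier_mat c c" "\<kappa> \<in> carrier_mat d d" "K \<in> carrier_mat d d"
  shows "(1\<^sub>m c + z \<cdot>\<^sub>m \<gamma>) * f * ((1\<^sub>m d + z \<cdot>\<^sub>m \<kappa>) * K)
    = f * K + z \<cdot>\<^sub>m ((\<gamma> * f + f * \<kappa>) * K + z \<cdot>\<^sub>m (\<gamma> * f * \<kappa> * K))"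
proof -
  note f = assms(1) and g = assms(2) and k = assms(3) and K = assms(4)
  note gf = mult_carrier_mat[OF g f] and kK = mult_carrier_mat[OF k K] and fk = mult_carrier_mat[OF f k]
  let ?R = "K + z \<cdot>\<^sub>m (\<kappa> * K)"
  have R: "?R \<in> carrier_mat d d" using kK K by simp
  have l: "(1\<^sub>m c + z \<cdot>\<^sub>m \<gamma>) * f = f + z \<cdot>\<^sub>m (\<gamma> * f)"
    unfolding add_mult_distrib_mat[OF one_carrier_mat smult_carrier_mat[OF g] f] mult_smult_assoc_mat[OF g f]
      left_mult_one_mat[OF f] ..
  have r: "(1\<^sub>m d + z \<cdot>\<^sub>m \<kappa>) * K = ?R"
    unfolding add_mult_distrib_mat[OF one_carrier_mat smult_carrier_mat[OF k] K] mult_smult_assoc_mat[OF k K]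
      left_mult_one_mat[OF K] ..
  have "(f + z \<cdot>\<^sub>m (\<gamma> * f)) * ?R = f * ?R + z \<cdot>\<^sub>m (\<gamma> * f * ?R)"
    unfolding add_mult_distrib_mat[OF f smult_carrier_mat[OF gf] R] mult_smult_assoc_mat[OF gf R] ..
  also have "f * ?R = f * K + z \<cdot>\<^sub>m (f * \<kappa> * K)"
    unfolding mult_add_distrib_mat[OF f K smult_carrier_mat[OF kK]] mult_smult_distrib[OF f kK] assoc_mult_mat[OF f k K] ..
  also have "\<gamma> * f * ?R = \<gamma> * f * K + z \<cdot>\<^sub>m (\<gamma> * f * \<kappa> * K)"
    unfolding mult_add_distrib_mat[OF gf K smult_carrier_mat[OF kK]] mult_smult_distrib[OF gf kK] assoc_mult_mat[OF gf k K] ..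
  also have "f * K + z \<cdot>\<^sub>m (f * \<kappa> * K) + z \<cdot>\<^sub>m (\<gamma> * f * K + z \<cdot>\<^sub>m (\<gamma> * f * \<kappa> * K))
      = f * K + z \<cdot>\<^sub>m (\<gamma> * f * K + f * \<kappa> * K + z \<cdot>\<^sub>m (\<gamma> * f * \<kappa> * K))"
  proof -
    have "A + z \<cdot>\<^sub>m C + z \<cdot>\<^sub>m (B + z \<cdot>\<^sub>m D) = A + z \<cdot>\<^sub>m (B + C + z \<cdot>\<^sub>m D)"
      if "A \<in> carrier_mat c d" "B \<in> carrier_mat c d" "C \<in> carrier_mat c d" "D \<in> carrier_mat c d"
      for A B C D :: "complex mat"
      using that by (intro eq_matI) (auto simp: algebra_simps)
    then show ?thesis
      using mult_carrier_mat[OF f K] mult_carrier_mat[OF gf K] mult_carrier_mat[OF fk K]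
        mult_carrier_mat[OF mult_carrier_mat[OF gf k] K] .
  qed
  also have "\<gamma> * f * K + f * \<kappa> * K = (\<gamma> * f + f * \<kappa>) * K"
    by (rule add_mult_distrib_mat[OF gf fk K, symmetric])
  finally show ?thesis unfolding l r .
qed

text \<open>Moving along the curve \<open>(1 + z \<gamma>) f (1 + z \<kappa>)\<close> stays inside the orbit, and its tangent direction
  \<open>\<gamma> f + f \<kappa>\<close> is arbitrary by assumption; so the orbit is dense in the slice over every
  representation isomorphic to \<open>R\<close>, and these are dense.\<close>

lemma generic_rep_pendant_arrow:
  fixes X :: "('v, 'b) quiver_rep" and n :: 'v and Q :: "('v, 'b) pre_digraph" and a0 :: 'b
  defines "c \<equiv> dimv X n" and "d \<equiv> dimv X (tail Q a0)" and "f \<equiv> maps X a0"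
  assumes P: "pendant_arrow Q n a0" and X: "is_rep Q X"
    and R: "generic_rep (pre_digraph.del_vert Q n) ((dimv X)(n := 0)) R"
    and iso: "isom (pre_digraph.del_vert Q n) R (restrict_rep Q n X) \<phi> \<psi>"
    and tangent: "\<And>F. F \<in> carrier_mat c d \<Longrightarrow> \<exists>\<gamma>\<in>carrier_mat c c. \<exists>\<kappa>.
      ishom (pre_digraph.del_vert Q n) (restrict_rep Q n X) (restrict_rep Q n X) \<kappa> \<and> F = \<gamma> * f + f * \<kappa> (tail Q a0)"
  shows "generic_rep Q (dimv X) X"
proof -
  let ?Q' = "pre_digraph.del_vert Q n" and ?Y = "restrict_rep Q n X" and ?\<alpha> = "dimv X"
  let ?p = "tail Q a0"
  note PD = pendant_arrowD[OF P]
  interpret wf_digraph Q by (rule PD(1))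
  have verts': "x \<in> verts ?Q' \<longleftrightarrow> x \<in> verts Q \<and> x \<noteq> n" for x by (auto simp: del_vert_simps)
  have ht: "head Q a \<in> verts ?Q'" "tail Q a \<in> verts ?Q'" "a \<in> arcs Q" "a \<noteq> a0" if "a \<in> arcs ?Q'" for a
    using that by (auto simp: del_vert_simps verts' PD(5))
  have p': "?p \<in> verts ?Q'" using PD(6,7) by (simp add: verts')
  have dY: "dimv ?Y x = ?\<alpha> x" if "x \<in> verts ?Q'" for x using that by (simp add: restrict_rep_def verts')
  have mY: "maps ?Y a = maps X a" if "a \<in> arcs ?Q'" for a using that by (simp add: restrict_rep_def)
  have RQ: "is_rep ?Q' R" and dR: "dimv R = ?\<alpha>(n := 0)"
    and dense: "zariski ?Q' (?\<alpha>(n := 0)) closure_of orbit_rep ?Q' (?\<alpha>(n := 0)) (maps R) = rep_space ?Q' (?\<alpha>(n := 0))"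
    using R by (simp_all add: generic_rep_def)
  have dR': "dimv R x = ?\<alpha> x" if "x \<in> verts ?Q'" for x using that by (simp add: dR verts')
  have fc: "f \<in> carrier_mat c d" using is_repD(1)[OF X PD(4)] by (simp add: f_def c_def d_def PD(5))
  have Xs: "maps X \<in> rep_space Q ?\<alpha>" using X by (simp add: is_rep_def)
  have Rs: "maps R \<in> rep_space ?Q' (?\<alpha>(n := 0))" using RQ dR by (simp add: is_rep_def)
  have Rdense: "\<And>h S. h \<in> regular_functions ?Q' (?\<alpha>(n := 0)) \<Longrightarrow>
      (\<forall>S\<in>orbit_rep ?Q' (?\<alpha>(n := 0)) (maps R). h S = 0) \<Longrightarrow> S \<in> rep_space ?Q' (?\<alpha>(n := 0)) \<Longrightarrow> h S = 0"
    using dense zariski_dense_iff[OF orbit_rep_subset[OF PD(10) Rs]] by simp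
  \<comment> \<open>The fibre over one point \<open>S\<close> of the orbit of \<open>R\<close>, with
    an arbitrary matrix \<open>f'\<close> on the pendant arrow.\<close>
  have slice: "h (S(a0 := f')) = 0"
    if h: "h \<in> regular_functions Q ?\<alpha>" and van: "\<forall>S\<in>orbit_rep Q ?\<alpha> (maps X). h S = 0"
      and S: "S \<in> orbit_rep ?Q' (?\<alpha>(n := 0)) (maps R)" and f': "f' \<in> carrier_mat c d" for h S f'
  proof -
    obtain g k where Sdef: "S = (\<lambda>a\<in>arcs ?Q'. g (head ?Q' a) * maps R a * k (tail ?Q' a))"
      and gk: "\<forall>x\<in>verts ?Q'. g x \<in> carrier_mat ((?\<alpha>(n := 0)) x) ((?\<alpha>(n := 0)) x) \<and>
        k x \<in> carrier_mat ((?\<alpha>(n := 0)) x) ((?\<alpha>(n := 0)) x) \<and> inverts_mat (g x) (k x) \<and> inverts_mat (k x) (g x)"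
      using S unfolding orbit_rep_def mem_Collect_eq by (elim exE conjE) (rule that)
    have g: "g x \<in> carrier_mat (?\<alpha> x) (?\<alpha> x)" and k: "k x \<in> carrier_mat (?\<alpha> x) (?\<alpha> x)"
      and gk1: "g x * k x = 1\<^sub>m (?\<alpha> x)" and kg1: "k x * g x = 1\<^sub>m (?\<alpha> x)" if x: "x \<in> verts ?Q'" for x
    proof -
      have "(?\<alpha>(n := 0)) x = ?\<alpha> x" using x by (simp add: verts')
      then show "g x \<in> carrier_mat (?\<alpha> x) (?\<alpha> x)" "k x \<in> carrier_mat (?\<alpha> x) (?\<alpha> x)"
        using bspec[OF gk x] by simp_all
      then show "g x * k x = 1\<^sub>m (?\<alpha> x)" "k x * g x = 1\<^sub>m (?\<alpha> x)"
        using bspec[OF gk x] by (simp_all add: inverts_mat_def)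
    qed
    have \<phi>: "\<phi> x \<in> carrier_mat (?\<alpha> x) (?\<alpha> x)" and \<psi>: "\<psi> x \<in> carrier_mat (?\<alpha> x) (?\<alpha> x)"
      and \<psi>\<phi>: "\<psi> x * \<phi> x = 1\<^sub>m (?\<alpha> x)" and \<phi>\<psi>: "\<phi> x * \<psi> x = 1\<^sub>m (?\<alpha> x)" if x: "x \<in> verts ?Q'" for x
      using iso x ishomD(1)[of ?Q' R ?Y \<phi> x] ishomD(1)[of ?Q' ?Y R \<psi> x] dR'[OF x] dY[OF x]
      by (simp_all add: isom_def)
    \<comment> \<open>\<open>S\<close> arises from \<open>R\<close> by \<open>g\<close>, and
      \<open>R\<close> is isomorphic to the restriction of \<open>X\<close>; \<open>G\<close>
      combines the two, with inverse \<open>K\<close>, and carries the restriction of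
      \<open>X\<close> to \<open>S\<close>.\<close>
    define G where "G = (\<lambda>x. g x * \<psi> x)"
    define K where "K = (\<lambda>x. \<phi> x * k x)"
    have G: "G x \<in> carrier_mat (?\<alpha> x) (?\<alpha> x)" and K: "K x \<in> carrier_mat (?\<alpha> x) (?\<alpha> x)" if "x \<in> verts ?Q'" for x
      using g[OF that] k[OF that] \<phi>[OF that] \<psi>[OF that] by (simp_all add: G_def K_def)
    have GK: "G x * K x = 1\<^sub>m (?\<alpha> x)" and KG: "K x * G x = 1\<^sub>m (?\<alpha> x)" if x: "x \<in> verts ?Q'" for x
    proof -
      note cs = g[OF x] k[OF x] \<phi>[OF x] \<psi>[OF x]
      have "G x * K x = g x * (\<psi> x * (\<phi> x * k x))"
        unfolding G_def K_def by (rule assoc_mult_mat[OF cs(1,4) mult_carrier_mat[OF cs(3,2)]])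
      also have "\<psi> x * (\<phi> x * k x) = \<psi> x * \<phi> x * k x" by (rule assoc_mult_mat[OF cs(4,3,2), symmetric])
      finally show "G x * K x = 1\<^sub>m (?\<alpha> x)" unfolding \<psi>\<phi>[OF x] left_mult_one_mat[OF cs(2)] gk1[OF x] .
      have "K x * G x = \<phi> x * (k x * (g x * \<psi> x))"
        unfolding G_def K_def by (rule assoc_mult_mat[OF cs(3,2) mult_carrier_mat[OF cs(1,4)]])
      also have "k x * (g x * \<psi> x) = k x * g x * \<psi> x" by (rule assoc_mult_mat[OF cs(2,1,4), symmetric])
      finally show "K x * G x = 1\<^sub>m (?\<alpha> x)" unfolding kg1[OF x] left_mult_one_mat[OF cs(4)] \<phi>\<psi>[OF x] .
    qed
    have SG: "S a = G (head Q a) * maps X a * K (tail Q a)" if a: "a \<in> arcs ?Q'" for a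
    proof -
      note h' = ht[OF a]
      have Ra: "maps R a \<in> carrier_mat (?\<alpha> (head Q a)) (?\<alpha> (tail Q a))"
        using is_repD(1)[OF RQ a] dR'[OF h'(1)] dR'[OF h'(2)] by (simp add: del_vert_simps)
      have Xa: "maps X a \<in> carrier_mat (?\<alpha> (head Q a)) (?\<alpha> (tail Q a))" by (rule is_repD(1)[OF X h'(3)])
      have "ishom ?Q' R ?Y \<phi>" using iso by (simp add: isom_def)
      from ishomD(4)[OF this a] have com: "\<phi> (head Q a) * maps R a = maps X a * \<phi> (tail Q a)"
        by (simp add: del_vert_simps mY[OF a])
      note cs = g[OF h'(1)] \<psi>[OF h'(1)] \<phi>[OF h'(1)] \<phi>[OF h'(2)] k[OF h'(2)]
      have "G (head Q a) * maps X a * K (tail Q a) = g (head Q a) * (\<psi> (head Q a) * maps X a) * (\<phi> (tail Q a) * k (tail Q a))"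
        unfolding G_def K_def assoc_mult_mat[OF cs(1,2) Xa] ..
      also have "\<dots> = g (head Q a) * ((\<psi> (head Q a) * maps X a * \<phi> (tail Q a)) * k (tail Q a))"
        unfolding assoc_mult_mat[OF cs(1) mult_carrier_mat[OF cs(2) Xa] mult_carrier_mat[OF cs(4,5)]]
          assoc_mult_mat[OF mult_carrier_mat[OF cs(2) Xa] cs(4,5)] ..
      also have "\<psi> (head Q a) * maps X a * \<phi> (tail Q a) = \<psi> (head Q a) * \<phi> (head Q a) * maps R a"
        unfolding assoc_mult_mat[OF cs(2) Xa cs(4)] com[symmetric] assoc_mult_mat[OF cs(2,3) Ra] ..
      also have "\<dots> = maps R a" unfolding \<psi>\<phi>[OF h'(1)] left_mult_one_mat[OF Ra] ..
      finally have e: "G (head Q a) * maps X a * K (tail Q a) = g (head Q a) * (maps R a * k (tail Q a))" .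
      have "S a = g (head Q a) * maps R a * k (tail Q a)" using a by (simp add: Sdef del_vert_simps)
      then show ?thesis unfolding e assoc_mult_mat[OF cs(1) Ra cs(5)] .
    qed
    note Kp = K[OF p', folded d_def] and Gp = G[OF p', folded d_def]
    \<comment> \<open>The matrix on the pendant arrow of the point over \<open>S\<close> into which
      \<open>G\<close> carries \<open>X\<close>, with the identity at \<open>n\<close>.\<close>
    define B where "B = f * K ?p"
    have B: "B \<in> carrier_mat c d" unfolding B_def by (rule mult_carrier_mat[OF fc Kp])
    obtain p where p: "p \<in> entry_polynomials c d" and hp: "\<And>F. F \<in> carrier_mat c d \<Longrightarrow> h (S(a0 := B + F)) = p F"
      using regular_slice_entry_polynomial[OF h PD(4), of B S] B unfolding PD(5) c_def d_def by blast
    have "p (f' - B) = 0"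
    proof (rule entry_polynomial_vanishes[OF p])
      show "f' - B \<in> carrier_mat c d" by (rule minus_carrier_mat[OF B])
      fix F :: "complex mat" assume F: "F \<in> carrier_mat c d"
      \<comment> \<open>The tangent hypothesis speaks of \<open>X\<close> itself, so the direction
        \<open>F\<close> at \<open>S\<close> is first carried back by \<open>G\<close>; multiplying
        by \<open>K\<close> returns it.\<close>
      obtain \<gamma> \<kappa> where \<gamma>: "\<gamma> \<in> carrier_mat c c" and \<kappa>: "ishom ?Q' ?Y ?Y \<kappa>" and FG: "F * G ?p = \<gamma> * f + f * \<kappa> ?p"
        using tangent[OF mult_carrier_mat[OF F Gp]] by (elim bexE exE conjE)
      have \<kappa>c: "\<kappa> x \<in> carrier_mat (?\<alpha> x) (?\<alpha> x)" if "x \<in> verts ?Q'" for x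
        using ishomD(1)[OF \<kappa> that] dY[OF that] by simp
      note \<kappa>p = \<kappa>c[OF p', folded d_def]
      define H where "H = \<gamma> * f * \<kappa> ?p * K ?p"
      have H: "H \<in> carrier_mat c d" unfolding H_def
        by (rule mult_carrier_mat[OF mult_carrier_mat[OF mult_carrier_mat[OF \<gamma> fc] \<kappa>p] Kp])
      have "(\<gamma> * f + f * \<kappa> ?p) * K ?p = F"
        unfolding FG[symmetric] assoc_mult_mat[OF F Gp Kp] GK[OF p', folded d_def] by (rule right_mult_one_mat[OF F])
      then have curve: "(1\<^sub>m c + z \<cdot>\<^sub>m \<gamma>) * f * ((1\<^sub>m d + z \<cdot>\<^sub>m \<kappa> ?p) * K ?p) = B + z \<cdot>\<^sub>m (F + z \<cdot>\<^sub>m H)" for z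
        using mult_three_expand[OF fc \<gamma> \<kappa>p Kp] by (simp only: B_def H_def)
      have fin: "finite (verts ?Q')" using PD(2) by (simp add: del_vert_simps)
      have "eventually (\<lambda>z. \<forall>x\<in>verts ?Q'. \<exists>M\<in>carrier_mat (?\<alpha> x) (?\<alpha> x).
        (1\<^sub>m (?\<alpha> x) + z \<cdot>\<^sub>m \<kappa> x) * M = 1\<^sub>m (?\<alpha> x) \<and> M * (1\<^sub>m (?\<alpha> x) + z \<cdot>\<^sub>m \<kappa> x) = 1\<^sub>m (?\<alpha> x)) (at 0)"
        by (rule eventually_ball_finite[OF fin], rule ballI, rule eventually_invertible_near_one, rule \<kappa>c)
      then have "eventually (\<lambda>z. h (S(a0 := B + z \<cdot>\<^sub>m (F + z \<cdot>\<^sub>m H))) = 0) (at 0)"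
        using eventually_invertible_near_one[OF \<gamma>]
      proof eventually_elim
        case (elim z)
        obtain N where N: "N \<in> carrier_mat c c" "(1\<^sub>m c + z \<cdot>\<^sub>m \<gamma>) * N = 1\<^sub>m c" "N * (1\<^sub>m c + z \<cdot>\<^sub>m \<gamma>) = 1\<^sub>m c"
          using elim(2) by (elim bexE conjE)
        from bchoice[OF elim(1)[unfolded Bex_def]] obtain M where Mall: "\<forall>x\<in>verts ?Q'. M x \<in> carrier_mat (?\<alpha> x) (?\<alpha> x) \<and>
          (1\<^sub>m (?\<alpha> x) + z \<cdot>\<^sub>m \<kappa> x) * M x = 1\<^sub>m (?\<alpha> x) \<and> M x * (1\<^sub>m (?\<alpha> x) + z \<cdot>\<^sub>m \<kappa> x) = 1\<^sub>m (?\<alpha> x)" by (elim exE)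
        define L where "L = (\<lambda>x. 1\<^sub>m (?\<alpha> x) + z \<cdot>\<^sub>m \<kappa> x)"
        have L: "L x \<in> carrier_mat (?\<alpha> x) (?\<alpha> x)" and M: "M x \<in> carrier_mat (?\<alpha> x) (?\<alpha> x)"
          and lm1: "L x * M x = 1\<^sub>m (?\<alpha> x)" and ml1: "M x * L x = 1\<^sub>m (?\<alpha> x)" if x: "x \<in> verts ?Q'" for x
          using bspec[OF Mall x] \<kappa>c[OF x] by (simp_all add: L_def)
        have Lcom: "L (head Q a) * maps X a = maps X a * L (tail Q a)" if a: "a \<in> arcs ?Q'" for a
        proof -
          note h' = ht[OF a]
          have Xa: "maps X a \<in> carrier_mat (?\<alpha> (head Q a)) (?\<alpha> (tail Q a))" by (rule is_repD(1)[OF X h'(3)])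
          have com: "\<kappa> (head Q a) * maps X a = maps X a * \<kappa> (tail Q a)"
            using ishomD(4)[OF \<kappa> a] by (simp add: del_vert_simps mY[OF a])
          show ?thesis
            unfolding L_def add_mult_distrib_mat[OF one_carrier_mat smult_carrier_mat[OF \<kappa>c[OF h'(1)]] Xa]
              mult_add_distrib_mat[OF Xa one_carrier_mat smult_carrier_mat[OF \<kappa>c[OF h'(2)]]]
              mult_smult_assoc_mat[OF \<kappa>c[OF h'(1)] Xa] mult_smult_distrib[OF Xa \<kappa>c[OF h'(2)]]
              left_mult_one_mat[OF Xa] right_mult_one_mat[OF Xa] com ..
        qed
        \<comment> \<open>At \<open>n\<close> the group element moves by
          \<open>1 + z \<gamma>\<close>; elsewhere the inverse \<open>M\<close> of
          \<open>L = 1 + z \<kappa>\<close> precedes \<open>G\<close>. As \<open>\<kappa>\<close> is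
          an endomorphism, \<open>L\<close> commutes with the remaining arrows, so that only the
          matrix of the pendant arrow moves.\<close>
        define g' where "g' = (\<lambda>x. if x = n then 1\<^sub>m c + z \<cdot>\<^sub>m \<gamma> else G x * M x)"
        define k' where "k' = (\<lambda>x. if x = n then N else L x * K x)"
        have gk': "g' x \<in> carrier_mat (?\<alpha> x) (?\<alpha> x) \<and> k' x \<in> carrier_mat (?\<alpha> x) (?\<alpha> x) \<and>
          inverts_mat (g' x) (k' x) \<and> inverts_mat (k' x) (g' x)" if x: "x \<in> verts Q" for x
        proof (cases "x = n")
          case True
          then show ?thesis using \<gamma> N by (simp add: g'_def k'_def c_def inverts_mat_def)
        next
          case False
          then have x': "x \<in> verts ?Q'" using x by (simp add: verts')
          note cs = G[OF x'] M[OF x'] L[OF x'] K[OF x']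
          have "G x * M x * (L x * K x) = G x * (M x * (L x * K x))"
            by (rule assoc_mult_mat[OF cs(1,2) mult_carrier_mat[OF cs(3,4)]])
          also have "M x * (L x * K x) = K x"
            unfolding assoc_mult_mat[OF cs(2,3,4), symmetric] ml1[OF x'] by (rule left_mult_one_mat[OF cs(4)])
          finally have 1: "G x * M x * (L x * K x) = 1\<^sub>m (?\<alpha> x)" unfolding GK[OF x'] .
          have "L x * K x * (G x * M x) = L x * (K x * (G x * M x))"
            by (rule assoc_mult_mat[OF cs(3,4) mult_carrier_mat[OF cs(1,2)]])
          also have "K x * (G x * M x) = M x"
            unfolding assoc_mult_mat[OF cs(4,1,2), symmetric] KG[OF x'] by (rule left_mult_one_mat[OF cs(2)])
          finally have 2: "L x * K x * (G x * M x) = 1\<^sub>m (?\<alpha> x)" unfolding lm1[OF x'] .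
          have "G x * M x \<in> carrier_mat (?\<alpha> x) (?\<alpha> x)" "L x * K x \<in> carrier_mat (?\<alpha> x) (?\<alpha> x)"
            by (rule mult_carrier_mat[OF cs(1,2)], rule mult_carrier_mat[OF cs(3,4)])
          then show ?thesis using 1 2 False unfolding g'_def k'_def inverts_mat_def by auto
        qed
        have "S(a0 := B + z \<cdot>\<^sub>m (F + z \<cdot>\<^sub>m H)) = (\<lambda>a\<in>arcs Q. g' (head Q a) * maps X a * k' (tail Q a))"
        proof (rule ext)
          fix a
          consider "a = a0" | "a \<in> arcs ?Q'" "a \<noteq> a0" | "a \<notin> arcs Q" using PD(4,8) by auto
          then show "(S(a0 := B + z \<cdot>\<^sub>m (F + z \<cdot>\<^sub>m H))) a = (\<lambda>a\<in>arcs Q. g' (head Q a) * maps X a * k' (tail Q a)) a"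
          proof cases
            case 1
            have "g' n * f * k' ?p = B + z \<cdot>\<^sub>m (F + z \<cdot>\<^sub>m H)"
              unfolding curve[symmetric] using PD(6) by (simp only: g'_def k'_def L_def d_def if_True if_False simp_thms)
            then show ?thesis unfolding 1 fun_upd_same using PD(4,5) by (simp only: restrict_apply if_True f_def)
          next
            case 2
            note h' = ht[OF 2(1)]
            have Xa: "maps X a \<in> carrier_mat (?\<alpha> (head Q a)) (?\<alpha> (tail Q a))" by (rule is_repD(1)[OF X h'(3)])
            note cs = G[OF h'(1)] M[OF h'(1)] L[OF h'(1)] L[OF h'(2)] K[OF h'(2)]
            have "G (head Q a) * M (head Q a) * maps X a * (L (tail Q a) * K (tail Q a))
                = G (head Q a) * (M (head Q a) * maps X a) * (L (tail Q a) * K (tail Q a))"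
              unfolding assoc_mult_mat[OF cs(1,2) Xa] ..
            also have "\<dots> = G (head Q a) * ((M (head Q a) * maps X a * L (tail Q a)) * K (tail Q a))"
              unfolding assoc_mult_mat[OF cs(1) mult_carrier_mat[OF cs(2) Xa] mult_carrier_mat[OF cs(4,5)]]
                assoc_mult_mat[OF mult_carrier_mat[OF cs(2) Xa] cs(4,5)] ..
            also have "M (head Q a) * maps X a * L (tail Q a) = M (head Q a) * L (head Q a) * maps X a"
              unfolding assoc_mult_mat[OF cs(2) Xa cs(4)] Lcom[OF 2(1), symmetric] assoc_mult_mat[OF cs(2,3) Xa] ..
            also have "\<dots> = maps X a" unfolding ml1[OF h'(1)] by (rule left_mult_one_mat[OF Xa])
            also have "G (head Q a) * (maps X a * K (tail Q a)) = S a"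
              unfolding SG[OF 2(1)] by (rule assoc_mult_mat[OF cs(1) Xa cs(5), symmetric])
            finally show ?thesis
              unfolding fun_upd_other[OF 2(2)] using h' verts' by (simp add: g'_def k'_def)
          next
            case 3
            then have "a \<noteq> a0" "a \<notin> arcs ?Q'" using PD(4,8) by auto
            then show ?thesis using 3 unfolding fun_upd_other[OF \<open>a \<noteq> a0\<close>] Sdef by (simp add: restrict_apply)
          qed
        qed
        then have "S(a0 := B + z \<cdot>\<^sub>m (F + z \<cdot>\<^sub>m H)) \<in> orbit_rep Q ?\<alpha> (maps X)"
          unfolding orbit_rep_def mem_Collect_eq by (intro exI[of _ g'] exI[of _ k'] conjI ballI gk')
        then show ?case using van by simp
      qed
      moreover have "h (S(a0 := B + z \<cdot>\<^sub>m (F + z \<cdot>\<^sub>m H))) = p (z \<cdot>\<^sub>m (F + z \<cdot>\<^sub>m H))" for z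
        by (rule hp) (use F H in simp)
      ultimately show "\<exists>G\<in>carrier_mat c d. eventually (\<lambda>z. p (z \<cdot>\<^sub>m (F + z \<cdot>\<^sub>m G)) = 0) (at 0)"
        using H by (intro bexI[of _ H]) (simp_all only:)
    qed
    moreover have "B + (f' - B) = f'" using f' B by (intro eq_matI) auto
    ultimately show ?thesis using hp[OF minus_carrier_mat[OF B, of f']] by simp
  qed
  have "zariski Q ?\<alpha> closure_of orbit_rep Q ?\<alpha> (maps X) = rep_space Q ?\<alpha>"
    unfolding zariski_dense_iff[OF orbit_rep_subset[OF PD(1) Xs]]
  proof (intro ballI impI)
    fix h R' assume h: "h \<in> regular_functions Q ?\<alpha>" and van: "\<forall>S\<in>orbit_rep Q ?\<alpha> (maps X). h S = 0"
      and R': "R' \<in> rep_space Q ?\<alpha>"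
    have f': "R' a0 \<in> carrier_mat c d" using R' PD(4,5) unfolding rep_space_def c_def d_def by (auto dest: PiE_mem)
    \<comment> \<open>With the pendant matrix of \<open>R'\<close> fixed, the function vanishes on
      the orbit of \<open>R\<close> by \<open>slice\<close>, hence on the whole smaller
      representation space.\<close>
    have "(\<lambda>S. h (S(a0 := R' a0))) (restrict R' (arcs ?Q')) = 0"
    proof (rule Rdense[OF regular_slice_del_vert[OF h P]])
      show "\<forall>S\<in>orbit_rep ?Q' (?\<alpha>(n := 0)) (maps R). h (S(a0 := R' a0)) = 0"
        by (intro ballI slice[OF h van _ f'])
      have "R' a \<in> carrier_mat ((?\<alpha>(n := 0)) (head ?Q' a)) ((?\<alpha>(n := 0)) (tail ?Q' a))" if a: "a \<in> arcs ?Q'" for a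
      proof -
        have "R' a \<in> carrier_mat (?\<alpha> (head Q a)) (?\<alpha> (tail Q a))"
          using R' ht(3)[OF a] unfolding rep_space_def by (rule PiE_mem)
        then show ?thesis using ht(1,2)[OF a] by (simp add: del_vert_simps)
      qed
      then show "restrict R' (arcs ?Q') \<in> rep_space ?Q' (?\<alpha>(n := 0))"
        unfolding rep_space_def by (intro restrict_PiE_iff[THEN iffD2] ballI)
    qed
    moreover have "(restrict R' (arcs ?Q'))(a0 := R' a0) = R'"
    proof (rule ext)
      fix a
      have "R' a = undefined" if "a \<notin> arcs Q" using R' that unfolding rep_space_def by (rule PiE_arb)
      then show "((restrict R' (arcs ?Q'))(a0 := R' a0)) a = R' a"
        using PD(8) by (cases "a = a0") auto
    qed
    ultimately show "h R' = 0" by simp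
  qed
  then show ?thesis using X by (simp add: generic_rep_def)
qed

section \<open>Morphisms between interval representations\<close>

lemma one_by_one_eqI:
  assumes "A \<in> carrier_mat 1 1" "B \<in> carrier_mat 1 1" "A $$ (0, 0) = B $$ (0, 0)"
  shows "A = B"
  by (rule eq_matI) (use assms in auto)

text \<open>The common part of the intervals has to be a quotient of \<open>X\<close> and a
  subrepresentation of \<open>Y\<close>. Both start at \<open>j\<close>, so only the arrow at the
  earlier right end matters, and \<open>border\<close> is the required orientation. On the common
  part the morphism is the ratio of the two compatible bases.\<close>

lemma interval_hom_exists:
  assumes chain: "chain_quiver m Q e" and X: "interval_rep Q j b X v" and Y: "interval_rep Q j b' Y w"
    and jb: "1 \<le> j" "j \<le> b" "j \<le> b'" "b \<le> m" "b' \<le> m"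
    and border: "b < b' \<Longrightarrow> tail Q (e b) = Suc b" "b' < b \<Longrightarrow> tail Q (e b') = b'"
  shows "\<exists>\<phi>. ishom Q X Y \<phi> \<and> (\<forall>i\<in>{j..b} \<inter> {j..b'}. \<phi> i $$ (0, 0) \<noteq> 0)"
proof -
  have wf: "wf_digraph Q" and V: "verts Q = {1..m}" and A: "arcs Q = e ` {1..<m}"
    and o: "\<And>i. i \<in> {1..<m} \<Longrightarrow> tail Q (e i) = i \<and> head Q (e i) = Suc i \<or> tail Q (e i) = Suc i \<and> head Q (e i) = i"
    using chain by (auto simp: chain_quiver_def)
  interpret wf_digraph Q by (rule wf)
  note dX = interval_dims(2)[OF X] and dY = interval_dims(2)[OF Y]
  define \<phi> where "\<phi> = (\<lambda>i. mat (dimv Y i) (dimv X i) (\<lambda>_. w i / v i))"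
  have vw: "v i \<noteq> 0" "w i \<noteq> 0" for i using X Y by (auto simp: interval_rep_def)
  have "\<phi> (head Q a) * maps X a = maps Y a * \<phi> (tail Q a)" if a: "a \<in> arcs Q" for a
  proof -
    obtain i where i: "i \<in> {1..<m}" "a = e i" using a by (auto simp: A)
    have Xa: "maps X a \<in> carrier_mat (dimv X (head Q a)) (dimv X (tail Q a))"
      by (rule is_repD(1)[OF interval_dims(1)[OF X] a])
    have Ya: "maps Y a \<in> carrier_mat (dimv Y (head Q a)) (dimv Y (tail Q a))"
      by (rule is_repD(1)[OF interval_dims(1)[OF Y] a])
    have ph: "\<phi> (head Q a) \<in> carrier_mat (dimv Y (head Q a)) (dimv X (head Q a))"
      and pt: "\<phi> (tail Q a) \<in> carrier_mat (dimv Y (tail Q a)) (dimv X (tail Q a))" by (simp_all add: \<phi>_def)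
    note l = mult_carrier_mat[OF ph Xa] and r = mult_carrier_mat[OF Ya pt]
    show ?thesis
    proof (cases "dimv Y (head Q a) = 0 \<or> dimv X (tail Q a) = 0")
      case True
      then show ?thesis by (rule mat_eq_zero_dim[OF l r])
    next
      case False
      then have h: "head Q a \<in> {j..b'}" and t: "tail Q a \<in> {j..b}" by (auto simp: dX dY split: if_splits)
      have hb: "head Q a \<in> {j..b}"
      proof (rule ccontr)
        assume "head Q a \<notin> {j..b}"
        then have "head Q a > b" using h by auto
        then have "b = i" "tail Q a = b" using o[OF i(1)] t i(2) by auto
        then show False using border(1) h \<open>head Q a > b\<close> i(2) by auto
      qed
      have tb: "tail Q a \<in> {j..b'}"
      proof (rule ccontr)
        assume "tail Q a \<notin> {j..b'}"
        then have "tail Q a > b'" using t by auto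
        then have "b' = i" "tail Q a = Suc b'" using o[OF i(1)] h i(2) by auto
        then show False using border(2) t i(2) by auto
      qed
      have d: "dimv X (head Q a) = 1" "dimv X (tail Q a) = 1" "dimv Y (head Q a) = 1" "dimv Y (tail Q a) = 1"
        using h t hb tb by (simp_all add: dX dY)
      have "maps X a $$ (0, 0) * v (tail Q a) = v (head Q a)" "maps Y a $$ (0, 0) * w (tail Q a) = w (head Q a)"
        using X Y a h t hb tb by (auto simp: interval_rep_def)
      then have x: "maps X a $$ (0, 0) = v (head Q a) / v (tail Q a)" "maps Y a $$ (0, 0) = w (head Q a) / w (tail Q a)"
        using vw by (simp_all add: field_simps)
      have "(\<phi> (head Q a) * maps X a) $$ (0, 0) = (maps Y a * \<phi> (tail Q a)) $$ (0, 0)"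
        using one_by_one_mult[of "\<phi> (head Q a)" "maps X a"] one_by_one_mult[of "maps Y a" "\<phi> (tail Q a)"]
          ph pt Xa Ya vw unfolding d by (simp add: x \<phi>_def d)
      then show ?thesis by (rule one_by_one_eqI[OF l[unfolded d] r[unfolded d]])
    qed
  qed
  then have "ishom Q X Y \<phi>" by (auto simp: ishom_def \<phi>_def)
  moreover have "\<phi> i $$ (0, 0) \<noteq> 0" if "i \<in> {j..b} \<inter> {j..b'}" for i
    using that vw by (auto simp: \<phi>_def dX dY)
  ultimately show ?thesis by blast
qed

text \<open>Meant for representations of dimension 1 at vertex 2, where a morphism is a scalar.
  Being non-zero there is inherited by composites, which fails for non-zero morphisms in
  general.\<close>

definition hom_at_2 :: "(nat, 'b) pre_digraph \<Rightarrow> (nat, 'b) quiver_rep \<Rightarrow> (nat, 'b) quiver_rep \<Rightarrow> bool" where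
  "hom_at_2 Q X Y \<longleftrightarrow> (\<exists>\<phi>. ishom Q X Y \<phi> \<and> \<phi> 2 $$ (0, 0) \<noteq> 0)"

text \<open>The left end \<open>j\<close> is kept as a parameter because, with the orientation of
  the arrow between 1 and 2, it determines the class. The right end is free.\<close>

definition interval_through_2 :: "nat \<Rightarrow> (nat, 'b) pre_digraph \<Rightarrow> nat \<Rightarrow> (nat, 'b) quiver_rep \<Rightarrow> bool" where
  "interval_through_2 m Q j X \<longleftrightarrow> 1 \<le> j \<and> j \<le> 2 \<and> (\<exists>b v. 2 \<le> b \<and> b \<le> m \<and> interval_rep Q j b X v)"

lemma interval_through_2_dims:
  assumes "interval_through_2 m Q j X"
  shows "is_rep Q X" "dimv X 2 = 1" "dimv X 1 = (if j = 1 then 1 else 0)"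
  using assms by (auto simp: interval_through_2_def interval_rep_def)

lemma nonzero_Hom_iff_at_2:
  assumes chain: "chain_quiver m Q e" and m: "2 \<le> m"
    and X: "interval_through_2 m Q j X" and Y: "interval_through_2 m Q j' Y"
  shows "nonzero_Hom Q X Y \<longleftrightarrow> hom_at_2 Q X Y"
proof -
  have wf: "wf_digraph Q" and V: "verts Q = {1..m}" using chain by (auto simp: chain_quiver_def)
  obtain b v where X': "1 \<le> j" "j \<le> 2" "2 \<le> b" "b \<le> m" "interval_rep Q j b X v"
    using X by (auto simp: interval_through_2_def)
  obtain b' w where Y': "1 \<le> j'" "j' \<le> 2" "2 \<le> b'" "b' \<le> m" "interval_rep Q j' b' Y w"
    using Y by (auto simp: interval_through_2_def)
  show ?thesis unfolding nonzero_Hom_iff[OF wf]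
  proof
    assume "\<exists>\<phi>. ishom Q X Y \<phi> \<and> (\<exists>x\<in>verts Q. \<phi> x \<noteq> 0\<^sub>m (dimv Y x) (dimv X x))"
    then obtain \<phi> x where "ishom Q X Y \<phi>" "x \<in> verts Q" "\<phi> x \<noteq> 0\<^sub>m (dimv Y x) (dimv X x)"
      by (elim exE conjE bexE)
    from this(1) interval_hom_nonzero_at_2[OF chain X'(5) Y'(5) this(1) X'(1-4) Y'(1-4) this(2,3)]
    show "hom_at_2 Q X Y" unfolding hom_at_2_def by (intro exI conjI)
  next
    assume "hom_at_2 Q X Y"
    then obtain \<phi> where \<phi>: "ishom Q X Y \<phi>" "\<phi> 2 $$ (0, 0) \<noteq> 0" unfolding hom_at_2_def by (elim exE conjE)
    then have "\<phi> 2 \<noteq> 0\<^sub>m (dimv Y 2) (dimv X 2)"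
      using interval_through_2_dims(2)[OF X] interval_through_2_dims(2)[OF Y] by auto
    moreover have "2 \<in> verts Q" using V m by simp
    ultimately show "\<exists>\<phi>. ishom Q X Y \<phi> \<and> (\<exists>x\<in>verts Q. \<phi> x \<noteq> 0\<^sub>m (dimv Y x) (dimv X x))"
      using \<phi>(1) by (intro exI[of _ \<phi>] conjI bexI[of _ 2])
  qed
qed

lemma interval_hom_vanishes:
  assumes chain: "chain_quiver m Q e"
    and X: "interval_through_2 m Q j X" and Y: "interval_through_2 m Q j' Y"
    and h: "ishom Q X Y \<phi>" "\<phi> 2 $$ (0, 0) = 0" and x: "x \<in> verts Q"
  shows "\<phi> x = 0\<^sub>m (dimv Y x) (dimv X x)"
proof (rule ccontr)
  assume nz: "\<phi> x \<noteq> 0\<^sub>m (dimv Y x) (dimv X x)"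
  obtain b v where X': "1 \<le> j" "j \<le> 2" "2 \<le> b" "b \<le> m" "interval_rep Q j b X v"
    using X by (auto simp: interval_through_2_def)
  obtain b' w where Y': "1 \<le> j'" "j' \<le> 2" "2 \<le> b'" "b' \<le> m" "interval_rep Q j' b' Y w"
    using Y by (auto simp: interval_through_2_def)
  show False
    using interval_hom_nonzero_at_2[OF chain X'(5) Y'(5) h(1) X'(1-4) Y'(1-4) x nz] h(2) by simp
qed

text \<open>The left ends agree, so the arrow at the earlier right end decides: one orientation
  admits a morphism from \<open>X\<close> to \<open>Y\<close>, the other one from \<open>Y\<close>
  to \<open>X\<close>.\<close>

lemma hom_at_2_total:
  assumes chain: "chain_quiver m Q e"
    and X: "interval_through_2 m Q j X" and Y: "interval_through_2 m Q j Y"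
  shows "hom_at_2 Q X Y \<or> hom_at_2 Q Y X"
proof -
  have A: "arcs Q = e ` {1..<m}"
    and o: "\<And>i. i \<in> {1..<m} \<Longrightarrow> tail Q (e i) = i \<and> head Q (e i) = Suc i \<or> tail Q (e i) = Suc i \<and> head Q (e i) = i"
    using chain by (auto simp: chain_quiver_def)
  obtain b v where X': "1 \<le> j" "j \<le> 2" "2 \<le> b" "b \<le> m" "interval_rep Q j b X v"
    using X by (auto simp: interval_through_2_def)
  obtain b' w where Y': "1 \<le> j" "j \<le> 2" "2 \<le> b'" "b' \<le> m" "interval_rep Q j b' Y w"
    using Y by (auto simp: interval_through_2_def)
  have two: "2 \<in> {j..b} \<inter> {j..b'}" "2 \<in> {j..b'} \<inter> {j..b}" using X' Y' by auto
  have jb: "j \<le> b" "j \<le> b'" using X' Y' by auto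
  note XY = interval_hom_exists[OF chain X'(5) Y'(5) X'(1) jb X'(4) Y'(4)]
  note YX = interval_hom_exists[OF chain Y'(5) X'(5) X'(1) jb(2,1) Y'(4) X'(4)]
  have "(b < b' \<longrightarrow> tail Q (e b) = Suc b) \<and> (b' < b \<longrightarrow> tail Q (e b') = b') \<or>
        (b' < b \<longrightarrow> tail Q (e b') = Suc b') \<and> (b < b' \<longrightarrow> tail Q (e b) = b)"
    using o[of b] o[of b'] X' Y' by auto
  then show ?thesis
  proof
    assume "(b < b' \<longrightarrow> tail Q (e b) = Suc b) \<and> (b' < b \<longrightarrow> tail Q (e b') = b')"
    then obtain \<phi> where "ishom Q X Y \<phi>" "\<forall>i\<in>{j..b} \<inter> {j..b'}. \<phi> i $$ (0, 0) \<noteq> 0" using XY by blast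
    then have "hom_at_2 Q X Y" unfolding hom_at_2_def using two(1) by blast
    then show ?thesis ..
  next
    assume "(b' < b \<longrightarrow> tail Q (e b') = Suc b') \<and> (b < b' \<longrightarrow> tail Q (e b) = b)"
    then obtain \<phi> where "ishom Q Y X \<phi>" "\<forall>i\<in>{j..b'} \<inter> {j..b}. \<phi> i $$ (0, 0) \<noteq> 0" using YX by blast
    then have "hom_at_2 Q Y X" unfolding hom_at_2_def using two(2) by blast
    then show ?thesis ..
  qed
qed

lemma hom_at_2_trans:
  assumes wf: "wf_digraph Q" and "2 \<in> verts Q" and r: "is_rep Q X" "is_rep Q Y" "is_rep Q Z"
    and d: "dimv X 2 = 1" "dimv Y 2 = 1" "dimv Z 2 = 1"
    and h: "hom_at_2 Q X Y" "hom_at_2 Q Y Z"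
  shows "hom_at_2 Q X Z"
proof -
  obtain \<phi> where \<phi>: "ishom Q X Y \<phi>" "\<phi> 2 $$ (0, 0) \<noteq> 0" using h(1) unfolding hom_at_2_def by (elim exE conjE)
  obtain \<psi> where \<psi>: "ishom Q Y Z \<psi>" "\<psi> 2 $$ (0, 0) \<noteq> 0" using h(2) unfolding hom_at_2_def by (elim exE conjE)
  have "\<phi> 2 \<in> carrier_mat 1 1" "\<psi> 2 \<in> carrier_mat 1 1"
    using ishomD(1)[OF \<phi>(1) assms(2)] ishomD(1)[OF \<psi>(1) assms(2)] by (simp_all add: d)
  then have "(\<psi> 2 * \<phi> 2) $$ (0, 0) \<noteq> 0" using one_by_one_mult[of "\<psi> 2" "\<phi> 2"] \<phi>(2) \<psi>(2) by simp
  then show ?thesis unfolding hom_at_2_def using ishom_comp[OF wf r \<phi>(1) \<psi>(1)]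
    by (intro exI[of _ "\<lambda>x. \<psi> x * \<phi> x"] conjI)
qed

text \<open>In the commuting square of the arrow between 1 and 2, one composite passes through a
  zero space at vertex 1, while the other is the scalar at 2 times a non-zero arrow map. The classes
  depend on the orientation of this arrow so that this happens in both cases.\<close>

lemma no_hom_first_to_second:
  assumes chain: "chain_quiver m Q e" and m: "2 \<le> m"
    and X: "interval_through_2 m Q (if 1 \<rightarrow>\<^bsub>Q\<^esub> 2 then 1 else 2) X"
    and Y: "interval_through_2 m Q (if 1 \<rightarrow>\<^bsub>Q\<^esub> 2 then 2 else 1) Y"
  shows "\<not> hom_at_2 Q X Y"
proof
  assume "hom_at_2 Q X Y"
  then obtain \<phi> where \<phi>: "ishom Q X Y \<phi>" "\<phi> 2 $$ (0, 0) \<noteq> 0" unfolding hom_at_2_def by (elim exE conjE)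
  have wf: "wf_digraph Q" and V: "verts Q = {1..m}" and A: "arcs Q = e ` {1..<m}"
    and o: "\<And>i. i \<in> {1..<m} \<Longrightarrow> tail Q (e i) = i \<and> head Q (e i) = Suc i \<or> tail Q (e i) = Suc i \<and> head Q (e i) = i"
    using chain by (auto simp: chain_quiver_def)
  let ?a = "e 1"
  have a: "?a \<in> arcs Q" and v2: "2 \<in> verts Q" "1 \<in> verts Q" using A V m by auto
  have p2: "\<phi> 2 \<in> carrier_mat 1 1"
    using ishomD(1)[OF \<phi>(1) v2(1)] interval_through_2_dims(2)[OF X] interval_through_2_dims(2)[OF Y] by simp
  have p1: "\<phi> 1 \<in> carrier_mat (dimv Y 1) (dimv X 1)" by (rule ishomD(1)[OF \<phi>(1) v2(2)])
  have nz: "maps Z ?a $$ (0, 0) \<noteq> 0 \<and> maps Z ?a \<in> carrier_mat 1 1" if Z: "interval_through_2 m Q 1 Z" for Z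
  proof -
    obtain b v where Z': "2 \<le> b" "interval_rep Q 1 b Z v" using Z by (auto simp: interval_through_2_def)
    have "tail Q ?a \<in> {1..b}" "head Q ?a \<in> {1..b}" using o[of 1] m Z'(1) by auto
    then show ?thesis using interval_map_nonzero[OF Z'(2) a] by blast
  qed
  note com = ishomD(4)[OF \<phi>(1) a]
  show False
  proof (cases "1 \<rightarrow>\<^bsub>Q\<^esub> 2")
    case True
    then have "(1, 2) \<in> arc_to_ends Q ` arcs Q" by (simp add: arcs_ends_def)
    then obtain a' where a': "(1, 2) = arc_to_ends Q a'" "a' \<in> arcs Q" by (rule imageE)
    then have a'12: "tail Q a' = 1" "head Q a' = 2" by (simp_all add: arc_to_ends_def)
    have "a' \<in> e ` {1..<m}" using a'(2) A by simp
    then obtain i where i: "a' = e i" "i \<in> {1..<m}" by (rule imageE)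
    have "i = 1" using o[OF i(2)] a'12 unfolding i(1) by linarith
    then have ht: "head Q ?a = 2" "tail Q ?a = 1" using a'12 unfolding i(1) by simp_all
    have X1: "interval_through_2 m Q 1 X" and Y2: "dimv Y 1 = 0"
      using X Y True interval_through_2_dims(3)[of m Q 2 Y] by simp_all
    have "maps Y ?a \<in> carrier_mat 1 0"
      using is_repD(1)[OF interval_through_2_dims(1)[OF Y] a] interval_through_2_dims(2)[OF Y] Y2 unfolding ht by simp
    moreover have "\<phi> 1 \<in> carrier_mat 0 1" using p1 Y2 interval_through_2_dims(3)[OF X1] by simp
    ultimately have "maps Y ?a * \<phi> 1 = 0\<^sub>m 1 1" by (rule mult_mat_zero_dim)
    from arg_cong[OF trans[OF com[unfolded ht] this], of "\<lambda>M. M $$ (0, 0)"]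
    have "(\<phi> 2 * maps X ?a) $$ (0, 0) = 0\<^sub>m 1 1 $$ (0, 0)" .
    then show False unfolding one_by_one_mult[OF p2 conjunct2[OF nz[OF X1]]] using nz[OF X1] \<phi>(2) by simp
  next
    case False
    have ht: "head Q ?a = 1" "tail Q ?a = 2"
    proof -
      have "\<not> (tail Q ?a = 1 \<and> head Q ?a = 2)"
      proof
        assume "tail Q ?a = 1 \<and> head Q ?a = 2"
        then have "(1, 2) = arc_to_ends Q ?a" by (simp add: arc_to_ends_def)
        from image_eqI[of _ "arc_to_ends Q", OF this a] show False using False by (simp add: arcs_ends_def)
      qed
      moreover have "(1::nat) \<in> {1..<m}" using m by simp
      from o[OF this] have "tail Q ?a = 1 \<and> head Q ?a = 2 \<or> tail Q ?a = 2 \<and> head Q ?a = 1"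
        by (simp only: Suc_1)
      ultimately show "head Q ?a = 1" "tail Q ?a = 2" by blast+
    qed
    have Y1: "interval_through_2 m Q 1 Y" and X2: "dimv X 1 = 0"
      using X Y False interval_through_2_dims(3)[of m Q 2 X] by simp_all
    have "maps X ?a \<in> carrier_mat 0 1"
      using is_repD(1)[OF interval_through_2_dims(1)[OF X] a] interval_through_2_dims(2)[OF X] X2 unfolding ht by simp
    moreover have "\<phi> 1 \<in> carrier_mat 1 0" using p1 X2 interval_through_2_dims(3)[OF Y1] by simp
    ultimately have "\<phi> 1 * maps X ?a = 0\<^sub>m 1 1" by (intro mult_mat_zero_dim)
    from arg_cong[OF trans[OF com[unfolded ht, symmetric] this], of "\<lambda>M. M $$ (0, 0)"]
    have "(maps Y ?a * \<phi> 2) $$ (0, 0) = 0\<^sub>m 1 1 $$ (0, 0)" .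
    then show False unfolding one_by_one_mult[OF conjunct2[OF nz[OF Y1]] p2] using nz[OF Y1] \<phi>(2) by simp
  qed
qed

text \<open>The left end is the first vertex of the support, which is 1 or 2 because the dimension
  at 2 is not 0.\<close>

lemma indecomposable_class:
  assumes chain: "chain_quiver m Q e" and m: "2 \<le> m" and X: "indecomposable_rep Q X" and d: "dimv X 2 \<noteq> 0"
  shows "interval_through_2 m Q (if dimv X 1 = 0 then 2 else 1) X"
proof (cases "dimv X 1 = 0")
  case True
  have "dimv X i = 0" if "1 \<le> i" "i < 2" for i using True that by (metis One_nat_def Suc_1 le_antisym less_Suc_eq_le)
  then obtain b v where "2 \<le> b" "b \<le> m" "interval_rep Q 2 b X v"
    using indecomposable_chain_interval[OF chain X _ m d] by (metis one_le_numeral)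
  then show ?thesis using True by (auto simp: interval_through_2_def)
next
  case False
  have m1: "1 \<le> m" using m by simp
  obtain b v where b: "1 \<le> b" "b \<le> m" "interval_rep Q 1 b X v"
    by (rule indecomposable_chain_interval[OF chain X le_refl m1 False]) (use that in auto)
  then have "2 \<le> b" using d interval_dims(2)[OF b(3), of 2] by (auto split: if_splits)
  then show ?thesis using False b by (auto simp: interval_through_2_def)
qed

lemma first_class_interval:
  assumes "interval_through_2 m Q (if dimv X 1 = 0 then 2 else 1) X"
  shows "first_class Q X \<or> second_class Q X"
    and "first_class Q X \<Longrightarrow> interval_through_2 m Q (if 1 \<rightarrow>\<^bsub>Q\<^esub> 2 then 1 else 2) X"
    and "second_class Q X \<Longrightarrow> interval_through_2 m Q (if 1 \<rightarrow>\<^bsub>Q\<^esub> 2 then 2 else 1) X"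
  using assms interval_through_2_dims[OF assms]
  by (auto simp: first_class_def second_class_def split: if_splits)

text \<open>The number of successors serves as a sort key.\<close>

lemma total_preorder_arrange:
  assumes tot: "\<And>x y. x \<in> set xs \<Longrightarrow> y \<in> set xs \<Longrightarrow> r x y \<or> r y x"
    and tr: "\<And>x y z. x \<in> set xs \<Longrightarrow> y \<in> set xs \<Longrightarrow> z \<in> set xs \<Longrightarrow> r x y \<Longrightarrow> r y z \<Longrightarrow> r x z"
  shows "\<exists>ys. mset ys = mset xs \<and> (\<forall>i<length ys. \<forall>j\<le>i. r (ys ! i) (ys ! j))"
proof -
  define k where "k = (\<lambda>x. card {y \<in> set xs. r x y})"
  have key: "r x y" if xy: "x \<in> set xs" "y \<in> set xs" "k y \<le> k x" for x y
  proof (rule ccontr)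
    \<comment> \<open>Then \<open>y\<close> has all successors of \<open>x\<close> and also itself,
      hence strictly more.\<close>
    assume n: "\<not> r x y"
    then have "r y x" using tot[OF xy(1,2)] by blast
    then have "{z \<in> set xs. r x z} \<subseteq> {z \<in> set xs. r y z}" using tr[OF xy(2,1)] by blast
    moreover have "y \<in> {z \<in> set xs. r y z}" using tot[OF xy(2,2)] xy(2) by blast
    ultimately have "{z \<in> set xs. r x z} \<subset> {z \<in> set xs. r y z}" using n by blast
    then have "k x < k y" unfolding k_def by (intro psubset_card_mono) auto
    then show False using xy(3) by simp
  qed
  \<comment> \<open>Ascending in the number of successors, so that later elements are related to
    earlier ones, as in \<open>hom_ordered\<close>.\<close>
  let ?ys = "sort_key k xs"
  have "r (?ys ! i) (?ys ! j)" if "i < length ?ys" "j \<le> i" for i j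
  proof (rule key)
    have "sorted (map k ?ys)" by simp
    from sorted_nth_mono[OF this that(2)] that show "k (?ys ! j) \<le> k (?ys ! i)" by simp
    show "?ys ! i \<in> set xs" "?ys ! j \<in> set xs"
      using nth_mem[of i ?ys] nth_mem[of j ?ys] that by simp_all
  qed
  then show ?thesis by (intro exI[of _ ?ys]) simp
qed

section \<open>Gluing a vertex to a direct sum\<close>

text \<open>Inverse construction to \<open>restrict_rep\<close>: a space of dimension
  \<open>s\<close> is put at \<open>n\<close>, with \<open>r\<close> on every arrow ending there,
  which for a pendant arrow means on that arrow only.\<close>

definition glue :: "('v, 'b) pre_digraph \<Rightarrow> 'v \<Rightarrow> nat \<Rightarrow> complex mat \<Rightarrow> ('v, 'b) quiver_rep \<Rightarrow> ('v, 'b) quiver_rep" where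
  "glue Q n s r Y = \<lparr>dimv = (dimv Y)(n := s), maps = (\<lambda>a\<in>arcs Q. if head Q a = n then r else maps Y a)\<rparr>"

lemma glue_rep:
  assumes P: "pendant_arrow Q n a0" and Y: "is_rep (pre_digraph.del_vert Q n) Y"
    and r: "r \<in> carrier_mat s (dimv Y (tail Q a0))"
  shows "is_rep Q (glue Q n s r Y)" "restrict_rep Q n (glue Q n s r Y) = Y" "maps (glue Q n s r Y) a0 = r"
proof -
  note PD = pendant_arrowD[OF P]
  have dn: "dimv Y n = 0" by (rule is_repD(4)[OF Y]) (simp add: del_vert_simps)
  show "is_rep Q (glue Q n s r Y)"
  proof (rule is_repI)
    show "dimv (glue Q n s r Y) x = 0" if "x \<notin> verts Q" for x
    proof -
      have "x \<noteq> n" "x \<notin> verts (pre_digraph.del_vert Q n)" using that PD(3) by (auto simp: del_vert_simps)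
      then show ?thesis using is_repD(4)[OF Y, of x] by (simp add: glue_def)
    qed
    show "maps (glue Q n s r Y) \<in> extensional (arcs Q)" by (simp add: glue_def)
    fix a assume a: "a \<in> arcs Q"
    show "maps (glue Q n s r Y) a \<in> carrier_mat (dimv (glue Q n s r Y) (head Q a)) (dimv (glue Q n s r Y) (tail Q a))"
    proof (cases "a = a0")
      case True
      then show ?thesis using r PD(4,5,6) by (simp add: glue_def)
    next
      case False
      then have "head Q a \<noteq> n" "tail Q a \<noteq> n" "a \<in> arcs (pre_digraph.del_vert Q n)"
        using a PD(8,9) by auto
      then show ?thesis using a is_repD(1)[OF Y, of a] by (simp add: glue_def del_vert_simps)
    qed
  qed
  show "maps (glue Q n s r Y) a0 = r" using PD(4,5) by (simp add: glue_def)
  have "dimv (restrict_rep Q n (glue Q n s r Y)) = dimv Y" using dn by (auto simp: restrict_rep_def glue_def)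
  moreover have "maps (restrict_rep Q n (glue Q n s r Y)) = maps Y"
  proof (rule ext)
    fix a
    have "maps Y a = undefined" if "a \<notin> arcs (pre_digraph.del_vert Q n)"
      using Y that unfolding is_rep_def rep_space_def by (elim conjE) (rule PiE_arb)
    then show "maps (restrict_rep Q n (glue Q n s r Y)) a = maps Y a"
      by (auto simp: restrict_rep_def glue_def del_vert_simps)
  qed
  ultimately show "restrict_rep Q n (glue Q n s r Y) = Y" by (rule quiver_rep.equality) simp
qed

lemma restrict_direct_sum:
  "restrict_rep Q n (direct_sum Q Ws) = direct_sum (pre_digraph.del_vert Q n) (map (restrict_rep Q n) Ws)"
proof (rule quiver_rep.equality)
  show "dimv (restrict_rep Q n (direct_sum Q Ws)) = dimv (direct_sum (pre_digraph.del_vert Q n) (map (restrict_rep Q n) Ws))"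
  proof (rule ext)
    fix x
    have "(\<Sum>X\<leftarrow>Ws. ((dimv X)(n := 0)) x) = (if x = n then 0 else \<Sum>X\<leftarrow>Ws. dimv X x)"
      by (induction Ws) auto
    then show "dimv (restrict_rep Q n (direct_sum Q Ws)) x = dimv (direct_sum (pre_digraph.del_vert Q n) (map (restrict_rep Q n) Ws)) x"
      by (simp add: restrict_rep_def direct_sum_def o_def)
  qed
  show "maps (restrict_rep Q n (direct_sum Q Ws)) = maps (direct_sum (pre_digraph.del_vert Q n) (map (restrict_rep Q n) Ws))"
    by (rule ext) (auto simp: restrict_rep_def direct_sum_def o_def restrict_apply del_vert_simps)
qed simp

lemma direct_sum_singleton: "is_rep Q X \<Longrightarrow> direct_sum Q [X] = X"
proof (rule quiver_rep.equality)
  assume "is_rep Q X"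
  then have "maps X \<in> extensional (arcs Q)" by (simp add: is_rep_def rep_space_def PiE_def)
  then show "maps (direct_sum Q [X]) = maps X"
    by (simp add: direct_sum_def extensional_restrict del: diag_block_mat.simps)
qed (simp_all add: direct_sum_def)

lemma biproduct_cong:
  assumes "biproduct Q X I F \<iota> \<pi>" "\<And>k. k \<in> I \<Longrightarrow> F k = F' k"
  shows "biproduct Q X I F' \<iota> \<pi>"
  using assms unfolding biproduct_def by simp

lemma biproduct_restrict_rep:
  assumes b: "biproduct Q X I F \<iota> \<pi>" and wf: "wf_digraph Q"
  shows "biproduct (pre_digraph.del_vert Q n) (restrict_rep Q n X) I (\<lambda>k. restrict_rep Q n (F k)) \<iota> \<pi>"
  unfolding biproduct_def
proof (intro conjI ballI)
  fix k assume k: "k \<in> I"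
  show "is_rep (pre_digraph.del_vert Q n) (restrict_rep Q n (F k))"
    by (rule is_rep_restrict_rep[OF biproductD(3)[OF b k]])
  show "ishom (pre_digraph.del_vert Q n) (restrict_rep Q n (F k)) (restrict_rep Q n X) (\<iota> k)"
    by (rule ishom_restrict_rep[OF wf biproductD(4)[OF b k]])
  show "ishom (pre_digraph.del_vert Q n) (restrict_rep Q n X) (restrict_rep Q n (F k)) (\<pi> k)"
    by (rule ishom_restrict_rep[OF wf biproductD(5)[OF b k]])
next
  fix x k l assume x: "x \<in> verts (pre_digraph.del_vert Q n)" and kl: "k \<in> I" "l \<in> I"
  then have x': "x \<in> verts Q" "x \<noteq> n" by (auto simp: del_vert_simps)
  then have "dimv (restrict_rep Q n (F k)) x = dimv (F k) x" "dimv (restrict_rep Q n (F l)) x = dimv (F l) x"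
    by (simp_all add: restrict_rep_def)
  then show "\<pi> k x * \<iota> l x = (if k = l then 1\<^sub>m (dimv (restrict_rep Q n (F k)) x)
      else 0\<^sub>m (dimv (restrict_rep Q n (F k)) x) (dimv (restrict_rep Q n (F l)) x))"
    using biproductD(6)[OF b x'(1) kl(1)] biproductD(7)[OF b x'(1) kl] by (cases "k = l") simp_all
next
  fix x assume x: "x \<in> verts (pre_digraph.del_vert Q n)"
  then have x': "x \<in> verts Q" "x \<noteq> n" by (auto simp: del_vert_simps)
  then have "dimv (restrict_rep Q n X) x = dimv X x" by (simp add: restrict_rep_def)
  then show "mat_sum (dimv (restrict_rep Q n X) x) (dimv (restrict_rep Q n X) x) (\<lambda>k. \<iota> k x * \<pi> k x) I
      = 1\<^sub>m (dimv (restrict_rep Q n X) x)"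
    using biproductD(8)[OF b x'(1)] by simp
qed (rule biproductD(1)[OF b], rule is_rep_restrict_rep[OF biproductD(2)[OF b]])

lemma mat_sum_zero: "mat_sum nr nc (\<lambda>k. 0\<^sub>m nr nc) I = 0\<^sub>m nr nc"
  by (rule eq_matI) (auto simp: mat_sum_def)

lemma biproduct_expand_left:
  assumes b: "biproduct Q X I F \<iota> \<pi>" and x: "x \<in> verts Q" and M: "M \<in> carrier_mat (dimv X x) k"
  shows "M = mat_sum (dimv X x) k (\<lambda>p. \<iota> p x * (\<pi> p x * M)) I"
proof -
  note c = biproduct_carriers[OF b x]
  have "M = mat_sum (dimv X x) (dimv X x) (\<lambda>p. \<iota> p x * \<pi> p x) I * M"
    unfolding biproductD(8)[OF b x] by (rule left_mult_one_mat[OF M, symmetric])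
  also have "\<dots> = mat_sum (dimv X x) k (\<lambda>p. \<iota> p x * \<pi> p x * M) I"
    by (rule mat_sum_mult[OF M mult_carrier_mat[OF c]])
  also have "\<dots> = mat_sum (dimv X x) k (\<lambda>p. \<iota> p x * (\<pi> p x * M)) I"
    by (rule mat_sum_cong, rule assoc_mult_mat[OF c M])
  finally show ?thesis .
qed

lemma biproduct_expand_right:
  assumes b: "biproduct Q X I F \<iota> \<pi>" and x: "x \<in> verts Q" and M: "M \<in> carrier_mat k (dimv X x)"
  shows "M = mat_sum k (dimv X x) (\<lambda>p. M * \<iota> p x * \<pi> p x) I"
proof -
  note c = biproduct_carriers[OF b x]
  have "M = M * mat_sum (dimv X x) (dimv X x) (\<lambda>p. \<iota> p x * \<pi> p x) I"
    unfolding biproductD(8)[OF b x] by (rule right_mult_one_mat[OF M, symmetric])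
  also have "\<dots> = mat_sum k (dimv X x) (\<lambda>p. M * (\<iota> p x * \<pi> p x)) I"
    by (rule mult_mat_sum[OF M mult_carrier_mat[OF c]])
  also have "\<dots> = mat_sum k (dimv X x) (\<lambda>p. M * \<iota> p x * \<pi> p x) I"
    by (rule mat_sum_cong, rule assoc_mult_mat[OF M c, symmetric])
  finally show ?thesis .
qed

lemma isom_dimv:
  assumes "isom Q X Y \<phi> \<psi>" "x \<in> verts Q"
  shows "dimv X x = dimv Y x"
proof -
  have h: "ishom Q X Y \<phi>" "ishom Q Y X \<psi>" and inv: "\<psi> x * \<phi> x = 1\<^sub>m (dimv X x)" "\<phi> x * \<psi> x = 1\<^sub>m (dimv Y x)"
    using assms by (simp_all add: isom_def)
  note c = ishomD(1)[OF h(1) assms(2)] ishomD(1)[OF h(2) assms(2)]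
  show ?thesis using one_mat_factor_le[OF c(2,1) inv(1)] one_mat_factor_le[OF c(1,2) inv(2)] by (rule antisym)
qed

lemma one_mat_eq_zero:
  assumes "(1\<^sub>m k :: complex mat) = 0\<^sub>m k k"
  shows "k = 0"
proof (rule ccontr)
  assume "k \<noteq> 0"
  then show False using arg_cong[OF assms, of "\<lambda>M. M $$ (0, 0)"] by simp
qed

text \<open>Converse of \<open>indecomposable_idempotent\<close>: the projection onto the first
  summand of a decomposition, carried to \<open>X\<close> by the isomorphism, is an idempotent; if
  it is 0 the first summand vanishes, if it is 1 the second.\<close>

lemma indecomposable_repI:
  assumes wf: "wf_digraph Q" and X: "is_rep Q X" "\<not> zero_rep Q X"
    and triv: "\<And>e. ishom Q X X e \<Longrightarrow> (\<And>x. x \<in> verts Q \<Longrightarrow> e x * e x = e x) \<Longrightarrow>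
      (\<forall>x\<in>verts Q. e x = 0\<^sub>m (dimv X x) (dimv X x)) \<or> (\<forall>x\<in>verts Q. e x = 1\<^sub>m (dimv X x))"
  shows "indecomposable_rep Q X"
  unfolding indecomposable_rep_def
proof (intro conjI allI impI, rule X(1), rule X(2))
  fix Y Z assume A: "is_rep Q Y \<and> is_rep Q Z \<and> iso_rep Q X (direct_sum Q [Y, Z])"
  define F where "F = (\<lambda>k::nat. if k = 0 then Y else Z)"
  have F: "is_rep Q (F k)" for k using A by (simp add: F_def)
  have "\<exists>\<iota> \<pi>. biproduct Q (direct_sum Q (map F [0, 1])) (set [0, 1]) F \<iota> \<pi>"
    by (rule direct_sum_biproduct[OF wf]) (simp, rule F)
  then obtain \<iota> \<pi> where b: "biproduct Q (direct_sum Q [Y, Z]) {0, 1} F \<iota> \<pi>" by (auto simp: F_def)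
  have D: "is_rep Q (direct_sum Q [Y, Z])" by (rule biproductD(2)[OF b])
  obtain \<phi> \<psi> where iso: "isom Q X (direct_sum Q [Y, Z]) \<phi> \<psi>"
    using A iso_rep_iff[OF wf X(1) D] by blast
  then have h: "ishom Q X (direct_sum Q [Y, Z]) \<phi>" "ishom Q (direct_sum Q [Y, Z]) X \<psi>" by (simp_all add: isom_def)
  let ?d = "dimv (direct_sum Q [Y, Z])"
  have e0: "ishom Q (direct_sum Q [Y, Z]) (direct_sum Q [Y, Z]) (\<lambda>x. \<iota> 0 x * \<pi> 0 x)"
    by (rule ishom_comp[OF wf D F D biproductD(5)[OF b] biproductD(4)[OF b]]) simp_all
  \<comment> \<open>The projection onto \<open>Y\<close>, conjugated by the isomorphism with the
    direct sum.\<close>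
  define e where "e = (\<lambda>x. \<psi> x * (\<iota> 0 x * \<pi> 0 x * \<phi> x))"
  have e: "ishom Q X X e" unfolding e_def
    by (rule ishom_comp[OF wf X(1) D X(1) ishom_comp[OF wf X(1) D D h(1) e0] h(2)])
  have tr: "\<phi> x * e x * \<psi> x = \<iota> 0 x * \<pi> 0 x" and idem: "e x * e x = e x" if x: "x \<in> verts Q" for x
  proof -
    have inv: "\<psi> x * \<phi> x = 1\<^sub>m (dimv X x)" "\<phi> x * \<psi> x = 1\<^sub>m (?d x)" using iso x by (simp_all add: isom_def)
    note p = ishomD(1)[OF h(1) x] and q = ishomD(1)[OF h(2) x] and E = ishomD(1)[OF e0 x]
    note i0 = biproduct_carriers[OF b x, of 0, simplified]
    let ?E = "\<iota> 0 x * \<pi> 0 x"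
    have EE: "?E * ?E = ?E"
    proof -
      have "?E * ?E = \<iota> 0 x * (\<pi> 0 x * (\<iota> 0 x * \<pi> 0 x))" by (rule assoc_mult_mat[OF i0 E])
      also have "\<pi> 0 x * (\<iota> 0 x * \<pi> 0 x) = \<pi> 0 x * \<iota> 0 x * \<pi> 0 x" by (rule assoc_mult_mat[OF i0(2,1,2), symmetric])
      also have "\<pi> 0 x * \<iota> 0 x = 1\<^sub>m (dimv (F 0) x)" by (rule biproductD(6)[OF b x]) simp
      also have "1\<^sub>m (dimv (F 0) x) * \<pi> 0 x = \<pi> 0 x" by (rule left_mult_one_mat[OF i0(2)])
      finally show ?thesis .
    qed
    have "\<phi> x * e x = \<phi> x * \<psi> x * (?E * \<phi> x)" unfolding e_def
      by (rule assoc_mult_mat[OF p q mult_carrier_mat[OF E p], symmetric])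
    also have "\<dots> = ?E * \<phi> x" unfolding inv(2) by (rule left_mult_one_mat[OF mult_carrier_mat[OF E p]])
    finally have pe: "\<phi> x * e x = ?E * \<phi> x" .
    have "\<phi> x * e x * \<psi> x = ?E * (\<phi> x * \<psi> x)" unfolding pe by (rule assoc_mult_mat[OF E p q])
    then show "\<phi> x * e x * \<psi> x = ?E" unfolding inv(2) right_mult_one_mat[OF E] .
    have "e x * e x = \<psi> x * (?E * \<phi> x * e x)" 
      by (subst (1) e_def) (rule assoc_mult_mat[OF q mult_carrier_mat[OF E p] ishomD(1)[OF e x]])
    also have "?E * \<phi> x * e x = ?E * (?E * \<phi> x)"
      unfolding assoc_mult_mat[OF E p ishomD(1)[OF e x]] pe ..
    also have "\<dots> = ?E * \<phi> x" unfolding assoc_mult_mat[OF E E p, symmetric] EE ..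
    finally show "e x * e x = e x" unfolding e_def .
  qed
  from triv[OF e idem] show "zero_rep Q Y \<or> zero_rep Q Z"
  proof
    assume z: "\<forall>x\<in>verts Q. e x = 0\<^sub>m (dimv X x) (dimv X x)"
    have "dimv Y x = 0" if x: "x \<in> verts Q" for x
    proof (rule one_mat_eq_zero)
      note p = ishomD(1)[OF h(1) x] and q = ishomD(1)[OF h(2) x] and i0 = biproduct_carriers[OF b x, of 0, simplified]
      have F0: "F 0 = Y" by (simp add: F_def)
      have "\<iota> 0 x * \<pi> 0 x = 0\<^sub>m (?d x) (?d x)"
        unfolding tr[OF x, symmetric] bspec[OF z x] using p q by simp
      then have "\<pi> 0 x * (\<iota> 0 x * \<pi> 0 x) * \<iota> 0 x = 0\<^sub>m (dimv Y x) (dimv Y x)"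
        using i0 by (simp add: F0)
      moreover have "\<pi> 0 x * (\<iota> 0 x * \<pi> 0 x) * \<iota> 0 x = (\<pi> 0 x * \<iota> 0 x) * (\<pi> 0 x * \<iota> 0 x)"
        unfolding assoc_mult_mat[OF i0(2,1,2), symmetric]
        by (rule assoc_mult_mat[OF mult_carrier_mat[OF i0(2,1)] i0(2,1)])
      moreover have "\<pi> 0 x * \<iota> 0 x = 1\<^sub>m (dimv Y x)" using biproductD(6)[OF b x, of 0] by (simp add: F0)
      ultimately show "1\<^sub>m (dimv Y x) = (0\<^sub>m (dimv Y x) (dimv Y x) :: complex mat)" by simp
    qed
    then show ?thesis by (simp add: zero_rep_def)
  next
    assume o: "\<forall>x\<in>verts Q. e x = 1\<^sub>m (dimv X x)"
    have "dimv Z x = 0" if x: "x \<in> verts Q" for x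
    proof (rule one_mat_eq_zero)
      note p = ishomD(1)[OF h(1) x] and q = ishomD(1)[OF h(2) x]
      note i0 = biproduct_carriers[OF b x, of 0, simplified] and i1 = biproduct_carriers[OF b x, of 1, simplified]
      have F1: "F 1 = Z" by (simp add: F_def)
      have "\<iota> 0 x * \<pi> 0 x = \<phi> x * \<psi> x"
        unfolding tr[OF x, symmetric] bspec[OF o x] right_mult_one_mat[OF p] ..
      then have "\<iota> 0 x * \<pi> 0 x = 1\<^sub>m (?d x)" using iso x by (simp add: isom_def)
      then have "\<pi> 1 x * (\<iota> 0 x * \<pi> 0 x) = \<pi> 1 x" using i1 by simp
      moreover have "\<pi> 1 x * (\<iota> 0 x * \<pi> 0 x) = \<pi> 1 x * \<iota> 0 x * \<pi> 0 x"
        by (rule assoc_mult_mat[OF _ i0, symmetric]) (use i1 in simp)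
      moreover have "\<pi> 1 x * \<iota> 0 x = 0\<^sub>m (dimv (F 1) x) (dimv (F 0) x)" by (rule biproductD(7)[OF b x]) simp_all
      ultimately have "\<pi> 1 x = 0\<^sub>m (dimv (F 1) x) (?d x)" using i0(2) by simp
      then have "\<pi> 1 x * \<iota> 1 x = 0\<^sub>m (dimv (F 1) x) (dimv (F 1) x)" using i1 by simp
      moreover have "\<pi> 1 x * \<iota> 1 x = 1\<^sub>m (dimv (F 1) x)" by (rule biproductD(6)[OF b x]) simp
      ultimately show "1\<^sub>m (dimv Z x) = (0\<^sub>m (dimv Z x) (dimv Z x) :: complex mat)" unfolding F1 by simp
    qed
    then show ?thesis by (simp add: zero_rep_def)
  qed
qed

text \<open>A decomposition restricts to one of \<open>Y\<close>, so one restricted summand is zero;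
  at \<open>n\<close> both summands vanish since their dimensions add up to 0.\<close>

lemma indecomposable_glue_zero:
  assumes P: "pendant_arrow Q n a0" and Y: "indecomposable_rep (pre_digraph.del_vert Q n) Y"
    and r: "r \<in> carrier_mat 0 (dimv Y (tail Q a0))"
  shows "indecomposable_rep Q (glue Q n 0 r Y)"
  unfolding indecomposable_rep_def
proof (intro conjI allI impI)
  note PD = pendant_arrowD[OF P]
  let ?Q' = "pre_digraph.del_vert Q n" and ?W = "glue Q n 0 r Y"
  have Yr: "is_rep ?Q' Y" and Ynz: "\<not> zero_rep ?Q' Y" using Y by (simp_all add: indecomposable_rep_def)
  note g = glue_rep[OF P Yr r]
  show "is_rep Q ?W" by (rule g(1))
  show "\<not> zero_rep Q ?W"
  proof
    assume "zero_rep Q ?W"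
    then have wx: "dimv ?W x = 0" if "x \<in> verts Q" for x using that by (simp add: zero_rep_def)
    have "dimv Y x = 0" if "x \<in> verts Q" "x \<noteq> n" for x using wx[OF that(1)] that(2) by (simp add: glue_def)
    then have "zero_rep ?Q' Y" by (simp add: zero_rep_def del_vert_simps)
    then show False using Ynz by simp
  qed
  fix A B assume AB: "is_rep Q A \<and> is_rep Q B \<and> iso_rep Q ?W (direct_sum Q [A, B])"
  have D: "is_rep Q (direct_sum Q [A, B])" by (rule is_rep_direct_sum) (use AB in auto)
  obtain \<phi> \<psi> where iso: "isom Q ?W (direct_sum Q [A, B]) \<phi> \<psi>" using AB iso_rep_iff[OF PD(1) g(1) D] by blast
  then have "isom ?Q' (restrict_rep Q n ?W) (restrict_rep Q n (direct_sum Q [A, B])) \<phi> \<psi>"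
    using ishom_restrict_rep[OF PD(1)] unfolding isom_def by (auto simp: del_vert_simps restrict_rep_def)
  then have iso': "isom ?Q' Y (direct_sum ?Q' [restrict_rep Q n A, restrict_rep Q n B]) \<phi> \<psi>"
    unfolding g(2) restrict_direct_sum by simp
  have AB': "is_rep ?Q' (restrict_rep Q n A)" "is_rep ?Q' (restrict_rep Q n B)"
    using AB by (auto intro: is_rep_restrict_rep)
  have D': "is_rep ?Q' (direct_sum ?Q' [restrict_rep Q n A, restrict_rep Q n B])"
    by (rule is_rep_direct_sum) (use AB' in auto)
  have "iso_rep ?Q' Y (direct_sum ?Q' [restrict_rep Q n A, restrict_rep Q n B])"
    using iso' iso_rep_iff[OF PD(10) Yr D'] by blast
  then have z: "zero_rep ?Q' (restrict_rep Q n A) \<or> zero_rep ?Q' (restrict_rep Q n B)"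
    using Y AB' unfolding indecomposable_rep_def by blast
  have "dimv A n + dimv B n = 0"
    using isom_dimv[OF iso PD(3)] by (simp add: dimv_direct_sum glue_def)
  then have n: "dimv A n = 0" "dimv B n = 0" by simp_all
  from z show "zero_rep Q A \<or> zero_rep Q B"
  proof
    assume "zero_rep ?Q' (restrict_rep Q n A)"
    then have "zero_rep Q A" using n by (auto simp: zero_rep_def restrict_rep_def del_vert_simps)
    then show ?thesis ..
  next
    assume "zero_rep ?Q' (restrict_rep Q n B)"
    then have "zero_rep Q B" using n by (auto simp: zero_rep_def restrict_rep_def del_vert_simps)
    then show ?thesis ..
  qed
qed

text \<open>Meant for sizes at most 1, where it is the scalar 1 or an empty matrix. Rows without a
  copy of \<open>S_n\<close> and summands vanishing at 2 are thereby treated by the same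
  formulas.\<close>

definition ones_mat :: "nat \<Rightarrow> nat \<Rightarrow> complex mat" where
  "ones_mat a b = mat a b (\<lambda>_. 1)"

lemma ones_mat_carrier [simp]: "ones_mat a b \<in> carrier_mat a b"
  by (simp add: ones_mat_def)

lemma ones_mat_1_1: "ones_mat 1 1 = 1\<^sub>m 1"
  by (rule eq_matI) (auto simp: ones_mat_def)

lemma small_mat_scaled_ones:
  assumes "M \<in> carrier_mat a b" "a \<le> 1" "b \<le> 1"
  shows "M = (M $$ (0, 0)) \<cdot>\<^sub>m ones_mat a b"
proof (rule eq_matI)
  fix i j assume "i < dim_row ((M $$ (0, 0)) \<cdot>\<^sub>m ones_mat a b)" "j < dim_col ((M $$ (0, 0)) \<cdot>\<^sub>m ones_mat a b)"
  then have "i < a" "j < b" by (simp_all add: ones_mat_def)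
  moreover from this have "i = 0" "j = 0" using assms(2,3) by simp_all
  ultimately show "M $$ (i, j) = ((M $$ (0, 0)) \<cdot>\<^sub>m ones_mat a b) $$ (i, j)" by (simp add: ones_mat_def)
qed (use assms in \<open>simp_all add: ones_mat_def\<close>)

text \<open>In the coordinates given by the summands of \<open>Y\<close>, for \<open>s = 1\<close>
  and summands of dimension 1 at \<open>u\<close>: the row vector with all entries 1.\<close>

definition sum_row :: "'v \<Rightarrow> nat \<Rightarrow> ('v, 'b) quiver_rep \<Rightarrow> ('p \<Rightarrow> ('v, 'b) quiver_rep) \<Rightarrow>
    ('p \<Rightarrow> 'v \<Rightarrow> complex mat) \<Rightarrow> 'p set \<Rightarrow> complex mat" where
  "sum_row u s Y S \<pi> J = mat_sum s (dimv Y u) (\<lambda>p. ones_mat s (dimv (S p) u) * \<pi> p u) J"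

lemma sum_row_carrier [simp]: "sum_row u s Y S \<pi> J \<in> carrier_mat s (dimv Y u)"
  by (simp add: sum_row_def)

lemma sum_row_mult:
  assumes b: "biproduct Q Y J S \<iota> \<pi>" and u: "u \<in> verts Q" and M: "M \<in> carrier_mat (dimv Y u) k"
  shows "sum_row u s Y S \<pi> J * M = mat_sum s k (\<lambda>p. ones_mat s (dimv (S p) u) * (\<pi> p u * M)) J"
proof -
  note c = biproduct_carriers(2)[OF b u]
  have "sum_row u s Y S \<pi> J * M = mat_sum s k (\<lambda>p. ones_mat s (dimv (S p) u) * \<pi> p u * M) J"
    unfolding sum_row_def by (rule mat_sum_mult[OF M mult_carrier_mat[OF ones_mat_carrier c]])
  also have "\<dots> = mat_sum s k (\<lambda>p. ones_mat s (dimv (S p) u) * (\<pi> p u * M)) J"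
    by (rule mat_sum_cong, rule assoc_mult_mat[OF ones_mat_carrier c M])
  finally show ?thesis .
qed

lemma sum_row_iota:
  assumes b: "biproduct Q Y J S \<iota> \<pi>" and u: "u \<in> verts Q" and q: "q \<in> J"
  shows "sum_row u s Y S \<pi> J * \<iota> q u = ones_mat s (dimv (S q) u)"
proof -
  note c = biproduct_carriers[OF b u]
  have "sum_row u s Y S \<pi> J * \<iota> q u = mat_sum s (dimv (S q) u) (\<lambda>p. ones_mat s (dimv (S p) u) * (\<pi> p u * \<iota> q u)) J"
    by (rule sum_row_mult[OF b u c(1)[OF q]])
  also have "\<dots> = ones_mat s (dimv (S q) u) * (\<pi> q u * \<iota> q u)"
  proof (rule mat_sum_single)
    show "ones_mat s (dimv (S q) u) * (\<pi> q u * \<iota> q u) \<in> carrier_mat s (dimv (S q) u)"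
      by (rule mult_carrier_mat[OF ones_mat_carrier mult_carrier_mat[OF c(2)[OF q] c(1)[OF q]]])
    show "ones_mat s (dimv (S l) u) * (\<pi> l u * \<iota> q u) = 0\<^sub>m s (dimv (S q) u)" if "l \<in> J" "l \<noteq> q" for l
      unfolding biproductD(7)[OF b u that(1) q that(2)] by (rule right_mult_zero_mat[OF ones_mat_carrier])
  qed (rule biproductD(1)[OF b], rule q)
  also have "\<dots> = ones_mat s (dimv (S q) u)"
    unfolding biproductD(6)[OF b u q] by (rule right_mult_one_mat[OF ones_mat_carrier])
  finally show ?thesis .
qed

text \<open>An endomorphism that vanishes at \<open>n\<close> is zero. By \<open>off\<close> it is
  diagonal at the vertex attached to \<open>n\<close>; as the glued row has entries 1 only, each
  diagonal entry equals the scalar at \<open>n\<close>, which is 0; \<open>faithful\<close> spreads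
  the vanishing to all vertices. This applies to an idempotent or to its complement, according to
  its scalar at \<open>n\<close>.\<close>

lemma indecomposable_glue_one:
  assumes P: "pendant_arrow Q n a0"
    and b: "biproduct (pre_digraph.del_vert Q n) Y J S \<iota> \<pi>"
    and d: "\<And>p. p \<in> J \<Longrightarrow> dimv (S p) (tail Q a0) = 1"
    and off: "\<And>p q \<phi>. p \<in> J \<Longrightarrow> q \<in> J \<Longrightarrow> p \<noteq> q \<Longrightarrow> ishom (pre_digraph.del_vert Q n) (S p) (S q) \<phi> \<Longrightarrow>
      \<phi> (tail Q a0) $$ (0, 0) = 0"
    and faithful: "\<And>p q \<phi> x. p \<in> J \<Longrightarrow> q \<in> J \<Longrightarrow> ishom (pre_digraph.del_vert Q n) (S p) (S q) \<phi> \<Longrightarrow>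
      \<phi> (tail Q a0) $$ (0, 0) = 0 \<Longrightarrow> x \<in> verts (pre_digraph.del_vert Q n) \<Longrightarrow>
      \<phi> x = 0\<^sub>m (dimv (S q) x) (dimv (S p) x)"
  shows "indecomposable_rep Q (glue Q n 1 (sum_row (tail Q a0) 1 Y S \<pi> J) Y)"
proof -
  let ?Q' = "pre_digraph.del_vert Q n" and ?u = "tail Q a0"
  note PD = pendant_arrowD[OF P]
  define r where "r = sum_row ?u 1 Y S \<pi> J"
  have r: "r \<in> carrier_mat 1 (dimv Y ?u)" by (simp add: r_def)
  have Y: "is_rep ?Q' Y" by (rule biproductD(2)[OF b])
  define W where "W = glue Q n 1 r Y"
  note g = glue_rep[OF P Y r, folded W_def]
  have u: "?u \<in> verts ?Q'" using PD(6,7) by (simp add: del_vert_simps)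
  have dn: "dimv W n = 1" and dW: "x \<noteq> n \<Longrightarrow> dimv W x = dimv Y x" for x by (simp_all add: W_def glue_def)
  have zero: "e x = 0\<^sub>m (dimv W x) (dimv W x)"
    if e: "ishom Q W W e" and en: "e n = 0\<^sub>m 1 1" and x: "x \<in> verts Q" for e x
  proof (cases "x = n")
    case True
    then show ?thesis using en dn by simp
  next
    case False
    then have x': "x \<in> verts ?Q'" using x by (simp add: del_vert_simps)
    have e': "ishom ?Q' Y Y e" using ishom_restrict_rep[OF PD(1) e, of n] unfolding g(2) .
    have eu: "e ?u \<in> carrier_mat (dimv Y ?u) (dimv Y ?u)" by (rule ishomD(1)[OF e' u])
    have re: "r * e ?u = 0\<^sub>m 1 (dimv Y ?u)"
    proof -
      have "e n * r = r * e ?u" using ishomD(4)[OF e PD(4)] unfolding PD(5) g(3) .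
      then show ?thesis unfolding en using r by simp
    qed
    \<comment> \<open>Components of \<open>e\<close> with respect to the summands;
      \<open>B p q\<close> goes from \<open>S q\<close> to \<open>S p\<close>.\<close>
    define B where "B = (\<lambda>p q x. \<pi> p x * (e x * \<iota> q x))"
    have Bh: "ishom ?Q' (S q) (S p) (B p q)" if "p \<in> J" "q \<in> J" for p q
      unfolding B_def
      by (rule ishom_comp[OF PD(10) biproductD(3)[OF b that(2)] Y biproductD(3)[OF b that(1)]
          ishom_comp[OF PD(10) biproductD(3)[OF b that(2)] Y Y biproductD(4)[OF b that(2)] e'] biproductD(5)[OF b that(1)]])
    have Bc: "B p q ?u \<in> carrier_mat 1 1" if "p \<in> J" "q \<in> J" for p q
      using ishomD(1)[OF Bh[OF that] u] d that by simp
    have B0: "B p q ?u $$ (0, 0) = 0" if pq: "p \<in> J" "q \<in> J" for p q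
    proof (cases "p = q")
      case False
      then show ?thesis using off[OF pq(2,1) _ Bh[OF pq]] by simp
    next
      case True
      note iq = biproduct_carriers(1)[OF b u pq(2)]
      \<comment> \<open>The row of ones applied to column \<open>q\<close> of \<open>e\<close>
        leaves the diagonal component, the others being zero at this vertex. By \<open>re\<close>
        the result is also zero.\<close>
      have "r * (e ?u * \<iota> q ?u) = mat_sum 1 (dimv (S q) ?u) (\<lambda>p. ones_mat 1 (dimv (S p) ?u) * B p q ?u) J"
        unfolding r_def B_def by (rule sum_row_mult[OF b u mult_carrier_mat[OF eu iq]])
      also have "\<dots> = ones_mat 1 (dimv (S q) ?u) * B q q ?u"
      proof (rule mat_sum_single)
        show "ones_mat 1 (dimv (S q) ?u) * B q q ?u \<in> carrier_mat 1 (dimv (S q) ?u)"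
          by (rule mult_carrier_mat[OF ones_mat_carrier ishomD(1)[OF Bh[OF pq(2,2)] u]])
        show "ones_mat 1 (dimv (S l) ?u) * B l q ?u = 0\<^sub>m 1 (dimv (S q) ?u)" if l: "l \<in> J" "l \<noteq> q" for l
        proof -
          have "B l q ?u $$ (0, 0) = 0" using off[OF pq(2) l(1) _ Bh[OF l(1) pq(2)]] l(2) by simp
          then have "B l q ?u = 0\<^sub>m 1 1" using Bc[OF l(1) pq(2)] by (intro one_by_one_eqI) simp_all
          then show ?thesis using d[OF l(1)] d[OF pq(2)] by (simp add: ones_mat_1_1[simplified])
        qed
      qed (rule biproductD(1)[OF b], rule pq(2))
      finally have "r * (e ?u * \<iota> q ?u) = B q q ?u"
        unfolding d[OF pq(2)] ones_mat_1_1 left_mult_one_mat[OF Bc[OF pq(2,2)]] .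
      moreover have "r * (e ?u * \<iota> q ?u) = 0\<^sub>m 1 (dimv (S q) ?u)"
        unfolding assoc_mult_mat[OF r eu iq, symmetric] re by (rule left_mult_zero_mat[OF iq])
      ultimately have "B q q ?u = 0\<^sub>m 1 1" unfolding d[OF pq(2)] by simp
      then show ?thesis unfolding True by simp
    qed
    have ex: "e x \<in> carrier_mat (dimv Y x) (dimv Y x)" by (rule ishomD(1)[OF e' x'])
    have "e x * \<iota> q x = 0\<^sub>m (dimv Y x) (dimv (S q) x)" if q: "q \<in> J" for q
    proof -
      note iq = biproduct_carriers(1)[OF b x' q]
      have "e x * \<iota> q x = mat_sum (dimv Y x) (dimv (S q) x) (\<lambda>p. \<iota> p x * B p q x) J"
        unfolding B_def by (rule biproduct_expand_left[OF b x' mult_carrier_mat[OF ex iq]])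
      also have "\<dots> = mat_sum (dimv Y x) (dimv (S q) x) (\<lambda>p. 0\<^sub>m (dimv Y x) (dimv (S q) x)) J"
      proof (rule mat_sum_cong)
        fix p assume p: "p \<in> J"
        show "\<iota> p x * B p q x = 0\<^sub>m (dimv Y x) (dimv (S q) x)"
          unfolding faithful[OF q p Bh[OF p q] B0[OF p q] x']
          by (rule right_mult_zero_mat[OF biproduct_carriers(1)[OF b x' p]])
      qed
      finally show ?thesis unfolding mat_sum_zero .
    qed
    then have "mat_sum (dimv Y x) (dimv Y x) (\<lambda>q. e x * \<iota> q x * \<pi> q x) J = mat_sum (dimv Y x) (dimv Y x) (\<lambda>q. 0\<^sub>m (dimv Y x) (dimv Y x)) J"
      by (intro mat_sum_cong) (simp add: left_mult_zero_mat[OF biproduct_carriers(2)[OF b x']])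
    then have "e x = 0\<^sub>m (dimv Y x) (dimv Y x)"
      using biproduct_expand_right[OF b x' ex] unfolding mat_sum_zero by simp
    then show ?thesis using dW[OF False] by simp
  qed
  have "indecomposable_rep Q W"
  proof (rule indecomposable_repI[OF PD(1) g(1)])
    show "\<not> zero_rep Q W"
    proof
      assume "zero_rep Q W"
      then have "dimv W n = 0" using PD(3) by (simp add: zero_rep_def)
      then show False using dn by simp
    qed
    fix e assume e: "ishom Q W W e" and idem: "\<And>x. x \<in> verts Q \<Longrightarrow> e x * e x = e x"
    have en: "e n \<in> carrier_mat 1 1" using ishomD(1)[OF e PD(3)] dn by simp
    have "e n $$ (0, 0) * e n $$ (0, 0) = e n $$ (0, 0)"
      using one_by_one_mult[OF en en] idem[OF PD(3)] by simp
    then have "e n $$ (0, 0) = 0 \<or> e n $$ (0, 0) = 1" by simp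
    then show "(\<forall>x\<in>verts Q. e x = 0\<^sub>m (dimv W x) (dimv W x)) \<or> (\<forall>x\<in>verts Q. e x = 1\<^sub>m (dimv W x))"
    proof
      assume "e n $$ (0, 0) = 0"
      then have "e n = 0\<^sub>m 1 1" by (intro one_by_one_eqI[OF en]) simp_all
      then show ?thesis using zero[OF e] by simp
    next
      assume one: "e n $$ (0, 0) = 1"
      \<comment> \<open>The complement of \<open>e\<close> vanishes at \<open>n\<close>, hence
        everywhere.\<close>
      let ?f = "\<lambda>x. 1\<^sub>m (dimv W x) + (-1) \<cdot>\<^sub>m e x"
      have f: "ishom Q W W ?f"
        by (rule ishom_add[OF PD(1) g(1) g(1) ishom_id[OF PD(1) g(1)] ishom_smult[OF PD(1) g(1) g(1) e]])
      have fn: "?f n = 0\<^sub>m 1 1"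
        by (rule one_by_one_eqI) (use en one dn in auto)
      have "e x = 1\<^sub>m (dimv W x)" if x: "x \<in> verts Q" for x
      proof (rule eq_matI)
        have ex: "e x \<in> carrier_mat (dimv W x) (dimv W x)" by (rule ishomD(1)[OF e x])
        fix i j assume "i < dim_row (1\<^sub>m (dimv W x) :: complex mat)" "j < dim_col (1\<^sub>m (dimv W x) :: complex mat)"
        then have ij: "i < dimv W x" "j < dimv W x" by simp_all
        have "?f x $$ (i, j) = 0" unfolding zero[OF f fn x] using ij by simp
        then show "e x $$ (i, j) = 1\<^sub>m (dimv W x) $$ (i, j)" using ij ex by (auto split: if_splits)
      qed (use ishomD(2,3)[OF e x] in simp_all)
      then show ?thesis by blast
    qed
  qed
  then show ?thesis by (simp only: W_def r_def)
qed

section \<open>The tangent space of the glued representation\<close>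

text \<open>The elementary matrices \<open>\<iota> w n \<pi> p u\<close>, sending summand \<open>p\<close> to row \<open>w\<close>, span. Those with a
  non-zero morphism from \<open>p\<close> to some summand in row \<open>w\<close> come from endomorphisms, and the sum over
  the summands in any row comes from the base change at \<open>n\<close>; \<open>fill\<close> says these generate.\<close>

lemma glue_tangent_space:
  fixes S :: "'p \<Rightarrow> ('v, 'b) quiver_rep" and Y W :: "'k \<Rightarrow> ('v, 'b) quiver_rep" and s :: "'k \<Rightarrow> nat"
  assumes P: "pendant_arrow Q n a0"
    and b: "biproduct Q X K W \<iota> \<pi>"
    and b': "\<And>w. w \<in> K \<Longrightarrow> biproduct (pre_digraph.del_vert Q n) (Y w) (J w) S (\<iota>' w) (\<pi>' w)"
    and own: "\<And>w p. w \<in> K \<Longrightarrow> p \<in> J w \<Longrightarrow> own p = w"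
    and W: "\<And>w. w \<in> K \<Longrightarrow> W w = glue Q n (s w) (sum_row (tail Q a0) (s w) (Y w) S (\<pi>' w) (J w)) (Y w)"
    and s: "\<And>w. w \<in> K \<Longrightarrow> s w \<le> 1"
    and d: "\<And>w p. w \<in> K \<Longrightarrow> p \<in> J w \<Longrightarrow> dimv (S p) (tail Q a0) \<le> 1"
    and fill: "\<And>(T :: 'k \<Rightarrow> 'p \<Rightarrow> bool) w p.
      (\<And>w p q \<phi>. w \<in> K \<Longrightarrow> s w = 1 \<Longrightarrow> p \<in> (\<Union>w\<in>K. J w) \<Longrightarrow> q \<in> J w \<Longrightarrow>
        dimv (S p) (tail Q a0) = 1 \<Longrightarrow> dimv (S q) (tail Q a0) = 1 \<Longrightarrow>
        ishom (pre_digraph.del_vert Q n) (S p) (S q) \<phi> \<Longrightarrow> \<phi> (tail Q a0) $$ (0, 0) \<noteq> 0 \<Longrightarrow> T w p) \<Longrightarrow>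
      (\<And>w w' p. w \<in> K \<Longrightarrow> w' \<in> K \<Longrightarrow> s w = 1 \<Longrightarrow> s w' = 1 \<Longrightarrow> p \<in> J w' \<Longrightarrow>
        (\<And>q. q \<in> J w' \<Longrightarrow> q \<noteq> p \<Longrightarrow> T w q) \<Longrightarrow> T w p) \<Longrightarrow>
      w \<in> K \<Longrightarrow> s w = 1 \<Longrightarrow> p \<in> (\<Union>w\<in>K. J w) \<Longrightarrow> dimv (S p) (tail Q a0) = 1 \<Longrightarrow> T w p"
    and F: "F \<in> carrier_mat (dimv X n) (dimv X (tail Q a0))"
  shows "\<exists>\<gamma>\<in>carrier_mat (dimv X n) (dimv X n). \<exists>\<kappa>.
    ishom (pre_digraph.del_vert Q n) (restrict_rep Q n X) (restrict_rep Q n X) \<kappa> \<and>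
    F = \<gamma> * maps X a0 + maps X a0 * \<kappa> (tail Q a0)"
proof -
  let ?Q' = "pre_digraph.del_vert Q n" and ?u = "tail Q a0" and ?c = "dimv X n" and ?d = "dimv X (tail Q a0)"
  let ?f = "maps X a0" and ?R = "restrict_rep Q n X" and ?P = "\<Union>w\<in>K. J w"
  note PD = pendant_arrowD[OF P]
  have u: "?u \<in> verts ?Q'" using PD(6,7) by (simp add: del_vert_simps)
  have Yr: "is_rep ?Q' (Y w)" if "w \<in> K" for w by (rule biproductD(2)[OF b'[OF that]])
  define r where "r = (\<lambda>w. sum_row ?u (s w) (Y w) S (\<pi>' w) (J w))"
  have r: "r w \<in> carrier_mat (s w) (dimv (Y w) ?u)" for w by (simp add: r_def)
  have Wg: "restrict_rep Q n (W w) = Y w" "maps (W w) a0 = r w" "dimv (W w) n = s w" if w: "w \<in> K" for w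
    using glue_rep(2,3)[OF P Yr[OF w] r] unfolding W[OF w] r_def by (simp_all add: glue_def)
  have dWu: "dimv (W w) ?u = dimv (Y w) ?u" if w: "w \<in> K" for w
    unfolding W[OF w] using PD(6) by (simp add: glue_def)
  have X: "is_rep Q X" by (rule biproductD(2)[OF b])
  have f: "?f \<in> carrier_mat ?c ?d" using is_repD(1)[OF X PD(4)] unfolding PD(5) .
  have Rr: "is_rep ?Q' ?R" by (rule is_rep_restrict_rep[OF X])
  have dR: "dimv ?R ?u = ?d" using PD(6) by (simp add: restrict_rep_def)
  have bR: "biproduct ?Q' ?R K Y \<iota> \<pi>"
    by (rule biproduct_cong[OF biproduct_restrict_rep[OF b PD(1)]]) (rule Wg(1))
  \<comment> \<open>Structure maps of a single summand \<open>p\<close> in the restriction of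
    \<open>X\<close>, through the row \<open>own p\<close> that contains it.\<close>
  define \<mu> where "\<mu> = (\<lambda>p x. \<iota> (own p) x * \<iota>' (own p) p x)"
  define \<rho> where "\<rho> = (\<lambda>p x. \<pi>' (own p) p x * \<pi> (own p) x)"
  have bn: "biproduct ?Q' ?R ?P S \<mu> \<rho>"
    unfolding \<mu>_def \<rho>_def by (rule biproduct_nest[OF PD(10) bR b' own])
  have \<iota>n: "\<iota> w n \<in> carrier_mat ?c (s w)" "\<pi> w n \<in> carrier_mat (s w) ?c" if w: "w \<in> K" for w
    using biproduct_carriers[OF b PD(3) w] unfolding Wg(3)[OF w] .
  have \<rho>c: "\<mu> p ?u \<in> carrier_mat ?d (dimv (S p) ?u)" "\<rho> p ?u \<in> carrier_mat (dimv (S p) ?u) ?d" if p: "p \<in> ?P" for p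
    using biproduct_carriers[OF bn u p] unfolding dR .
  \<comment> \<open>In these coordinates the column of \<open>f\<close> at a summand is the unit
    vector of its row, and by \<open>\<pi>f\<close> below the row of \<open>f\<close> at
    \<open>w\<close> has a 1 at each summand placed in \<open>w\<close>, up to empty
    matrices.\<close>
  have f\<mu>: "?f * \<mu> p ?u = \<iota> w n * ones_mat (s w) (dimv (S p) ?u)" if w: "w \<in> K" and p: "p \<in> J w" for w p
  proof -
    have iu: "\<iota> w ?u \<in> carrier_mat ?d (dimv (Y w) ?u)" "\<iota>' w p ?u \<in> carrier_mat (dimv (Y w) ?u) (dimv (S p) ?u)"
      using biproduct_carriers(1)[OF b PD(7) w] biproduct_carriers(1)[OF b'[OF w] u p] unfolding dWu[OF w] .
    have com: "\<iota> w n * r w = ?f * \<iota> w ?u"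
      using ishomD(4)[OF biproductD(4)[OF b w] PD(4)] unfolding PD(5) Wg(2)[OF w] .
    have "?f * \<mu> p ?u = ?f * \<iota> w ?u * \<iota>' w p ?u"
      unfolding \<mu>_def own[OF w p] by (rule assoc_mult_mat[OF f iu, symmetric])
    also have "\<dots> = \<iota> w n * (r w * \<iota>' w p ?u)"
      unfolding com[symmetric] by (rule assoc_mult_mat[OF \<iota>n(1)[OF w] r iu(2)])
    finally show ?thesis unfolding r_def sum_row_iota[OF b'[OF w] u p] .
  qed
  have \<pi>f: "\<pi> w n * ?f = mat_sum (s w) ?d (\<lambda>p. ones_mat (s w) (dimv (S p) ?u) * \<rho> p ?u) (J w)" if w: "w \<in> K" for w
  proof -
    have pu: "\<pi> w ?u \<in> carrier_mat (dimv (Y w) ?u) ?d"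
      using biproduct_carriers(2)[OF b PD(7) w] unfolding dWu[OF w] .
    have "\<pi> w n * ?f = r w * \<pi> w ?u"
      using ishomD(4)[OF biproductD(5)[OF b w] PD(4)] unfolding PD(5) Wg(2)[OF w] .
    also have "\<dots> = mat_sum (s w) ?d (\<lambda>p. ones_mat (s w) (dimv (S p) ?u) * (\<pi>' w p ?u * \<pi> w ?u)) (J w)"
      unfolding r_def by (rule sum_row_mult[OF b'[OF w] u pu])
    also have "\<dots> = mat_sum (s w) ?d (\<lambda>p. ones_mat (s w) (dimv (S p) ?u) * \<rho> p ?u) (J w)"
      by (rule mat_sum_cong) (simp add: \<rho>_def own[OF w])
    finally show ?thesis .
  qed
  \<comment> \<open>The attainable directions. They form a linear subspace, so it suffices to reach
    a spanning set.\<close>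
  define T where "T = (\<lambda>F. F \<in> carrier_mat ?c ?d \<and> (\<exists>\<gamma>\<in>carrier_mat ?c ?c. \<exists>\<kappa>. ishom ?Q' ?R ?R \<kappa> \<and> F = \<gamma> * ?f + ?f * \<kappa> ?u))"
  have TI: "T F" if "F = \<gamma> * ?f + ?f * \<kappa> ?u" "\<gamma> \<in> carrier_mat ?c ?c" "ishom ?Q' ?R ?R \<kappa>" for F \<gamma> \<kappa>
  proof -
    have ku: "\<kappa> ?u \<in> carrier_mat ?d ?d" using ishomD(1)[OF that(3) u] unfolding dR .
    have "F \<in> carrier_mat ?c ?d" unfolding that(1)
      by (rule add_carrier_mat[OF mult_carrier_mat[OF f ku]])
    then show ?thesis unfolding T_def using that by blast
  qed
  have T_carrier: "F \<in> carrier_mat ?c ?d" if "T F" for F using that by (simp add: T_def)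
  have zero_hom: "ishom ?Q' ?R ?R (\<lambda>x. 0\<^sub>m (dimv ?R x) (dimv ?R x))"
    using ishom_mat_sum[OF PD(10) Rr Rr, of "{}"] by simp
  have T_lin: "T (z \<cdot>\<^sub>m F + G)" if TF: "T F" and TG: "T G" for F G z
  proof -
    obtain \<gamma> \<kappa> where 1: "\<gamma> \<in> carrier_mat ?c ?c" "ishom ?Q' ?R ?R \<kappa>" "F = \<gamma> * ?f + ?f * \<kappa> ?u"
      using TF unfolding T_def by (elim conjE bexE exE)
    obtain \<gamma>' \<kappa>' where 2: "\<gamma>' \<in> carrier_mat ?c ?c" "ishom ?Q' ?R ?R \<kappa>'" "G = \<gamma>' * ?f + ?f * \<kappa>' ?u"
      using TG unfolding T_def by (elim conjE bexE exE)
    have k: "\<kappa> ?u \<in> carrier_mat ?d ?d" "\<kappa>' ?u \<in> carrier_mat ?d ?d"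
      using ishomD(1)[OF 1(2) u] ishomD(1)[OF 2(2) u] unfolding dR .
    show ?thesis
    proof (rule TI[of _ "z \<cdot>\<^sub>m \<gamma> + \<gamma>'" "\<lambda>x. z \<cdot>\<^sub>m \<kappa> x + \<kappa>' x"])
      show "ishom ?Q' ?R ?R (\<lambda>x. z \<cdot>\<^sub>m \<kappa> x + \<kappa>' x)"
        by (rule ishom_add[OF PD(10) Rr Rr ishom_smult[OF PD(10) Rr Rr 1(2)] 2(2)])
      show "z \<cdot>\<^sub>m \<gamma> + \<gamma>' \<in> carrier_mat ?c ?c" using 2(1) by simp
      have "z \<cdot>\<^sub>m (A + B) + (C + D) = (z \<cdot>\<^sub>m A + C) + (z \<cdot>\<^sub>m B + D)"
        if "A \<in> carrier_mat ?c ?d" "B \<in> carrier_mat ?c ?d" "C \<in> carrier_mat ?c ?d" "D \<in> carrier_mat ?c ?d"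
        for A B C D :: "complex mat"
        using that by (intro eq_matI) (auto simp: algebra_simps)
      note lin = this[OF mult_carrier_mat[OF 1(1) f] mult_carrier_mat[OF f k(1)] mult_carrier_mat[OF 2(1) f] mult_carrier_mat[OF f k(2)]]
      show "z \<cdot>\<^sub>m F + G = (z \<cdot>\<^sub>m \<gamma> + \<gamma>') * ?f + ?f * (z \<cdot>\<^sub>m \<kappa> ?u + \<kappa>' ?u)"
        unfolding 1(3) 2(3) lin add_mult_distrib_mat[OF smult_carrier_mat[OF 1(1)] 2(1) f]
          mult_add_distrib_mat[OF f smult_carrier_mat[OF k(1)] k(2)] mult_smult_assoc_mat[OF 1(1) f] mult_smult_distrib[OF f k(1)] ..
    qed
  qed
  have T_zero: "T (0\<^sub>m ?c ?d)"
    by (rule TI[OF _ zero_carrier_mat zero_hom]) (use f dR in simp)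
  have T_smult: "T (z \<cdot>\<^sub>m F)" if TF: "T F" for F z
    using T_lin[OF TF T_zero, of z] right_add_zero_mat[OF smult_carrier_mat[OF T_carrier[OF TF]]] by simp
  have T_sum: "T (mat_sum ?c ?d g I)" if "finite I" "\<And>k. k \<in> I \<Longrightarrow> T (g k)" for g and I :: "'i set"
    using that
  proof (induction I)
    case empty
    show ?case using T_zero by simp
  next
    case (insert k I)
    have gk: "T (g k)" and gI: "T (mat_sum ?c ?d g I)" using insert by simp_all
    have "mat_sum ?c ?d g (insert k I) = 1 \<cdot>\<^sub>m g k + mat_sum ?c ?d g I"
      using mat_sum_insert[of I k g ?c ?d] insert(1,2) T_carrier[OF gk] by simp
    then show ?case using T_lin[OF gk gI, of 1] by simp
  qed
  \<comment> \<open>The elementary matrix at row \<open>w\<close> and column \<open>p\<close>. It is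
    zero if row \<open>w\<close> has no copy of \<open>S_n\<close> or if \<open>p\<close> vanishes
    at the vertex.\<close>
  define E where "E = (\<lambda>w p. \<iota> w n * (ones_mat (s w) (dimv (S p) ?u) * \<rho> p ?u))"
  have op: "ones_mat (s w) (dimv (S p) ?u) * \<rho> p ?u \<in> carrier_mat (s w) ?d" if "p \<in> ?P" for w p
    by (rule mult_carrier_mat[OF ones_mat_carrier \<rho>c(2)[OF that]])
  have Ec: "E w p \<in> carrier_mat ?c ?d" if "w \<in> K" "p \<in> ?P" for w p
    unfolding E_def by (rule mult_carrier_mat[OF \<iota>n(1)[OF that(1)] op[OF that(2)]])
  have fin: "finite K" "finite ?P" using biproductD(1)[OF b] biproductD(1)[OF bn] .
  have E1: "T (E w p)" if w: "w \<in> K" "s w = 1" and p: "p \<in> ?P" "dimv (S p) ?u = 1" for w p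
  proof (rule fill[of "\<lambda>w p. T (E w p)", OF _ _ w p])
    fix w p q \<phi>
    assume w: "w \<in> K" "s w = 1" and p: "p \<in> ?P" and q: "q \<in> J w" and dp: "dimv (S p) ?u = 1" and dq: "dimv (S q) ?u = 1"
      and \<phi>: "ishom ?Q' (S p) (S q) \<phi>" "\<phi> ?u $$ (0, 0) \<noteq> 0"
    have qP: "q \<in> ?P" using w(1) q by blast
    define z where "z = \<phi> ?u $$ (0, 0)"
    have \<phi>u: "\<phi> ?u = z \<cdot>\<^sub>m 1\<^sub>m 1"
      using ishomD(1)[OF \<phi>(1) u] unfolding dp dq by (intro one_by_one_eqI) (simp_all add: z_def)
    \<comment> \<open>The endomorphism that sends summand \<open>p\<close> through
      \<open>\<phi>\<close> into \<open>q\<close> and all other summands to 0;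
      \<open>f \<kappa>\<close> then carries the 1 at \<open>(w, q)\<close> to
      \<open>(w, p)\<close>, up to the scalar \<open>z\<close>.\<close>
    define \<kappa> where "\<kappa> = (\<lambda>x. \<mu> q x * (\<phi> x * \<rho> p x))"
    have \<kappa>: "ishom ?Q' ?R ?R \<kappa>" unfolding \<kappa>_def
      by (rule ishom_comp[OF PD(10) Rr biproductD(3)[OF bn qP] Rr
          ishom_comp[OF PD(10) Rr biproductD(3)[OF bn p] biproductD(3)[OF bn qP] biproductD(5)[OF bn p] \<phi>(1)] biproductD(4)[OF bn qP]])
    note c = \<rho>c(1)[OF qP, unfolded dq] \<rho>c(2)[OF p, unfolded dp] \<iota>n(1)[OF w(1), unfolded w(2)]
    have 1: "\<phi> ?u * \<rho> p ?u = z \<cdot>\<^sub>m \<rho> p ?u"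
      unfolding \<phi>u mult_smult_assoc_mat[OF one_carrier_mat c(2)] left_mult_one_mat[OF c(2)] ..
    have 2: "?f * \<mu> q ?u = \<iota> w n"
      unfolding f\<mu>[OF w(1) q] w(2) dq ones_mat_1_1 by (rule right_mult_one_mat[OF c(3)])
    have "?f * \<kappa> ?u = ?f * \<mu> q ?u * (z \<cdot>\<^sub>m \<rho> p ?u)"
      unfolding \<kappa>_def 1 by (rule assoc_mult_mat[OF f c(1) smult_carrier_mat[OF c(2)], symmetric])
    also have "\<dots> = z \<cdot>\<^sub>m (\<iota> w n * \<rho> p ?u)" unfolding 2 by (rule mult_smult_distrib[OF c(3,2)])
    finally have fk: "?f * \<kappa> ?u = z \<cdot>\<^sub>m (\<iota> w n * \<rho> p ?u)" .
    have "T (z \<cdot>\<^sub>m (\<iota> w n * \<rho> p ?u))"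
    proof (rule TI[OF _ zero_carrier_mat \<kappa>])
      show "z \<cdot>\<^sub>m (\<iota> w n * \<rho> p ?u) = 0\<^sub>m ?c ?c * ?f + ?f * \<kappa> ?u"
        unfolding fk left_mult_zero_mat[OF f]
        by (rule left_add_zero_mat[OF smult_carrier_mat[OF mult_carrier_mat[OF c(3,2)]], symmetric])
    qed
    from T_smult[OF this, of "1 / z"] have "T ((1 / z) \<cdot>\<^sub>m (z \<cdot>\<^sub>m (\<iota> w n * \<rho> p ?u)))" .
    moreover have "(1 / z) \<cdot>\<^sub>m (z \<cdot>\<^sub>m (\<iota> w n * \<rho> p ?u)) = \<iota> w n * \<rho> p ?u"
      using \<phi>(2) by (intro eq_matI) (auto simp: z_def)
    moreover have "E w p = \<iota> w n * \<rho> p ?u"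
      unfolding E_def w(2) dp ones_mat_1_1 left_mult_one_mat[OF c(2)] ..
    ultimately show "T (E w p)" by simp
  next
    fix w w' p
    assume w: "w \<in> K" "s w = 1" and w': "w' \<in> K" "s w' = 1" and p: "p \<in> J w'"
      and rest: "\<And>q. q \<in> J w' \<Longrightarrow> q \<noteq> p \<Longrightarrow> T (E w q)"
    note i = \<iota>n(1)[OF w(1), unfolded w(2)] and pn = \<iota>n(2)[OF w'(1), unfolded w'(2)]
    have JP: "q \<in> ?P" if "q \<in> J w'" for q using that w'(1) by blast
    \<comment> \<open>The change of basis \<open>\<iota> w n * \<pi> w' n\<close> at
      \<open>n\<close> copies row \<open>w'\<close> of \<open>f\<close> into row \<open>w\<close>,
      which gives the sum of the elementary matrices over all summands in \<open>w'\<close>. All of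
      them except the one for \<open>p\<close> are attainable already.\<close>
    have "\<iota> w n * \<pi> w' n * ?f = \<iota> w n * (\<pi> w' n * ?f)" by (rule assoc_mult_mat[OF i pn f])
    also have "\<dots> = mat_sum ?c ?d (\<lambda>p. \<iota> w n * (ones_mat 1 (dimv (S p) ?u) * \<rho> p ?u)) (J w')"
      unfolding \<pi>f[OF w'(1)] w'(2) by (rule mult_mat_sum[OF i mult_carrier_mat[OF ones_mat_carrier \<rho>c(2)[OF JP]]])
    also have "\<dots> = mat_sum ?c ?d (E w) (J w')" unfolding E_def w(2) ..
    finally have gf: "\<iota> w n * \<pi> w' n * ?f = mat_sum ?c ?d (E w) (J w')" .
    have Tall: "T (mat_sum ?c ?d (E w) (J w'))"
    proof (rule TI[OF _ mult_carrier_mat[OF i pn] zero_hom])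
      show "mat_sum ?c ?d (E w) (J w') = \<iota> w n * \<pi> w' n * ?f + ?f * 0\<^sub>m (dimv ?R ?u) (dimv ?R ?u)"
        unfolding gf dR right_mult_zero_mat[OF f] by (rule right_add_zero_mat[OF mat_sum_carrier, symmetric])
    qed
    have finJ: "finite (J w')" by (rule biproductD(1)[OF b'[OF w'(1)]])
    have Trest: "T (mat_sum ?c ?d (E w) (J w' - {p}))"
      by (rule T_sum) (use finJ rest in auto)
    have "J w' = insert p (J w' - {p})" using p by blast
    then have split: "mat_sum ?c ?d (E w) (J w') = E w p + mat_sum ?c ?d (E w) (J w' - {p})"
      using mat_sum_insert[of "J w' - {p}" p "E w" ?c ?d] finJ Ec[OF w(1) JP[OF p]] by simp
    have "(-1) \<cdot>\<^sub>m B + (A + B) = A" if "A \<in> carrier_mat ?c ?d" "B \<in> carrier_mat ?c ?d" for A B :: "complex mat"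
      using that by (intro eq_matI) auto
    from this[OF Ec[OF w(1) JP[OF p]] mat_sum_carrier]
    have "(-1) \<cdot>\<^sub>m mat_sum ?c ?d (E w) (J w' - {p}) + mat_sum ?c ?d (E w) (J w') = E w p" unfolding split .
    then show "T (E w p)" using T_lin[OF Trest Tall, of "-1"] by simp
  qed
  have TE: "T (E w p)" if w: "w \<in> K" and p: "p \<in> ?P" for w p
  proof -
    obtain v where v: "v \<in> K" "p \<in> J v" using p by blast
    consider "s w = 1" "dimv (S p) ?u = 1" | "s w = 0" | "dimv (S p) ?u = 0"
      using s[OF w] d[OF v] by linarith
    then show ?thesis
    proof cases
      case 1
      then show ?thesis using E1 w p by simp
    next
      case 2
      have "E w p = 0\<^sub>m ?c ?d" unfolding E_def
        by (rule mult_mat_zero_dim) (use \<iota>n(1)[OF w] op[OF p, of w] 2 in simp_all)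
      then show ?thesis using T_zero by simp
    next
      case 3
      have "ones_mat (s w) (dimv (S p) ?u) * \<rho> p ?u = 0\<^sub>m (s w) ?d"
        by (rule mult_mat_zero_dim) (use \<rho>c(2)[OF p] ones_mat_carrier[of "s w" 0] 3 in simp_all)
      then have "E w p = 0\<^sub>m ?c ?d" unfolding E_def using \<iota>n(1)[OF w] by simp
      then show ?thesis using T_zero by simp
    qed
  qed
  have "T (\<iota> w n * (\<pi> w n * F))" if w: "w \<in> K" for w
  proof -
    define G where "G = \<pi> w n * F"
    have G: "G \<in> carrier_mat (s w) ?d" unfolding G_def by (rule mult_carrier_mat[OF \<iota>n(2)[OF w] F])
    have G': "G \<in> carrier_mat (s w) (dimv ?R ?u)" using G unfolding dR .
    have Gm: "G * \<mu> p ?u * \<rho> p ?u \<in> carrier_mat (s w) ?d" if "p \<in> ?P" for p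
      by (rule mult_carrier_mat[OF mult_carrier_mat[OF G \<rho>c(1)[OF that]] \<rho>c(2)[OF that]])
    have "\<iota> w n * G = \<iota> w n * mat_sum (s w) ?d (\<lambda>p. G * \<mu> p ?u * \<rho> p ?u) ?P"
      using biproduct_expand_right[OF bn u G'] unfolding dR by simp
    also have "\<dots> = mat_sum ?c ?d (\<lambda>p. \<iota> w n * (G * \<mu> p ?u * \<rho> p ?u)) ?P"
      by (rule mult_mat_sum[OF \<iota>n(1)[OF w] Gm])
    also have "T \<dots>"
    proof (rule T_sum[OF fin(2)])
      fix p assume p: "p \<in> ?P"
      obtain v where v: "v \<in> K" "p \<in> J v" using p by blast
      define z where "z = (G * \<mu> p ?u) $$ (0, 0)"
      have "G * \<mu> p ?u = z \<cdot>\<^sub>m ones_mat (s w) (dimv (S p) ?u)"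
        unfolding z_def by (rule small_mat_scaled_ones[OF mult_carrier_mat[OF G \<rho>c(1)[OF p]] s[OF w] d[OF v]])
      then have "\<iota> w n * (G * \<mu> p ?u * \<rho> p ?u) = z \<cdot>\<^sub>m E w p"
        unfolding E_def by (simp only: mult_smult_assoc_mat[OF ones_mat_carrier \<rho>c(2)[OF p]] mult_smult_distrib[OF \<iota>n(1)[OF w] op[OF p]])
      then show "T (\<iota> w n * (G * \<mu> p ?u * \<rho> p ?u))" using T_smult[OF TE[OF w p]] by simp
    qed
    finally show ?thesis unfolding G_def .
  qed
  then have "T (mat_sum ?c ?d (\<lambda>w. \<iota> w n * (\<pi> w n * F)) K)" by (rule T_sum[OF fin(1)])
  then have "T F" using biproduct_expand_left[OF b PD(3) F] by simp
  then show ?thesis unfolding T_def by blast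
qed

section \<open>The algorithm\<close>

text \<open>The edges other than \<open>{2, n}\<close> are the sets \<open>{i, i + 1}\<close> with
  \<open>i < n - 1\<close>, including both remaining edges at 2. Bijectivity onto the edge set
  excludes a second arrow at \<open>n\<close> and gives one arrow \<open>e i\<close> for each of
  them.\<close>

lemma type_D_structure:
  assumes n: "n \<ge> 4" and D: "type_D_quiver n Q" and a2n: "2 \<rightarrow>\<^bsub>Q\<^esub> n"
  obtains a0 e where "pendant_arrow Q n a0" "tail Q a0 = 2" "chain_quiver (n - 1) (pre_digraph.del_vert Q n) e"
proof -
  have fin: "fin_digraph Q" and V: "verts Q = {1..n}"
    and bij: "bij_betw (\<lambda>a. {tail Q a, head Q a}) (arcs Q) (D_edges n)"
    using D by (auto simp: type_D_quiver_def)
  interpret fin_digraph Q by fact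
  let ?E = "\<lambda>a. {tail Q a, head Q a}"
  have inj: "a = a'" if "a \<in> arcs Q" "a' \<in> arcs Q" "?E a = ?E a'" for a a'
    by (rule inj_onD[OF bij_betw_imp_inj_on[OF bij] that(3) that(1,2)])
  have img: "?E a \<in> D_edges n" if "a \<in> arcs Q" for a by (rule bij_betwE[OF bij, rule_format, OF that])
  have "(2, n) \<in> arc_to_ends Q ` arcs Q" using a2n by (simp add: arcs_ends_def)
  then obtain a0 where a0: "(2, n) = arc_to_ends Q a0" "a0 \<in> arcs Q" by (rule imageE)
  then have th: "tail Q a0 = 2" "head Q a0 = n" by (simp_all add: arc_to_ends_def)
  have edges: "E = {2, n} \<or> (\<exists>i\<in>{1..<n - 1}. E = {i, Suc i})" if "E \<in> D_edges n" for E
  proof -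
    have "E = {2, 1} \<or> E = {2, 3} \<or> E = {2, n} \<or> (\<exists>i. E = {i, i + 1} \<and> 3 \<le> i \<and> i + 1 \<le> n - 1)"
      using that unfolding D_edges_def by simp
    then show ?thesis
    proof (elim disjE exE conjE)
      assume "E = {2, 1}"
      then have "E = {1, Suc 1}" by (simp add: insert_commute numeral_2_eq_2)
      then show ?thesis by (intro disjI2 bexI[of _ 1]) (use n in simp_all)
    next
      assume "E = {2, 3}"
      then have "E = {2, Suc 2}" by simp
      then show ?thesis by (intro disjI2 bexI[of _ 2]) (use n in simp_all)
    next
      fix i assume "E = {i, i + 1}" "3 \<le> i" "i + 1 \<le> n - 1"
      then show ?thesis by (intro disjI2 bexI[of _ i]) simp_all
    qed simp
  qed
  have other: "head Q a \<noteq> n \<and> tail Q a \<noteq> n" if a: "a \<in> arcs Q" "a \<noteq> a0" for a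
  proof (rule ccontr)
    assume "\<not> (head Q a \<noteq> n \<and> tail Q a \<noteq> n)"
    then have nE: "n \<in> ?E a" by auto
    have "?E a \<noteq> {i, Suc i}" if "i \<in> {1..<n - 1}" for i
    proof
      assume "?E a = {i, Suc i}"
      then have "n \<in> {i, Suc i}" using nE by (simp only:)
      then show False using that by simp linarith
    qed
    then have "\<not> (\<exists>i\<in>{1..<n - 1}. ?E a = {i, Suc i})" by blast
    then have "?E a = {2, n}" using edges[OF img[OF a(1)]] by (simp only: disj_not1 simp_thms)
    then have "?E a = ?E a0" using th by simp
    then show False using inj[OF a(1) a0(2)] a(2) by simp
  qed
  have pend: "pendant_arrow Q n a0"
    unfolding pendant_arrow_def using fin V a0(2) th other n by auto
  note PD = pendant_arrowD[OF pend]
  have surj: "\<exists>a. a \<in> arcs Q \<and> ?E a = {i, Suc i}" if i: "i \<in> {1..<n - 1}" for i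
  proof -
    have "{i, Suc i} \<in> D_edges n"
    proof -
      have "i = 1 \<or> i = 2 \<or> i \<ge> 3" using i by auto
      then show ?thesis
      proof (elim disjE)
        assume "i = 1"
        then have "{i, Suc i} = {2, 1}" by (simp add: insert_commute numeral_2_eq_2)
        then show ?thesis by (simp add: D_edges_def)
      next
        assume "i = 2"
        then have "{i, Suc i} = {2, 3}" by simp
        then show ?thesis by (simp add: D_edges_def)
      next
        assume "i \<ge> 3"
        then have "{i, Suc i} \<in> {{i, i + 1} | i. 3 \<le> i \<and> i + 1 \<le> n - 1}"
          using i by (intro CollectI exI[of _ i]) simp
        then show ?thesis unfolding D_edges_def by (rule UnI2)
      qed
    qed
    then have "{i, Suc i} \<in> ?E ` arcs Q" using bij unfolding bij_betw_def by simp
    then obtain a where "{i, Suc i} = ?E a" "a \<in> arcs Q" by (rule imageE)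
    then show ?thesis by (intro exI[of _ a]) simp
  qed
  have "\<forall>i\<in>{1..<n - 1}. \<exists>a. a \<in> arcs Q \<and> ?E a = {i, Suc i}" by (rule ballI, rule surj)
  from bchoice[OF this] obtain e where e': "\<forall>i\<in>{1..<n - 1}. e i \<in> arcs Q \<and> ?E (e i) = {i, Suc i}" by (elim exE)
  have e: "e i \<in> arcs Q \<and> ?E (e i) = {i, Suc i}" if "i \<in> {1..<n - 1}" for i
    by (rule bspec[OF e' that])
  have arcs': "arcs (pre_digraph.del_vert Q n) = e ` {1..<n - 1}"
  proof (intro equalityI subsetI)
    fix a assume "a \<in> arcs (pre_digraph.del_vert Q n)"
    then have a: "a \<in> arcs Q" "a \<noteq> a0" using PD(8) by auto
    have "n \<notin> ?E a" using other[OF a] by simp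
    have "?E a \<noteq> {2, n}"
    proof
      assume "?E a = {2, n}"
      then have "n \<in> ?E a" by (simp only:) simp
      then show False using \<open>n \<notin> ?E a\<close> by contradiction
    qed
    then have "\<exists>i\<in>{1..<n - 1}. ?E a = {i, Suc i}" using edges[OF img[OF a(1)]] by (simp only: simp_thms)
    then obtain i where i: "i \<in> {1..<n - 1}" "?E a = {i, Suc i}" by (elim bexE)
    have "a = e i"
      by (rule inj[OF a(1) conjunct1[OF e[OF i(1)]] trans[OF i(2) conjunct2[OF e[OF i(1)], symmetric]]])
    then show "a \<in> e ` {1..<n - 1}" using i(1) by (rule image_eqI)
  next
    fix a assume "a \<in> e ` {1..<n - 1}"
    then obtain i where i: "a = e i" "i \<in> {1..<n - 1}" by (rule imageE)
    have "n \<notin> {i, Suc i}" using i(2) by simp linarith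
    then have "n \<notin> ?E a" unfolding i(1) conjunct2[OF e[OF i(2)]] .
    then show "a \<in> arcs (pre_digraph.del_vert Q n)" using conjunct1[OF e[OF i(2)]] unfolding i(1) by (simp add: del_vert_simps)
  qed
  have orient: "tail Q (e i) = i \<and> head Q (e i) = Suc i \<or> tail Q (e i) = Suc i \<and> head Q (e i) = i"
    if "i \<in> {1..<n - 1}" for i
    using conjunct2[OF e[OF that]] unfolding doubleton_eq_iff .
  have verts': "verts (pre_digraph.del_vert Q n) = {1..n - 1}"
    unfolding del_vert_simps V using n by auto
  have "chain_quiver (n - 1) (pre_digraph.del_vert Q n) e"
    unfolding chain_quiver_def
  proof (intro conjI ballI)
    fix i assume "i \<in> {1..<n - 1}"
    from orient[OF this] show "tail (pre_digraph.del_vert Q n) (e i) = i \<and> head (pre_digraph.del_vert Q n) (e i) = Suc i \<or>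
      tail (pre_digraph.del_vert Q n) (e i) = Suc i \<and> head (pre_digraph.del_vert Q n) (e i) = i"
      by (simp add: del_vert_simps)
  qed (rule PD(10), rule verts', rule arcs')
  then show ?thesis by (rule that[OF pend th(1)])
qed

text \<open>Positions in \<open>ys\<close> serve as labels, so that both sides are biproducts of one
  family over the same index set even if summands repeat.\<close>

lemma direct_sum_permute:
  assumes wf: "wf_digraph Q" and ms: "mset xs = mset ys" and r: "\<And>X. X \<in> set ys \<Longrightarrow> is_rep Q X"
  shows "\<exists>\<phi> \<psi>. isom Q (direct_sum Q xs) (direct_sum Q ys) \<phi> \<psi>"
proof -
  obtain p where p: "p permutes {..<length ys}" "permute_list p ys = xs"
    using mset_eq_permutation[OF ms] by blast
  let ?is = "[0..<length ys]" and ?ps = "map p [0..<length ys]"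
  have xs: "map ((!) ys) ?ps = xs" using p(2) by (simp add: permute_list_def o_def)
  have ys: "map ((!) ys) ?is = ys" by (rule map_nth)
  have set: "set ?ps = set ?is" using permutes_image[OF p(1)] by (simp add: atLeast0LessThan)
  have dist: "distinct ?ps" using permutes_inj_on[OF p(1)] by (simp add: distinct_map)
  have "\<exists>\<iota> \<pi>. biproduct Q (direct_sum Q (map ((!) ys) ?is)) (set ?is) ((!) ys) \<iota> \<pi>"
    by (rule direct_sum_biproduct[OF wf]) (simp, rule r, simp)
  moreover have "\<exists>\<iota> \<pi>. biproduct Q (direct_sum Q (map ((!) ys) ?ps)) (set ?ps) ((!) ys) \<iota> \<pi>"
  proof (rule direct_sum_biproduct[OF wf dist])
    fix k assume "k \<in> set ?ps"
    then have "k < length ys" unfolding set by simp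
    then show "is_rep Q (ys ! k)" by (intro r) simp
  qed
  ultimately show ?thesis
    unfolding xs ys set using isom_of_biproducts[OF wf] by (elim exE) (intro exI)
qed

lemma mset_filter_trichotomy:
  assumes "\<And>x. x \<in> set xs \<Longrightarrow> (P x \<and> \<not> P' x \<and> \<not> P'' x) \<or> (\<not> P x \<and> P' x \<and> \<not> P'' x) \<or> (\<not> P x \<and> \<not> P' x \<and> P'' x)"
  shows "filter_mset P (mset xs) + filter_mset P' (mset xs) + filter_mset P'' (mset xs) = mset xs"
  using assms
proof (induction xs)
  case (Cons x xs)
  have "filter_mset P (mset xs) + filter_mset P' (mset xs) + filter_mset P'' (mset xs) = mset xs"
    by (rule Cons.IH) (rule Cons.prems, simp)
  then show ?case using Cons.prems[of x] by auto
qed simp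

text \<open>The summands \<open>Zslot\<close>, \<open>Aslot\<close>, \<open>Bslot\<close> and the rows of the algorithm; a summand that is not
  placed in a row is a row by itself, without a copy of \<open>S\<^sub>n\<close>.\<close>

datatype slot = Zslot nat | Aslot nat | Bslot nat | Row nat

definition slot_rep :: "('v, 'b) quiver_rep list \<Rightarrow> ('v, 'b) quiver_rep list \<Rightarrow> ('v, 'b) quiver_rep list \<Rightarrow>
    slot \<Rightarrow> ('v, 'b) quiver_rep" where
  "slot_rep Zs As Bs p = (case p of Zslot k \<Rightarrow> Zs ! k | Aslot i \<Rightarrow> As ! i | Bslot j \<Rightarrow> Bs ! j | Row i \<Rightarrow> undefined)"

text \<open>Slots count from 0 and rows from 1: row \<open>i\<close> holds the A at position
  \<open>i - 1\<close> and the B at position \<open>c - i\<close>. A slot that is not placed forms a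
  row of its own.\<close>

definition row_slots :: "nat \<Rightarrow> nat \<Rightarrow> nat \<Rightarrow> slot \<Rightarrow> slot list" where
  "row_slots M c t w = (case w of
     Row i \<Rightarrow> (if i \<le> M then [Aslot (i - 1)] else []) @ (if c + 1 - i \<le> t then [Bslot (c - i)] else []) | _ \<Rightarrow> [w])"

text \<open>Serves as \<open>own\<close> in \<open>biproduct_nest\<close>: it undoes
  \<open>row_slots\<close>, with \<open>Aslot i\<close> in row \<open>i + 1\<close> and
  \<open>Bslot j\<close> in row \<open>c - j\<close>.\<close>

definition slot_row :: "nat \<Rightarrow> nat \<Rightarrow> slot \<Rightarrow> slot" where
  "slot_row c t p = (case p of Aslot i \<Rightarrow> if i < c then Row (i + 1) else p | Bslot j \<Rightarrow> if j < t then Row (c - j) else p | _ \<Rightarrow> p)"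

text \<open>Listed in the order in which \<open>algorithm_output\<close> adds its four
  multisets.\<close>

definition all_rows :: "nat \<Rightarrow> nat \<Rightarrow> nat \<Rightarrow> nat \<Rightarrow> nat \<Rightarrow> slot list" where
  "all_rows k M N c t = map Zslot [0..<k] @ map Aslot [c..<M] @ map Bslot [t..<N] @ map Row [1..<c + 1]"

definition all_slots :: "nat \<Rightarrow> nat \<Rightarrow> nat \<Rightarrow> slot list" where
  "all_slots k M N = map Zslot [0..<k] @ map Aslot [0..<M] @ map Bslot [0..<N]"

lemma distinct_all_rows: "distinct (all_rows k M N c t)"
  by (auto simp: all_rows_def distinct_map inj_on_def)

lemma distinct_all_slots: "distinct (all_slots k M N)"
  by (auto simp: all_slots_def distinct_map inj_on_def)

lemma distinct_row_slots: "distinct (row_slots M c t w)"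
  by (cases w) (auto simp: row_slots_def)

lemma map_slot_rep_all_slots: "map (slot_rep Zs As Bs) (all_slots (length Zs) (length As) (length Bs)) = Zs @ As @ Bs"
  by (simp add: all_slots_def slot_rep_def o_def map_nth)

lemma in_all_rows:
  "w \<in> set (all_rows k M N c t) \<longleftrightarrow> (case w of Zslot i \<Rightarrow> i < k | Aslot i \<Rightarrow> c \<le> i \<and> i < M | Bslot j \<Rightarrow> t \<le> j \<and> j < N
     | Row i \<Rightarrow> 1 \<le> i \<and> i \<le> c)"
  by (cases w) (auto simp: all_rows_def)

lemma in_all_slots:
  "p \<in> set (all_slots k M N) \<longleftrightarrow> (case p of Zslot i \<Rightarrow> i < k | Aslot i \<Rightarrow> i < M | Bslot j \<Rightarrow> j < N | Row i \<Rightarrow> False)"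
  by (cases p) (auto simp: all_slots_def)

lemma slot_row_row_slots:
  assumes "w \<in> set (all_rows k M N c t)" "p \<in> set (row_slots M c t w)" "t \<le> c"
  shows "slot_row c t p = w"
  using assms by (cases w rule: slot.exhaust) (auto simp: in_all_rows row_slots_def slot_row_def split: if_splits)

lemma union_row_slots:
  assumes "t \<le> c" "t \<le> N"
  shows "(\<Union>w\<in>set (all_rows k M N c t). set (row_slots M c t w)) = set (all_slots k M N)"
proof (intro equalityI subsetI)
  fix p assume "p \<in> (\<Union>w\<in>set (all_rows k M N c t). set (row_slots M c t w))"
  then obtain w where "w \<in> set (all_rows k M N c t)" "p \<in> set (row_slots M c t w)" by (rule UN_E)
  then show "p \<in> set (all_slots k M N)"
    using assms by (cases w rule: slot.exhaust) (auto simp: in_all_rows in_all_slots row_slots_def split: if_splits)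
next
  fix p assume p: "p \<in> set (all_slots k M N)"
  have "slot_row c t p \<in> set (all_rows k M N c t)" "p \<in> set (row_slots M c t (slot_row c t p))"
    using p assms by (cases p rule: slot.exhaust; auto simp: in_all_rows in_all_slots row_slots_def slot_row_def)+
  then show "p \<in> (\<Union>w\<in>set (all_rows k M N c t). set (row_slots M c t w))" by (rule UN_I)
qed

text \<open>By the order within its class, an A reaches all rows up to its own, and a placed B all
  rows from its own on. For the remaining rows of a placed summand, \<open>row\<close> reduces to
  its partner, if there is one. An A that is not placed reaches every row. A B that is not placed
  uses the order of its class in rows holding a B, and \<open>stop\<close> in the others.\<close>

lemma rows_fill:
  fixes T :: "slot \<Rightarrow> slot \<Rightarrow> bool" and h :: "slot \<Rightarrow> slot \<Rightarrow> bool"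
  assumes hom: "\<And>i p q. 1 \<le> i \<Longrightarrow> i \<le> c \<Longrightarrow> p \<in> Aslot ` {..<M} \<union> Bslot ` {..<N} \<Longrightarrow> q \<in> set (row_slots M c t (Row i)) \<Longrightarrow>
      h p q \<Longrightarrow> T (Row i) p"
    and row: "\<And>i i' p. 1 \<le> i \<Longrightarrow> i \<le> c \<Longrightarrow> 1 \<le> i' \<Longrightarrow> i' \<le> c \<Longrightarrow> p \<in> set (row_slots M c t (Row i')) \<Longrightarrow>
      (\<And>q. q \<in> set (row_slots M c t (Row i')) \<Longrightarrow> q \<noteq> p \<Longrightarrow> T (Row i) q) \<Longrightarrow> T (Row i) p"
    and t: "t \<le> c" "t \<le> N"
    and AA: "\<And>i j. i < M \<Longrightarrow> j \<le> i \<Longrightarrow> h (Aslot i) (Aslot j)"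
    and BB: "\<And>i j. i < N \<Longrightarrow> j \<le> i \<Longrightarrow> h (Bslot i) (Bslot j)"
    and stop: "\<And>i j. t < c \<Longrightarrow> t \<le> j \<Longrightarrow> j < N \<Longrightarrow> 1 \<le> i \<Longrightarrow> i \<le> c - t \<Longrightarrow> i \<le> M \<and> h (Bslot j) (Aslot (i - 1))"
    and i: "1 \<le> i" "i \<le> c" and p: "p \<in> Aslot ` {..<M} \<union> Bslot ` {..<N}"
  shows "T (Row i) p"
proof -
  \<comment> \<open>Row \<open>i\<close> holds the A at position \<open>i - 1\<close>, which
    receives a morphism from every later A.\<close>
  have A1: "T (Row i) (Aslot k)" if k: "k < M" "i \<le> k + 1" for k
  proof (rule hom[OF i])
    show "Aslot (i - 1) \<in> set (row_slots M c t (Row i))" using k by (simp add: row_slots_def)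
    show "h (Aslot k) (Aslot (i - 1))" by (rule AA[OF k(1)]) (use k(2) in simp)
  qed (use k(1) in simp)
  have B1: "T (Row i) (Bslot j)" if j: "j < N" "c - i < t" "c - i \<le> j" for j
  proof (rule hom[OF i])
    show "Bslot (c - i) \<in> set (row_slots M c t (Row i))" using j(2) i by (simp add: row_slots_def Suc_diff_le)
    show "h (Bslot j) (Bslot (c - i))" by (rule BB[OF j(1,3)])
  qed (use j(1) in simp)
  from p consider k where "p = Aslot k" "k < M" | j where "p = Bslot j" "j < N" by auto
  then show ?thesis
  proof cases
    case (1 k)
    show ?thesis
    proof (cases "i \<le> k + 1")
      case True
      then show ?thesis using A1 1 by simp
    next
      \<comment> \<open>The row \<open>k + 1\<close> of this A has a smaller number than
        \<open>i\<close>. If it holds a B, then that B comes later in \<open>Bs\<close> than the B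
        of row \<open>i\<close>, which has therefore been placed too; so \<open>B1\<close> reaches
        the partner.\<close>
      case False
      show ?thesis
      proof (rule row[OF i, of "k + 1"])
        show "p \<in> set (row_slots M c t (Row (k + 1)))" using 1 by (simp add: row_slots_def)
        fix q assume q: "q \<in> set (row_slots M c t (Row (k + 1)))" "q \<noteq> p"
        then have "q = Bslot (c - (k + 1))" "c + 1 - (k + 1) \<le> t"
          using 1 by (auto simp: row_slots_def split: if_splits)
        moreover have "c - (k + 1) < N" "c - i < t" "c - i \<le> c - (k + 1)"
          using \<open>c + 1 - (k + 1) \<le> t\<close> False t i by linarith+
        ultimately show "T (Row i) q" using B1[of "c - (k + 1)"] by simp
      qed (use False i in linarith)+
    qed
  next
    case (2 j)
    show ?thesis
    proof (cases "j < t")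
      case True
      show ?thesis
      proof (cases "c - i \<le> j")
        case True
        then show ?thesis using B1[of j] \<open>j < t\<close> 2 by simp
      next
        \<comment> \<open>Mirror image: the row \<open>c - j\<close> of this B has a larger number
          than \<open>i\<close>, and an A in it comes later than the A of row \<open>i\<close>, so
          \<open>A1\<close> reaches the partner.\<close>
        case False
        show ?thesis
        proof (rule row[OF i, of "c - j"])
          show "p \<in> set (row_slots M c t (Row (c - j)))" using 2(1) True t by (simp add: row_slots_def)
          fix q assume q: "q \<in> set (row_slots M c t (Row (c - j)))" "q \<noteq> p"
          then have "q = Aslot (c - j - 1)" "c - j \<le> M"
            using 2 True t by (auto simp: row_slots_def split: if_splits)
          moreover have "c - j - 1 < M" "i \<le> c - j - 1 + 1" using \<open>c - j \<le> M\<close> False True t i by linarith+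
          ultimately show "T (Row i) q" using A1[of "c - j - 1"] by simp
        qed (use False True t in linarith)+
      qed
    next
      case False
      show ?thesis
      proof (cases "c - i < t")
        case True
        then show ?thesis using B1[of j] False 2 by simp
      next
        case nt: False
        show ?thesis
        proof (cases "t < c")
          case True
          \<comment> \<open>No B has been placed in row \<open>i\<close>, so the morphism that
            caused the stop has to be used; it also guarantees that row \<open>i\<close> holds an
            A.\<close>
          have s: "i \<le> M \<and> h (Bslot j) (Aslot (i - 1))" using stop[of j i] True False 2(2) i nt by linarith
          show ?thesis
            by (rule hom[OF i p, of "Aslot (i - 1)"]) (use s 2(1) in \<open>simp_all add: row_slots_def\<close>)
        next
          case False
          then show ?thesis using nt i t by linarith
        qed
      qed
    qed
  qed
qed

text \<open>The third fact is the reason for stopping and serves density. The fourth, by minimality,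
  is the reason for not stopping before and serves the indecomposability of the rows.\<close>

lemma stop_index_facts:
  fixes As Bs :: "('v, 'b) quiver_rep list" and Q :: "('v, 'b) pre_digraph" and c :: nat
  defines "t \<equiv> stop_index Q c As Bs"
  shows "t \<le> c" "t \<le> length Bs"
    and "t < c \<Longrightarrow> t < length Bs \<Longrightarrow> c - t \<le> length As \<and> nonzero_Hom Q (Bs ! t) (As ! (c - t - 1))"
    and "j < t \<Longrightarrow> c - j \<le> length As \<Longrightarrow> \<not> nonzero_Hom Q (Bs ! j) (As ! (c - j - 1))"
proof -
  let ?P = "\<lambda>t. t = c \<or> t = length Bs \<or> (c - t \<le> length As \<and> nonzero_Hom Q (Bs ! t) (As ! (c - t - 1)))"
  have t: "t = (LEAST t. ?P t)" by (simp add: t_def stop_index_def)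
  show "t \<le> c" unfolding t by (rule Least_le) simp
  show "t \<le> length Bs" unfolding t by (rule Least_le) simp
  have "?P t" unfolding t by (rule LeastI[of ?P c]) simp
  then show "t < c \<Longrightarrow> t < length Bs \<Longrightarrow> c - t \<le> length As \<and> nonzero_Hom Q (Bs ! t) (As ! (c - t - 1))" by simp
  show "\<not> nonzero_Hom Q (Bs ! j) (As ! (c - j - 1))" if "j < t" "c - j \<le> length As"
    using not_less_Least[of j ?P] that unfolding t by blast
qed

lemma isom_refl: "wf_digraph Q \<Longrightarrow> is_rep Q X \<Longrightarrow> isom Q X X (\<lambda>x. 1\<^sub>m (dimv X x)) (\<lambda>x. 1\<^sub>m (dimv X x))"
  using ishom_id[of Q X] by (simp add: isom_def)

text \<open>The representation with dense orbit is built as a direct sum of glued rows, so its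
  decomposition is given by construction. What remains is that its restriction is isomorphic to
  \<open>R\<close>, that its tangent directions are exhausted, and that each row is
  indecomposable.\<close>

lemma algorithm_correct:
  fixes Q Q' :: "(nat, 'b) pre_digraph" and Xs As Bs :: "(nat, 'b) quiver_rep list"
  assumes n: "n \<ge> 4" and P: "pendant_arrow Q n a0" and a0: "tail Q a0 = 2"
    and Q': "Q' = pre_digraph.del_vert Q n" and chain: "chain_quiver (n - 1) Q' e"
    and \<alpha>: "\<alpha> \<in> dim_vectors Q" and R: "generic_rep Q' (\<alpha>(n := 0)) R" and dec: "indec_decomposition Q' R Xs"
    and adm: "admissible_orders Q' Xs As Bs"
  shows "generic_decomposition Q \<alpha> (algorithm_output n Q' (\<alpha> n) Xs As Bs)"
proof -
  note PD = pendant_arrowD[OF P]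
  have wf': "wf_digraph Q'" unfolding Q' by (rule PD(10))

  \<comment> \<open>The classes of summands\<close>
  define c where "c = \<alpha> n"
  define t where "t = stop_index Q' c As Bs"
  define Zs where "Zs = filter (\<lambda>X. dimv X 2 = 0) Xs"
  define M where "M = length As"
  define N where "N = length Bs"
  have m2: "2 \<le> n - 1" using n by simp
  have v2: "2 \<in> verts Q'" using chain m2 by (simp add: chain_quiver_def)
  let ?jA = "if 1 \<rightarrow>\<^bsub>Q'\<^esub> 2 then 1 else 2 :: nat" and ?jB = "if 1 \<rightarrow>\<^bsub>Q'\<^esub> 2 then 2 else 1 :: nat"
  have indec: "indecomposable_rep Q' X" if "X \<in> set Xs" for X
    using dec that unfolding indec_decomposition_def by blast
  have rep: "is_rep Q' X" if "X \<in> set Xs" for X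
    using indec[OF that] unfolding indecomposable_rep_def by blast
  have cls: "interval_through_2 (n - 1) Q' (if dimv X 1 = 0 then 2 else 1) X" if "X \<in> set Xs" "dimv X 2 \<noteq> 0" for X
    by (rule indecomposable_class[OF chain m2 indec[OF that(1)] that(2)])
  have Aset: "set As = {X \<in> set Xs. first_class Q' X}" and Bset: "set Bs = {X \<in> set Xs. second_class Q' X}"
    using adm unfolding admissible_orders_def by (metis set_mset_mset set_mset_filter)+
  have Athr: "interval_through_2 (n - 1) Q' ?jA X" if X: "X \<in> set As" for X
  proof -
    have X': "X \<in> set Xs" "first_class Q' X" using X Aset by auto
    then have "dimv X 2 \<noteq> 0" by (simp add: first_class_def)
    then show ?thesis using first_class_interval(2)[OF cls[OF X'(1)] X'(2)] by blast
  qed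
  have Bthr: "interval_through_2 (n - 1) Q' ?jB X" if X: "X \<in> set Bs" for X
  proof -
    have X': "X \<in> set Xs" "second_class Q' X" using X Bset by auto
    then have "dimv X 2 \<noteq> 0" by (simp add: second_class_def)
    then show ?thesis using first_class_interval(3)[OF cls[OF X'(1)] X'(2)] by blast
  qed
  have ms: "mset (Zs @ As @ Bs) = mset Xs"
  proof -
    have "filter_mset (\<lambda>X. dimv X 2 = 0) (mset Xs) + filter_mset (first_class Q') (mset Xs) + filter_mset (second_class Q') (mset Xs) = mset Xs"
    proof (rule mset_filter_trichotomy)
      fix X assume X: "X \<in> set Xs"
      show "dimv X 2 = 0 \<and> \<not> first_class Q' X \<and> \<not> second_class Q' X \<or>
         dimv X 2 \<noteq> 0 \<and> first_class Q' X \<and> \<not> second_class Q' X \<or>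
         dimv X 2 \<noteq> 0 \<and> \<not> first_class Q' X \<and> second_class Q' X"
      proof (cases "dimv X 2 = 0")
        case True
        then show ?thesis by (simp add: first_class_def second_class_def)
      next
        case False
        moreover have "\<not> (first_class Q' X \<and> second_class Q' X)" by (simp add: first_class_def second_class_def)
        ultimately show ?thesis using first_class_interval(1)[OF cls[OF X False]] by blast
      qed
    qed
    then show ?thesis using adm unfolding admissible_orders_def Zs_def by (simp add: add.assoc)
  qed

  \<comment> \<open>Slots and the morphisms between them\<close>
  define S where "S = slot_rep Zs As Bs"
  define J where "J = row_slots M c t"
  define ks where "ks = all_rows (length Zs) M N c t"
  define ps where "ps = all_slots (length Zs) M N"
  define s :: "slot \<Rightarrow> nat" where "s = (\<lambda>w. case w of Row i \<Rightarrow> 1 | _ \<Rightarrow> 0)"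
  have Srow: "S (Zslot k) = Zs ! k" "S (Aslot i) = As ! i" "S (Bslot j) = Bs ! j" for i j k
    by (simp_all add: S_def slot_rep_def)
  note stop = stop_index_facts[where Q = Q' and c = c and As = As and Bs = Bs, folded t_def]
  have tc: "t \<le> c" "t \<le> N" using stop(1,2) unfolding N_def .
  have un: "(\<Union>w\<in>set ks. set (J w)) = set ps"
    unfolding ks_def J_def ps_def by (rule union_row_slots[OF tc])
  have mapS: "map S ps = Zs @ As @ Bs" unfolding S_def ps_def M_def N_def by (rule map_slot_rep_all_slots)
  have Sset: "S p \<in> set Xs" if "p \<in> set ps" for p
  proof -
    have "S p \<in> set (map S ps)" using that by simp
    then have "S p \<in> set_mset (mset (Zs @ As @ Bs))" unfolding mapS by simp
    then show ?thesis unfolding ms by simp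
  qed
  have Srep: "is_rep Q' (S p)" if "p \<in> set ps" for p by (rule rep[OF Sset[OF that]])
  have SA: "interval_through_2 (n - 1) Q' ?jA (S (Aslot i))" if "i < M" for i
    unfolding Srow by (rule Athr, rule nth_mem) (use that M_def in simp)
  have SB: "interval_through_2 (n - 1) Q' ?jB (S (Bslot j))" if "j < N" for j
    unfolding Srow by (rule Bthr, rule nth_mem) (use that N_def in simp)
  have SZ: "dimv (S (Zslot k)) 2 = 0" if "k < length Zs" for k
  proof -
    have "Zs ! k \<in> set Zs" using that by simp
    then show ?thesis unfolding Srow Zs_def by simp
  qed
  have dim2: "dimv (S p) 2 \<le> 1" and dim2_cases: "dimv (S p) 2 = 1 \<Longrightarrow> p \<in> Aslot ` {..<M} \<union> Bslot ` {..<N}"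
    if p: "p \<in> set ps" for p
  proof -
    have "(\<exists>k<length Zs. p = Zslot k) \<or> (\<exists>i<M. p = Aslot i) \<or> (\<exists>j<N. p = Bslot j)"
      using p unfolding ps_def all_slots_def by auto
    then have "dimv (S p) 2 \<le> 1 \<and> (dimv (S p) 2 = 1 \<longrightarrow> p \<in> Aslot ` {..<M} \<union> Bslot ` {..<N})"
    proof (elim disjE exE conjE)
      fix k assume "k < length Zs" "p = Zslot k"
      then show ?thesis using SZ by simp
    next
      fix i assume i: "i < M" "p = Aslot i"
      then show ?thesis using interval_through_2_dims(2)[OF SA[OF i(1)]] by simp
    next
      fix j assume j: "j < N" "p = Bslot j"
      then show ?thesis using interval_through_2_dims(2)[OF SB[OF j(1)]] by simp
    qed
    then show "dimv (S p) 2 \<le> 1" "dimv (S p) 2 = 1 \<Longrightarrow> p \<in> Aslot ` {..<M} \<union> Bslot ` {..<N}" by blast+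
  qed
  define h where "h = (\<lambda>p q. hom_at_2 Q' (S p) (S q))"
  have htrans: "h p q' " if "h p q" "h q q'" and pq: "p \<in> Aslot ` {..<M} \<union> Bslot ` {..<N}" "q \<in> Aslot ` {..<M} \<union> Bslot ` {..<N}"
      "q' \<in> Aslot ` {..<M} \<union> Bslot ` {..<N}" for p q q'
  proof -
    have "is_rep Q' (S p) \<and> dimv (S p) 2 = 1" if "p \<in> Aslot ` {..<M} \<union> Bslot ` {..<N}" for p
      using that interval_through_2_dims(1,2)[OF SA] interval_through_2_dims(1,2)[OF SB] by (elim UnE imageE) simp_all
    note this[OF pq(1)] this[OF pq(2)] this[OF pq(3)]
    then show ?thesis using hom_at_2_trans[OF wf' v2, of "S p" "S q" "S q'"] that(1,2) unfolding h_def by blast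
  qed
  have ordA: "nonzero_Hom Q' (As ! i) (As ! j)" if "i < M" "j \<le> i" for i j
    using adm that unfolding admissible_orders_def hom_ordered_def M_def by blast
  have ordB: "nonzero_Hom Q' (Bs ! i) (Bs ! j)" if "i < N" "j \<le> i" for i j
    using adm that unfolding admissible_orders_def hom_ordered_def N_def by blast
  have AA: "h (Aslot i) (Aslot j)" if "i < M" "j \<le> i" for i j
    using ordA[OF that] nonzero_Hom_iff_at_2[OF chain m2 SA[OF that(1)] SA[OF le_less_trans[OF that(2,1)]]]
    unfolding h_def Srow by simp
  have BB: "h (Bslot i) (Bslot j)" if "i < N" "j \<le> i" for i j
    using ordB[OF that] nonzero_Hom_iff_at_2[OF chain m2 SB[OF that(1)] SB[OF le_less_trans[OF that(2,1)]]]
    unfolding h_def Srow by simp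
  have AB: "\<not> h (Aslot i) (Bslot j)" if "i < M" "j < N" for i j
    unfolding h_def by (rule no_hom_first_to_second[OF chain m2 SA[OF that(1)] SB[OF that(2)]])
  have BA: "nonzero_Hom Q' (Bs ! j) (As ! i) \<longleftrightarrow> h (Bslot j) (Aslot i)" if "i < M" "j < N" for i j
    using nonzero_Hom_iff_at_2[OF chain m2 SB[OF that(2)] SA[OF that(1)]] unfolding h_def Srow .
  \<comment> \<open>Composes morphisms from the B at position \<open>j\<close> to the B at position
    \<open>t\<close>, from there to the A at position \<open>c - t - 1\<close>, and on to the A at
    position \<open>i - 1\<close>. The composite is non-zero because all factors are non-zero at
    vertex 2.\<close>
  have stop_hom: "i \<le> M \<and> h (Bslot j) (Aslot (i - 1))" if "t < c" "t \<le> j" "j < N" "1 \<le> i" "i \<le> c - t" for i j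
  proof -
    have tN: "t < N" using that by simp
    then have st: "c - t \<le> M" "nonzero_Hom Q' (Bs ! t) (As ! (c - t - 1))"
      using stop(3)[OF that(1)] unfolding N_def M_def by simp_all
    have lt: "c - t - 1 < M" "i - 1 < M" using st(1) that by linarith+
    have "h (Bslot j) (Bslot t)" by (rule BB[OF that(3,2)])
    moreover have "h (Bslot t) (Aslot (c - t - 1))" using st(2) BA[OF lt(1) tN] by simp
    moreover have "h (Aslot (c - t - 1)) (Aslot (i - 1))" by (rule AA[OF lt(1)]) (use that in linarith)
    ultimately have "h (Bslot j) (Aslot (i - 1))"
      using htrans[of "Bslot j" "Bslot t" "Aslot (c - t - 1)"] htrans[of "Bslot j" "Aslot (c - t - 1)" "Aslot (i - 1)"]
        lt tN that(3) by blast
    then show ?thesis using st(1) that by simp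
  qed
  have row_member: "q \<in> set (J (Row i)) \<Longrightarrow> i \<ge> 1 \<Longrightarrow> i \<le> c \<Longrightarrow> (i \<le> M \<and> q = Aslot (i - 1)) \<or> (c - i < t \<and> c - i < N \<and> q = Bslot (c - i))" for q i
    unfolding J_def row_slots_def using tc by (auto split: if_splits)

  \<comment> \<open>The representation glued from the rows\<close>
  define Y where "Y = (\<lambda>w. direct_sum Q' (map S (J w)))"
  have JS: "p \<in> set ps" if "w \<in> set ks" "p \<in> set (J w)" for w p using that un by blast
  have Yrep: "is_rep Q' (Y w)" if w: "w \<in> set ks" for w
    unfolding Y_def
  proof (rule is_rep_direct_sum)
    fix X assume "X \<in> set (map S (J w))"
    then obtain p where "p \<in> set (J w)" "X = S p" by auto
    then show "is_rep Q' X" using Srep[OF JS[OF w]] by simp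
  qed
  have "\<forall>w\<in>set ks. \<exists>ip. biproduct Q' (Y w) (set (J w)) S (fst ip) (snd ip)"
  proof
    fix w assume w: "w \<in> set ks"
    have "\<exists>\<iota> \<pi>. biproduct Q' (Y w) (set (J w)) S \<iota> \<pi>"
      unfolding Y_def
      by (rule direct_sum_biproduct[OF wf']) (simp add: J_def distinct_row_slots, rule Srep, rule JS[OF w])
    then obtain \<iota> \<pi> where "biproduct Q' (Y w) (set (J w)) S \<iota> \<pi>" by (elim exE)
    then show "\<exists>ip. biproduct Q' (Y w) (set (J w)) S (fst ip) (snd ip)" by (intro exI[of _ "(\<iota>, \<pi>)"]) simp
  qed
  from bchoice[OF this] obtain ip where ip: "\<forall>w\<in>set ks. biproduct Q' (Y w) (set (J w)) S (fst (ip w)) (snd (ip w))"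
    by (elim exE)
  define \<iota>' where "\<iota>' = (\<lambda>w. fst (ip w))"
  define \<pi>' where "\<pi>' = (\<lambda>w. snd (ip w))"
  have b': "biproduct Q' (Y w) (set (J w)) S (\<iota>' w) (\<pi>' w)" if "w \<in> set ks" for w
    using bspec[OF ip that] by (simp add: \<iota>'_def \<pi>'_def)
  define W where "W = (\<lambda>w. glue Q n (s w) (sum_row 2 (s w) (Y w) S (\<pi>' w) (set (J w))) (Y w))"
  have Wg: "is_rep Q (W w)" "restrict_rep Q n (W w) = Y w" if w: "w \<in> set ks" for w
    unfolding W_def
    by (rule glue_rep(1,2)[OF P Yrep[OF w, unfolded Q'] sum_row_carrier, unfolded a0])+
  define X where "X = direct_sum Q (map W ks)"
  have "\<exists>\<iota> \<pi>. biproduct Q X (set ks) W \<iota> \<pi>"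
    unfolding X_def by (rule direct_sum_biproduct[OF PD(1)]) (simp add: ks_def distinct_all_rows, rule Wg(1))
  then obtain \<iota> \<pi> where b: "biproduct Q X (set ks) W \<iota> \<pi>" by (elim exE)
  have Xrep: "is_rep Q X" by (rule biproductD(2)[OF b])
  have own: "slot_row c t p = w" if "w \<in> set ks" "p \<in> set (J w)" for w p
    by (rule slot_row_row_slots) (use that tc in \<open>simp_all add: ks_def J_def\<close>)
  have Row: "\<exists>i. w = Row i \<and> 1 \<le> i \<and> i \<le> c" if "w \<in> set ks" "s w = 1" for w
    using that by (cases w rule: slot.exhaust) (simp_all add: s_def ks_def in_all_rows)
  have RowI: "Row i \<in> set ks" "s (Row i) = 1" if "1 \<le> i" "i \<le> c" for i
    using that by (simp_all add: s_def ks_def in_all_rows)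

  \<comment> \<open>Tangent directions\<close>
  have tangent: "\<exists>\<gamma>\<in>carrier_mat (dimv X n) (dimv X n). \<exists>\<kappa>.
      ishom Q' (restrict_rep Q n X) (restrict_rep Q n X) \<kappa> \<and> F = \<gamma> * maps X a0 + maps X a0 * \<kappa> (tail Q a0)"
    if F: "F \<in> carrier_mat (dimv X n) (dimv X (tail Q a0))" for F
    unfolding Q'
  proof (rule glue_tangent_space[OF P b, where J = "\<lambda>w. set (J w)" and Y = Y and S = S and \<iota>' = \<iota>' and \<pi>' = \<pi>' and own = "slot_row c t" and s = s])
    show "biproduct (pre_digraph.del_vert Q n) (Y w) (set (J w)) S (\<iota>' w) (\<pi>' w)" if "w \<in> set ks" for w
      using b'[OF that] unfolding Q' .
    show "slot_row c t p = w" if "w \<in> set ks" "p \<in> set (J w)" for w p by (rule own[OF that])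
    show "W w = glue Q n (s w) (sum_row (tail Q a0) (s w) (Y w) S (\<pi>' w) (set (J w))) (Y w)" for w
      unfolding W_def a0 ..
    show "s w \<le> 1" for w by (simp add: s_def split: slot.split)
    show "dimv (S p) (tail Q a0) \<le> 1" if "w \<in> set ks" "p \<in> set (J w)" for w p
      unfolding a0 by (rule dim2[OF JS[OF that]])
  next
    fix T :: "slot \<Rightarrow> slot \<Rightarrow> bool" and w p
    assume T1: "\<And>w p q \<phi>. w \<in> set ks \<Longrightarrow> s w = 1 \<Longrightarrow> p \<in> (\<Union>w\<in>set ks. set (J w)) \<Longrightarrow> q \<in> set (J w) \<Longrightarrow>
        dimv (S p) (tail Q a0) = 1 \<Longrightarrow> dimv (S q) (tail Q a0) = 1 \<Longrightarrow>
        ishom (pre_digraph.del_vert Q n) (S p) (S q) \<phi> \<Longrightarrow> \<phi> (tail Q a0) $$ (0, 0) \<noteq> 0 \<Longrightarrow> T w p"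
      and T2: "\<And>w w' p. w \<in> set ks \<Longrightarrow> w' \<in> set ks \<Longrightarrow> s w = 1 \<Longrightarrow> s w' = 1 \<Longrightarrow> p \<in> set (J w') \<Longrightarrow>
        (\<And>q. q \<in> set (J w') \<Longrightarrow> q \<noteq> p \<Longrightarrow> T w q) \<Longrightarrow> T w p"
      and w: "w \<in> set ks" "s w = 1" and p: "p \<in> (\<Union>w\<in>set ks. set (J w))" and dp: "dimv (S p) (tail Q a0) = 1"
    obtain i where i: "w = Row i" "1 \<le> i" "i \<le> c" using Row[OF w] by (elim exE conjE)
    have p': "p \<in> Aslot ` {..<M} \<union> Bslot ` {..<N}"
      by (rule dim2_cases) (use p un dp a0 in simp_all)
    have AB_ps: "p \<in> set ps \<and> dimv (S p) 2 = 1" if "p \<in> Aslot ` {..<M} \<union> Bslot ` {..<N}" for p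
      using that interval_through_2_dims(2)[OF SA] interval_through_2_dims(2)[OF SB]
      by (elim UnE imageE) (simp_all add: ps_def in_all_slots)
    show "T w p" unfolding i(1)
    proof (rule rows_fill[where T = T and h = h and t = t and N = N and M = M, OF _ _ tc AA BB stop_hom i(2,3) p'])
      fix i p q
      assume i: "1 \<le> i" "i \<le> c" and p: "p \<in> Aslot ` {..<M} \<union> Bslot ` {..<N}" and q: "q \<in> set (row_slots M c t (Row i))" and hpq: "h p q"
      have q': "q \<in> set (J (Row i))" using q by (simp add: J_def)
      have "q \<in> Aslot ` {..<M} \<union> Bslot ` {..<N}" using row_member[OF q' i] i by auto
      note dq = AB_ps[OF this]
      obtain \<phi> where \<phi>: "ishom Q' (S p) (S q) \<phi>" "\<phi> 2 $$ (0, 0) \<noteq> 0"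
        using hpq unfolding h_def hom_at_2_def by (elim exE conjE)
      show "T (Row i) p"
        by (rule T1[OF RowI[OF i] _ q' _ _ \<phi>(1)[unfolded Q']])
          (use AB_ps[OF p] dq \<phi>(2) un in \<open>simp_all add: a0\<close>)
    next
      fix i i' p
      assume i: "1 \<le> i" "i \<le> c" "1 \<le> i'" "i' \<le> c" and p: "p \<in> set (row_slots M c t (Row i'))"
        and rest: "\<And>q. q \<in> set (row_slots M c t (Row i')) \<Longrightarrow> q \<noteq> p \<Longrightarrow> T (Row i) q"
      show "T (Row i) p"
        by (rule T2[OF RowI(1)[OF i(1,2)] RowI(1)[OF i(3,4)] RowI(2)[OF i(1,2)] RowI(2)[OF i(3,4)] p[folded J_def] rest[folded J_def]])
    qed
  qed (rule F)

  \<comment> \<open>Comparison of the restriction with \<open>R\<close>, and the dense orbit\<close>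
  have RR: "is_rep Q' R" and dR: "dimv R = \<alpha>(n := 0)" using R by (simp_all add: generic_rep_def)
  have DX: "is_rep Q' (direct_sum Q' Xs)" by (rule is_rep_direct_sum) (rule rep)
  obtain \<phi>1 \<psi>1 where iso1: "isom Q' R (direct_sum Q' Xs) \<phi>1 \<psi>1"
    using dec iso_rep_iff[OF wf' RR DX] unfolding indec_decomposition_def by blast
  have "\<exists>\<phi> \<psi>. isom Q' (direct_sum Q' (Zs @ As @ Bs)) (direct_sum Q' Xs) \<phi> \<psi>"
    by (rule direct_sum_permute[OF wf' ms]) (rule rep)
  then obtain \<phi>2 \<psi>2 where iso2: "isom Q' (direct_sum Q' (map S ps)) (direct_sum Q' Xs) \<phi>2 \<psi>2"
    unfolding mapS by (elim exE)
  have "\<exists>\<iota> \<pi>. biproduct Q' (direct_sum Q' (map S ps)) (set ps) S \<iota> \<pi>"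
    by (rule direct_sum_biproduct[OF wf']) (simp add: ps_def distinct_all_slots, rule Srep)
  then obtain \<iota>2 \<pi>2 where b2: "biproduct Q' (direct_sum Q' (map S ps)) (set ps) S \<iota>2 \<pi>2" by (elim exE)
  have bR: "biproduct Q' (restrict_rep Q n X) (set ks) Y \<iota> \<pi>"
    unfolding Q' by (rule biproduct_cong[OF biproduct_restrict_rep[OF b PD(1)]]) (rule Wg(2))
  \<comment> \<open>The restriction of \<open>X\<close> is a biproduct of rows, each a biproduct of
    slots. Nested, it has the same index set as the sum of all slots, which is isomorphic to
    \<open>R\<close>.\<close>
  have bn: "biproduct Q' (restrict_rep Q n X) (set ps) S (\<lambda>p x. \<iota> (slot_row c t p) x * \<iota>' (slot_row c t p) p x)
      (\<lambda>p x. \<pi>' (slot_row c t p) p x * \<pi> (slot_row c t p) x)"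
    by (rule biproduct_nest[OF wf' bR b' own, unfolded un])
  note iso3 = isom_of_biproducts[OF wf' b2 bn]
  have Rr: "is_rep Q' (restrict_rep Q n X)" by (rule biproductD(2)[OF bR])
  have Dp: "is_rep Q' (direct_sum Q' (map S ps))" by (rule biproductD(2)[OF b2])
  note iso = isom_trans[OF wf' RR Dp Rr isom_trans[OF wf' RR DX Dp iso1 isom_sym[OF iso2]] iso3]
  have dimX: "dimv X = \<alpha>"
  proof (rule ext)
    fix x
    consider "x = n" | "x \<in> verts Q'" "x \<noteq> n" | "x \<notin> verts Q" unfolding Q' by (auto simp: del_vert_simps)
    then show "dimv X x = \<alpha> x"
    proof cases
      case 1
      \<comment> \<open>Only the numbered rows contribute at \<open>n\<close>, each by 1, and there
        are \<open>c\<close> of them.\<close>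
      have "dimv X n = (\<Sum>w\<leftarrow>ks. s w)"
        by (simp add: X_def dimv_direct_sum o_def W_def glue_def)
      also have "\<dots> = c" by (simp add: ks_def all_rows_def s_def o_def sum_list_triv)
      finally show ?thesis using 1 by (simp add: c_def)
    next
      case 2
      have "dimv R x = dimv (restrict_rep Q n X) x" by (rule isom_dimv[OF iso 2(1)])
      then show ?thesis using 2(2) dR by (simp add: restrict_rep_def)
    next
      case 3
      then show ?thesis using is_repD(4)[OF Xrep 3] \<alpha> by (simp add: dim_vectors_def)
    qed
  qed
  have "generic_rep Q (dimv X) X"
  proof (rule generic_rep_pendant_arrow[OF P Xrep _ iso[unfolded Q']])
    show "generic_rep (pre_digraph.del_vert Q n) ((dimv X)(n := 0)) R" using R unfolding dimX Q' .
  qed (rule tangent[unfolded Q'])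
  then have gen: "generic_rep Q \<alpha> X" unfolding dimX .

  \<comment> \<open>Indecomposability of the rows\<close>
  have ind: "indecomposable_rep Q (W w)" if w: "w \<in> set ks" for w
  proof (cases "s w = 1")
    case False
    then have s0: "s w = 0" by (simp add: s_def split: slot.splits)
    have Jw: "J w = [w]" using False by (simp add: s_def J_def row_slots_def split: slot.splits)
    have wp: "w \<in> set ps" by (rule JS[OF w]) (simp add: Jw)
    have "Y w = S w" unfolding Y_def Jw by (simp add: direct_sum_singleton[OF Srep[OF wp]])
    then have "indecomposable_rep (pre_digraph.del_vert Q n) (Y w)" using indec[OF Sset[OF wp]] unfolding Q' by simp
    then show ?thesis unfolding W_def s0 by (rule indecomposable_glue_zero[OF P]) (simp add: a0)
  next
    case True
    obtain i where i: "w = Row i" "1 \<le> i" "i \<le> c" using Row[OF w True] by (elim exE conjE)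
    have mem: "(i \<le> M \<and> p = Aslot (i - 1)) \<or> (c - i < t \<and> c - i < N \<and> p = Bslot (c - i))" if "p \<in> set (J w)" for p
      using row_member[of p i] that i by simp
    have thr: "\<exists>j. interval_through_2 (n - 1) Q' j (S p)" if "p \<in> set (J w)" for p
      using mem[OF that]
    proof (elim disjE conjE)
      assume p: "i \<le> M" "p = Aslot (i - 1)"
      then have "i - 1 < M" using i by simp
      from SA[OF this] show ?thesis unfolding p(2) by (rule exI)
    next
      assume p: "c - i < N" "p = Bslot (c - i)"
      from SB[OF p(1)] show ?thesis unfolding p(2) by (rule exI)
    qed
    have noh: "\<not> h p q" if p: "p \<in> set (J w)" and q: "q \<in> set (J w)" and "p \<noteq> q" for p q
      using mem[OF p]
    proof (elim disjE conjE)
      \<comment> \<open>From an A to a B: excluded by the choice of the classes.\<close>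
      assume p': "i \<le> M" "p = Aslot (i - 1)"
      then have q': "c - i < N" "q = Bslot (c - i)" using mem[OF q] \<open>p \<noteq> q\<close> by auto
      have "i - 1 < M" using p'(1) i by simp
      then show ?thesis unfolding p'(2) q'(2) by (rule AB[OF _ q'(1)])
    next
      \<comment> \<open>From a B to an A: such a morphism would have stopped the algorithm before
        this B was placed. Position \<open>c - i\<close> in \<open>Bs\<close> belongs to row
        \<open>c - (c - i) = i\<close>.\<close>
      assume p': "c - i < t" "c - i < N" "p = Bslot (c - i)"
      then have q': "i \<le> M" "q = Aslot (i - 1)" using mem[OF q] \<open>p \<noteq> q\<close> by auto
      have ci: "c - (c - i) = i" using i by simp
      have "\<not> nonzero_Hom Q' (Bs ! (c - i)) (As ! (i - 1))"
        using stop(4)[OF p'(1)] q'(1) unfolding ci M_def by simp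
      moreover have "i - 1 < M" using q'(1) i by simp
      ultimately show ?thesis unfolding p'(3) q'(2) using BA[OF _ p'(2)] by blast
    qed
    have "indecomposable_rep Q (glue Q n 1 (sum_row (tail Q a0) 1 (Y w) S (\<pi>' w) (set (J w))) (Y w))"
    proof (rule indecomposable_glue_one[OF P b'[OF w, unfolded Q']])
      show "dimv (S p) (tail Q a0) = 1" if p: "p \<in> set (J w)" for p
        using thr[OF p] interval_through_2_dims(2) unfolding a0 by blast
      show "\<phi> (tail Q a0) $$ (0, 0) = 0"
        if "p \<in> set (J w)" "q \<in> set (J w)" "p \<noteq> q" "ishom (pre_digraph.del_vert Q n) (S p) (S q) \<phi>" for p q \<phi>
        using noh[OF that(1-3)] that(4) unfolding h_def hom_at_2_def a0 Q' by blast
      show "\<phi> x = 0\<^sub>m (dimv (S q) x) (dimv (S p) x)"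
        if pq: "p \<in> set (J w)" "q \<in> set (J w)" "ishom (pre_digraph.del_vert Q n) (S p) (S q) \<phi>"
          "\<phi> (tail Q a0) $$ (0, 0) = 0" "x \<in> verts (pre_digraph.del_vert Q n)" for p q \<phi> x
      proof -
        obtain j where j: "interval_through_2 (n - 1) Q' j (S p)" using thr[OF pq(1)] by (elim exE)
        obtain j' where j': "interval_through_2 (n - 1) Q' j' (S q)" using thr[OF pq(2)] by (elim exE)
        show ?thesis
          by (rule interval_hom_vanishes[OF chain j j' pq(3)[folded Q'] pq(4)[unfolded a0] pq(5)[folded Q']])
      qed
    qed
    then show ?thesis unfolding W_def True a0 .
  qed

  \<comment> \<open>Dimension vectors of the rows\<close>
  have dn: "dimv (S p) n = 0" if "p \<in> set ps" for p
    by (rule is_repD(4)[OF Srep[OF that]]) (simp add: Q' del_vert_simps)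
  have dW: "dimv (W w) = (\<lambda>x. (if x = n then s w else 0) + (\<Sum>p\<leftarrow>J w. dimv (S p) x))" if w: "w \<in> set ks" for w
  proof (rule ext)
    fix x
    have "(\<Sum>p\<leftarrow>J w. dimv (S p) n) = (\<Sum>p\<leftarrow>J w. 0)"
      by (rule arg_cong[where f = sum_list], rule map_cong[OF refl], rule dn, rule JS[OF w])
    then show "dimv (W w) x = (if x = n then s w else 0) + (\<Sum>p\<leftarrow>J w. dimv (S p) x)"
      by (cases "x = n") (simp_all add: W_def glue_def Y_def dimv_direct_sum o_def)
  qed
  have single: "dimv (W w) = dimv (S w)" if w: "w \<in> set ks" "J w = [w]" "s w = 0" for w
    unfolding dW[OF w(1)] w(2,3) by simp
  have "map dimv (map W ks) = map dimv Zs @ map dimv (drop c As) @ map dimv (drop t Bs) @ map (row_dim n c As Bs t) [1..<c + 1]"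
  proof -
    have Z: "map (\<lambda>k. dimv (W (Zslot k))) [0..<length Zs] = map dimv Zs"
    proof -
      have "map (\<lambda>k. dimv (W (Zslot k))) [0..<length Zs] = map (\<lambda>k. dimv (Zs ! k)) [0..<length Zs]"
        by (rule map_cong[OF refl], subst single) (simp_all add: ks_def in_all_rows J_def row_slots_def s_def Srow)
      also have "\<dots> = map dimv (map ((!) Zs) [0..<length Zs])" by simp
      finally show ?thesis by (simp only: map_nth)
    qed
    have A: "map (\<lambda>k. dimv (W (Aslot k))) [c..<M] = map dimv (drop c As)"
    proof -
      have "map (\<lambda>k. dimv (W (Aslot k))) [c..<M] = map (\<lambda>k. dimv (As ! k)) [c..<M]"
        by (rule map_cong[OF refl], subst single) (simp_all add: ks_def in_all_rows J_def row_slots_def s_def Srow)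
      also have "\<dots> = map dimv (map ((!) As) (drop c [0..<M]))" by simp
      also have "\<dots> = map dimv (drop c As)" unfolding drop_map[symmetric] M_def map_nth ..
      finally show ?thesis .
    qed
    have B: "map (\<lambda>k. dimv (W (Bslot k))) [t..<N] = map dimv (drop t Bs)"
    proof -
      have "map (\<lambda>k. dimv (W (Bslot k))) [t..<N] = map (\<lambda>k. dimv (Bs ! k)) [t..<N]"
        by (rule map_cong[OF refl], subst single) (simp_all add: ks_def in_all_rows J_def row_slots_def s_def Srow)
      also have "\<dots> = map dimv (map ((!) Bs) (drop t [0..<N]))" by simp
      also have "\<dots> = map dimv (drop t Bs)" unfolding drop_map[symmetric] N_def map_nth ..
      finally show ?thesis .
    qed
    have Rw: "map (\<lambda>i. dimv (W (Row i))) [1..<c + 1] = map (row_dim n c As Bs t) [1..<c + 1]"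
    proof (rule map_cong[OF refl])
      fix i assume "i \<in> set [1..<c + 1]"
      then have i: "1 \<le> i" "i \<le> c" by auto
      show "dimv (W (Row i)) = row_dim n c As Bs t i"
        unfolding dW[OF RowI(1)[OF i]]
        by (rule ext) (simp add: J_def row_slots_def s_def Srow row_dim_def M_def)
    qed
    show ?thesis by (simp only: ks_def all_rows_def map_append map_map o_def Z A B Rw)
  qed
  then have out: "mset (map dimv (map W ks)) = algorithm_output n Q' c Xs As Bs"
    unfolding algorithm_output_def Let_def t_def[symmetric] Zs_def by (simp only: mset_append add.assoc)
  have "iso_rep Q X (direct_sum Q (map W ks))"
    using isom_refl[OF PD(1) Xrep] iso_rep_iff[OF PD(1) Xrep Xrep] unfolding X_def by blast
  then have "indec_decomposition Q X (map W ks)"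
    unfolding indec_decomposition_def using ind by simp
  then show ?thesis
    unfolding generic_decomposition_def using gen out unfolding c_def by (intro exI[of _ X] exI[of _ "map W ks"]) simp
qed

text \<open>The exhaustiveness of the classes and the existence of the required orders are part of
  the claim, so that the last conjunct, over all such orders, is not vacuous.\<close>

theorem theoremA1:
  fixes n :: nat and Q Q' :: "(nat, 'b) pre_digraph" and \<alpha> :: "nat \<Rightarrow> nat"
    and R :: "(nat, 'b) quiver_rep" and Xs :: "(nat, 'b) quiver_rep list"
  assumes "n \<ge> 4"
    and "type_D_quiver n Q"
    and "2 \<rightarrow>\<^bsub>Q\<^esub> n"
    and "\<alpha> \<in> dim_vectors Q"
    and "Q' = pre_digraph.del_vert Q n"
    and "generic_rep Q' (\<alpha>(n := 0)) R"
    and "indec_decomposition Q' R Xs"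
  shows "(\<forall>X\<in>set Xs. dimv X 2 = 0 \<or> first_class Q' X \<or> second_class Q' X) \<and>
    (\<exists>As Bs. admissible_orders Q' Xs As Bs) \<and>
    (\<forall>As Bs. admissible_orders Q' Xs As Bs \<longrightarrow>
       generic_decomposition Q \<alpha> (algorithm_output n Q' (\<alpha> n) Xs As Bs))"
proof -
  obtain a0 e where P: "pendant_arrow Q n a0" and a0: "tail Q a0 = 2" and "chain_quiver (n - 1) (pre_digraph.del_vert Q n) e"
    using type_D_structure[OF assms(1-3)] .
  then have chain: "chain_quiver (n - 1) Q' e" unfolding assms(5) by simp
  have m2: "2 \<le> n - 1" using assms(1) by simp
  have wf': "wf_digraph Q'" and v2: "2 \<in> verts Q'" using chain m2 by (simp_all add: chain_quiver_def)
  have indec: "indecomposable_rep Q' X" if "X \<in> set Xs" for X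
    using assms(7) that unfolding indec_decomposition_def by blast
  have cls: "interval_through_2 (n - 1) Q' (if dimv X 1 = 0 then 2 else 1) X" if "X \<in> set Xs" "dimv X 2 \<noteq> 0" for X
    by (rule indecomposable_class[OF chain m2 indec[OF that(1)] that(2)])
  have classes: "dimv X 2 = 0 \<or> first_class Q' X \<or> second_class Q' X" if X: "X \<in> set Xs" for X
    using first_class_interval(1)[OF cls[OF X]] by blast
  \<comment> \<open>All members of a class have the same left end \<open>j\<close>, which makes the
    existence of non-zero morphisms a total preorder on them.\<close>
  have arrange: "\<exists>Ys. mset Ys = filter_mset C (mset Xs) \<and> hom_ordered Q' Ys"
    if C: "\<And>X. X \<in> set Xs \<Longrightarrow> C X \<Longrightarrow> interval_through_2 (n - 1) Q' j X" for C j
  proof -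
    let ?L = "filter C Xs"
    have thr: "interval_through_2 (n - 1) Q' j X" if "X \<in> set ?L" for X using C[of X] that by simp
    have "\<exists>Ys. mset Ys = mset ?L \<and> (\<forall>i<length Ys. \<forall>k\<le>i. nonzero_Hom Q' (Ys ! i) (Ys ! k))"
    proof (rule total_preorder_arrange)
      fix X Y assume X: "X \<in> set ?L" and Y: "Y \<in> set ?L"
      show "nonzero_Hom Q' X Y \<or> nonzero_Hom Q' Y X"
        using hom_at_2_total[OF chain thr[OF X] thr[OF Y]]
        unfolding nonzero_Hom_iff_at_2[OF chain m2 thr[OF X] thr[OF Y]] nonzero_Hom_iff_at_2[OF chain m2 thr[OF Y] thr[OF X]] .
    next
      fix X Y Z assume X: "X \<in> set ?L" and Y: "Y \<in> set ?L" and Z: "Z \<in> set ?L"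
        and h: "nonzero_Hom Q' X Y" "nonzero_Hom Q' Y Z"
      note d = interval_through_2_dims[OF thr[OF X]] interval_through_2_dims[OF thr[OF Y]] interval_through_2_dims[OF thr[OF Z]]
      show "nonzero_Hom Q' X Z"
        unfolding nonzero_Hom_iff_at_2[OF chain m2 thr[OF X] thr[OF Z]]
        by (rule hom_at_2_trans[OF wf' v2 d(1,4,7) d(2,5,8)
              h(1)[unfolded nonzero_Hom_iff_at_2[OF chain m2 thr[OF X] thr[OF Y]]]
              h(2)[unfolded nonzero_Hom_iff_at_2[OF chain m2 thr[OF Y] thr[OF Z]]]])
    qed
    then show ?thesis by (simp add: hom_ordered_def)
  qed
  have nz: "dimv X 2 \<noteq> 0" if "first_class Q' X \<or> second_class Q' X" for X
    using that by (auto simp: first_class_def second_class_def)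
  have "\<exists>As. mset As = filter_mset (first_class Q') (mset Xs) \<and> hom_ordered Q' As"
    by (rule arrange[of _ "if 1 \<rightarrow>\<^bsub>Q'\<^esub> 2 then 1 else 2"]) (rule first_class_interval(2)[OF cls], assumption, rule nz, simp_all)
  moreover have "\<exists>Bs. mset Bs = filter_mset (second_class Q') (mset Xs) \<and> hom_ordered Q' Bs"
    by (rule arrange[of _ "if 1 \<rightarrow>\<^bsub>Q'\<^esub> 2 then 2 else 1"]) (rule first_class_interval(3)[OF cls], assumption, rule nz, simp_all)
  ultimately have ex: "\<exists>As Bs. admissible_orders Q' Xs As Bs"
    unfolding admissible_orders_def by blast
  show ?thesis
    using classes ex algorithm_correct[OF assms(1) P a0 assms(5) chain assms(4,6,7)] by blast
qed

end
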